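(* Let $V,W$ be objects of $\mathcal{O}_{q^{-1}}$. Then $\mathcal{F}_q(V\otimes W)\simeq \mathcal{F}_q(W)\otimes \mathcal{F}_q(V)$ as $U_q(\mathfrak{b})$-modules.
   Context: Algebras. Let $q=e^{h}\in\mathbb{C}^{\times}$ ($h\in\mathbb{C}$) be not a root of unity and $q^r:=e^{hr}$. Everything is over $\mathbb{C}$; $\mathbb{N}=\mathbb{Z}_{\ge 0}$. Let $C=(C_{i,j})_{0\le i,j\le n}$ be an indecomposable Cartan matrix of untwisted affine type, with affine Kac--Moody algebra $\mathfrak{g}$; $d_0,\dots,d_n$ relatively prime positive integers with $(d_iC_{i,j})$ symmetric; $a_0=1,a_1,\dots,a_n\in\mathbb{N}$ relatively prime with $C(a_0,\dots,a_n)^T=0$; $q_i=q^{d_i}$; $I=\{1,\dots,n\}$; $[m]_x=\frac{x^m-x^{-m}}{x-x^{-1}}$, $[m]_x!=\prod_{r=1}^m[r]_x$. The quantum loop algebra $U_q(\mathfrak{g})$ is generated by $\{e_i,f_i,k_i^{\pm1}\}_{i=0}^n$ with relations $k_ik_j=k_jk_i$, $k_i^{\pm1}k_i^{\mp1}=1=k_0^{a_0}\cdots k_n^{a_n}$, $k_ie_jk_i^{-1}=q_i^{C_{i,j}}e_j$, $k_if_jk_i^{-1}=q_i^{-C_{i,j}}f_j$, $[e_i,f_j]=\delta_{i,j}\frac{k_i-k_i^{-1}}{q_i-q_i^{-1}}$ and, for $i\ne j$, $\sum_{r=0}^{1-C_{i,j}}(-1)^r x_i^{(1-C_{i,j}-r)}x_jx_i^{(r)}=0$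 for $x=e$ and for $x=f$, where $x_i^{(r)}=x_i^r/[r]_{q_i}!$. Coproduct: $\Delta(e_i)=e_i\otimes1+k_i\otimes e_i$, $\Delta(f_i)=f_i\otimes k_i^{-1}+1\otimes f_i$, $\Delta(k_i)=k_i\otimes k_i$. The Borel subalgebra $U_q(\mathfrak{b})$ is the (Hopf) subalgebra generated by $\{e_i,k_i^{\pm1}\}_{i=0}^n$. $U_{q^{-1}}(\mathfrak{g})$, $U_{q^{-1}}(\mathfrak{b})$ are the same with $q$ replaced by $q^{-1}$. Category $\mathcal{O}$. Let $\mathfrak{t}^\times=(\mathbb{C}^\times)^I$. For a $U_q(\mathfrak{b})$-module $V$ and $\mu\in\mathfrak{t}^\times$ put $V_\mu=\{v\in V: k_iv=\mu_iv\ \forall i\in I\}$, $P(V)=\{\mu:V_\mu\neq0\}$. Let $\alpha_i,\omega_i$ ($i\in I$) be the simple roots and fundamental weights of the simple Lie algebra $\dot{\mathfrak{g}}$ with Cartan matrix $(C_{i,j})_{i,j\in I}$ ($\alpha_i=\sum_jC_{j,i}\omega_j$), $Q^+=\bigoplus_{i\in I}\mathbb{N}\alpha_i$, $P_{\mathbb{Q}}=\bigoplus_{i\in I}\mathbb{Q}\omega_i$, and $\omega\mapsto\overline{\omega}$ the injective group morphism $P_{\mathbb{Q}}\to\mathfrak{t}^\times$ with $\overline{\omega_i}=(q_i^{\delta_{ij}})_{j\in I}$. Write $\mu\le\nu$ iff $\nu\mu^{-1}\in\overline{Q^+}$ and $D(\lambda)=\{\mu:\mu\le\lambda\}$. $\mathcal{O}_q$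 is the full monoidal subcategory of $U_q(\mathfrak{b})$-modules $V$ with $V=\bigoplus_\mu V_\mu$, $\dim V_\mu<\infty$ for all $\mu$, and $P(V)\subseteq\bigcup_{i=1}^sD(\lambda_i)$ for some $\lambda_1,\dots,\lambda_s\in\mathfrak{t}^\times$. $\mathcal{O}_{q^{-1}}$ is defined in the same way for $U_{q^{-1}}(\mathfrak{b})$, with $q$ replaced by $q^{-1}$ everywhere (including in the order). Functor $\mathcal{F}_q$. There is an algebra isomorphism $\sigma_q:U_q(\mathfrak{g})\to U_{q^{-1}}(\mathfrak{g})$ with $\sigma_q(e_i)=-k_i^{-1}e_i$, $\sigma_q(f_i)=-f_ik_i$, $\sigma_q(k_i)=k_i^{-1}$ for $0\le i\le n$; it restricts to $U_q(\mathfrak{b})\simeq U_{q^{-1}}(\mathfrak{b})$. $\mathcal{F}_q:\mathcal{O}_{q^{-1}}\to\mathcal{O}_q$ is the functor given by pullback of modules along $\sigma_q$ (identity on vector spaces and on morphisms). *)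

theory Defs
  imports Complex_Main "HOL-Library.Poly_Mapping" "HOL-Algebra.Subrings"
begin

section \<open>Complex vector spaces and algebras\<close>

text \<open>
  A complex vector space is a \<open>HOL-Algebra\<close> module over the following ring record. The
  multiplicative fields of the module record are used only if the space is an algebra. (The
  library locale \<open>algebra\<close> is for commutative algebras.)
\<close>

definition complex_ring :: "complex ring" where
  "complex_ring = \<lparr>carrier = UNIV, mult = (*), one = 1, zero = 0, add = (+)\<rparr>"

definition lin_hom ::
    "(complex, 'a, 'm) module_scheme \<Rightarrow> (complex, 'b, 'n) module_scheme \<Rightarrow> ('a \<Rightarrow> 'b) set" where
  "lin_hom V W = {f \<in> carrier V \<rightarrow> carrier W.
     (\<forall>x\<in>carrier V. \<forall>y\<in>carrier V. f (x \<oplus>\<^bsub>V\<^esub> y) = f x \<oplus>\<^bsub>W\<^esub> f y) \<and>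
     (\<forall>c. \<forall>x\<in>carrier V. f (c \<odot>\<^bsub>V\<^esub> x) = c \<odot>\<^bsub>W\<^esub> f x)}"

definition alg_hom ::
    "(complex, 'a, 'm) module_scheme \<Rightarrow> (complex, 'b, 'n) module_scheme \<Rightarrow> ('a \<Rightarrow> 'b) set" where
  "alg_hom A B = ring_hom A B \<inter> lin_hom A B"

definition lin_span :: "(complex, 'a, 'm) module_scheme \<Rightarrow> 'a set \<Rightarrow> 'a set" where
  "lin_span V S = \<Inter>{N. submodule N complex_ring V \<and> S \<subseteq> N}"

definition alg_span :: "(complex, 'a, 'm) module_scheme \<Rightarrow> 'a set \<Rightarrow> 'a set" where
  "alg_span A S = \<Inter>{B. subring B A \<and> submodule B complex_ring A \<and> S \<subseteq> B}"

text \<open>The library quotient \<^const>\<open>FactRing\<close> has no scalar multiplication, and it requires a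
  ring; carrier, zero and addition below are those of \<^const>\<open>FactRing\<close>.\<close>

definition quot_space ::
    "(complex, 'a, 'm) module_scheme \<Rightarrow> 'a set \<Rightarrow> (complex, 'a set) module" where
  "quot_space V N = \<lparr>carrier = a_rcosets\<^bsub>V\<^esub> N, mult = undefined, one = undefined,
     zero = N, add = set_add V, smult = (\<lambda>c Y. \<Union>x\<in>Y. N +>\<^bsub>V\<^esub> (c \<odot>\<^bsub>V\<^esub> x))\<rparr>"

definition quot_algebra ::
    "(complex, 'a, 'm) module_scheme \<Rightarrow> 'a set \<Rightarrow> (complex, 'a set) module" where
  "quot_algebra A J = (quot_space A J)\<lparr>mult := mult (A Quot J), one := one (A Quot J)\<rparr>"


section \<open>Free vector spaces and free algebras\<close>

definition cscale :: "complex \<Rightarrow> ('b \<Rightarrow>\<^sub>0 complex) \<Rightarrow> ('b \<Rightarrow>\<^sub>0 complex)" where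
  "cscale c p = Poly_Mapping.map ((*) c) p"

definition free_space :: "'b set \<Rightarrow> (complex, 'b \<Rightarrow>\<^sub>0 complex) module" where
  "free_space B = \<lparr>carrier = {p. Poly_Mapping.keys p \<subseteq> B}, mult = undefined, one = undefined,
     zero = 0, add = (+), smult = cscale\<rparr>"

text \<open>The free monoid. It is written additively because the convolution product on
  \<^typ>\<open>'b \<Rightarrow>\<^sub>0 complex\<close> requires an additive monoid of exponents.\<close>

datatype 'g free_monoid = Word (letters: "'g list")

instantiation free_monoid :: (type) monoid_add
begin
definition "0 = Word []"
definition "v + w = Word (letters v @ letters w)"
instance
  by standard (simp_all add: zero_free_monoid_def plus_free_monoid_def)
end

type_synonym 'g free_alg = "'g free_monoid \<Rightarrow>\<^sub>0 complex"

definition free_algebra :: "'g set \<Rightarrow> (complex, 'g free_alg) module" where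
  "free_algebra G = (free_space {w. set (letters w) \<subseteq> G})\<lparr>mult := (*), one := 1\<rparr>"

definition var :: "'g \<Rightarrow> 'g free_alg" where
  "var g = Poly_Mapping.single (Word [g]) 1"


section \<open>Tensor products\<close>

definition tensor_rels ::
    "(complex, 'v, 'm) module_scheme \<Rightarrow> (complex, 'w, 'n) module_scheme \<Rightarrow> ('v \<times> 'w \<Rightarrow>\<^sub>0 complex) set"
  where
  "tensor_rels V W = (let s = (\<lambda>v w. Poly_Mapping.single (v, w) 1) in
     {s (v \<oplus>\<^bsub>V\<^esub> v') w - s v w - s v' w | v v' w. v \<in> carrier V \<and> v' \<in> carrier V \<and> w \<in> carrier W}
   \<union> {s v (w \<oplus>\<^bsub>W\<^esub> w') - s v w - s v w' | v w w'. v \<in> carrier V \<and> w \<in> carrier W \<and> w' \<in> carrier W}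
   \<union> {s (c \<odot>\<^bsub>V\<^esub> v) w - cscale c (s v w) | c v w. v \<in> carrier V \<and> w \<in> carrier W}
   \<union> {s v (c \<odot>\<^bsub>W\<^esub> w) - cscale c (s v w) | c v w. v \<in> carrier V \<and> w \<in> carrier W})"

definition tensor_null ::
    "(complex, 'v, 'm) module_scheme \<Rightarrow> (complex, 'w, 'n) module_scheme \<Rightarrow> ('v \<times> 'w \<Rightarrow>\<^sub>0 complex) set"
  where
  "tensor_null V W = lin_span (free_space (carrier V \<times> carrier W)) (tensor_rels V W)"

definition tensor_space ::
    "(complex, 'v, 'm) module_scheme \<Rightarrow> (complex, 'w, 'n) module_scheme \<Rightarrow>
     (complex, ('v \<times> 'w \<Rightarrow>\<^sub>0 complex) set) module" where
  "tensor_space V W = quot_space (free_space (carrier V \<times> carrier W)) (tensor_null V W)"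

definition pure_tensor ::
    "(complex, 'v, 'm) module_scheme \<Rightarrow> (complex, 'w, 'n) module_scheme \<Rightarrow>
     'v \<Rightarrow> 'w \<Rightarrow> ('v \<times> 'w \<Rightarrow>\<^sub>0 complex) set" where
  "pure_tensor V W v w =
     tensor_null V W +>\<^bsub>free_space (carrier V \<times> carrier W)\<^esub> Poly_Mapping.single (v, w) 1"

text \<open>The linear map \<open>V \<otimes> W \<rightarrow> Z\<close> induced by a bilinear map \<open>f\<close> on \<open>V \<times> W\<close>. Here and below,
  membership in \<^const>\<open>extensional\<close> fixes the junk values outside the carrier, so that the
  description is unique.\<close>

definition tensor_lift ::
    "(complex, 'v, 'm) module_scheme \<Rightarrow> (complex, 'w, 'n) module_scheme \<Rightarrow>
     (complex, 'z, 'p) module_scheme \<Rightarrow> ('v \<Rightarrow> 'w \<Rightarrow> 'z) \<Rightarrow> ('v \<times> 'w \<Rightarrow>\<^sub>0 complex) set \<Rightarrow> 'z" where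
  "tensor_lift V W Z f = (THE g. g \<in> extensional (carrier (tensor_space V W)) \<and>
     g \<in> lin_hom (tensor_space V W) Z \<and>
     (\<forall>v\<in>carrier V. \<forall>w\<in>carrier W. g (pure_tensor V W v w) = f v w))"

text \<open>\<open>f \<otimes> g : V \<otimes> W \<rightarrow> V' \<otimes> W'\<close> for linear maps \<open>f : V \<rightarrow> V'\<close> and \<open>g : W \<rightarrow> W'\<close>.\<close>

definition tensor_map ::
    "(complex, 'v, 'm) module_scheme \<Rightarrow> (complex, 'w, 'n) module_scheme \<Rightarrow>
     (complex, 'x, 'p) module_scheme \<Rightarrow> (complex, 'y, 'r) module_scheme \<Rightarrow>
     ('v \<Rightarrow> 'x) \<Rightarrow> ('w \<Rightarrow> 'y) \<Rightarrow>
     ('v \<times> 'w \<Rightarrow>\<^sub>0 complex) set \<Rightarrow> ('x \<times> 'y \<Rightarrow>\<^sub>0 complex) set" where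
  "tensor_map V W V' W' f g =
     tensor_lift V W (tensor_space V' W') (\<lambda>v w. pure_tensor V' W' (f v) (g w))"

text \<open>The tensor product of algebras, with \<open>(a \<otimes> b) (a' \<otimes> b') = a a' \<otimes> b b'\<close>.\<close>

definition tensor_algebra ::
    "(complex, 'a, 'm) module_scheme \<Rightarrow> (complex, 'b, 'n) module_scheme \<Rightarrow>
     (complex, ('a \<times> 'b \<Rightarrow>\<^sub>0 complex) set) module" where
  "tensor_algebra A B = (tensor_space A B)\<lparr>
     mult := (\<lambda>s t. tensor_lift A B (tensor_space A B)
       (\<lambda>a b. tensor_map A B A B (\<lambda>a'. a \<otimes>\<^bsub>A\<^esub> a') (\<lambda>b'. b \<otimes>\<^bsub>B\<^esub> b') t) s),
     one := pure_tensor A B \<one>\<^bsub>A\<^esub> \<one>\<^bsub>B\<^esub>\<rparr>"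


section \<open>Modules over an algebra\<close>

record ('u, 'v) rep = "(complex, 'v) module" +
  act :: "'u \<Rightarrow> 'v \<Rightarrow> 'v"

definition is_rep :: "(complex, 'u, 'm) module_scheme \<Rightarrow> ('u, 'v) rep \<Rightarrow> bool" where
  "is_rep A V \<longleftrightarrow> module complex_ring V \<and>
     (\<forall>x\<in>carrier A. act V x \<in> lin_hom V V) \<and>
     (\<forall>v\<in>carrier V.
        (\<lambda>x. act V x v) \<in> lin_hom A V \<and>
        act V \<one>\<^bsub>A\<^esub> v = v \<and>
        (\<forall>x\<in>carrier A. \<forall>y\<in>carrier A. act V (x \<otimes>\<^bsub>A\<^esub> y) v = act V x (act V y v)))"

definition rep_isomorphic ::
    "(complex, 'u, 'm) module_scheme \<Rightarrow> ('u, 'v) rep \<Rightarrow> ('u, 'w) rep \<Rightarrow> bool" where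
  "rep_isomorphic A V W \<longleftrightarrow> is_rep A V \<and> is_rep A W \<and>
     (\<exists>\<phi>\<in>lin_hom V W. bij_betw \<phi> (carrier V) (carrier W) \<and>
        (\<forall>x\<in>carrier A. \<forall>v\<in>carrier V. \<phi> (act V x v) = act W x (\<phi> v)))"

definition pullback :: "('u \<Rightarrow> 'u') \<Rightarrow> ('u', 'v) rep \<Rightarrow> ('u, 'v) rep" where
  "pullback \<sigma> V = module.extend (module.truncate V) (rep.fields (\<lambda>x. act V (\<sigma> x)))"


section \<open>Untwisted affine Cartan matrices\<close>

text \<open>
  The untwisted affine Dynkin diagrams, with vertices \<open>0, \<dots>, n\<close>. An entry \<open>(i, j, x, y)\<close> is
  an edge between \<open>i\<close> and \<open>j\<close> with \<open>C i j = x\<close> and \<open>C j i = y\<close>, in the convention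
  \<open>C i j = 2 (\<alpha>\<^sub>i, \<alpha>\<^sub>j) / (\<alpha>\<^sub>i, \<alpha>\<^sub>i)\<close>.
\<close>

type_synonym edge = "nat \<times> nat \<times> int \<times> int"

definition chain :: "nat \<Rightarrow> nat \<Rightarrow> edge list" where
  "chain i m = map (\<lambda>k. (k, Suc k, -1, -1)) [i..<m]"

inductive untwisted_diagram :: "nat \<Rightarrow> edge list \<Rightarrow> bool" where
  A1: "untwisted_diagram 1 [(0, 1, -2, -2)]"
| A: "n \<ge> 2 \<Longrightarrow> untwisted_diagram n (chain 0 n @ [(n, 0, -1, -1)])"
| B: "n \<ge> 3 \<Longrightarrow>
    untwisted_diagram n ((0, 2, -1, -1) # chain 1 (n - 1) @ [(n - 1, n, -1, -2)])"
| C: "n \<ge> 2 \<Longrightarrow>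
    untwisted_diagram n ((0, 1, -1, -2) # chain 1 (n - 1) @ [(n - 1, n, -2, -1)])"
| D: "n \<ge> 4 \<Longrightarrow>
    untwisted_diagram n ((0, 2, -1, -1) # chain 1 (n - 1) @ [(n - 2, n, -1, -1)])"
| E6: "untwisted_diagram 6 (chain 1 5 @ [(3, 6, -1, -1), (6, 0, -1, -1)])"
| E7: "untwisted_diagram 7 (chain 0 6 @ [(3, 7, -1, -1)])"
| E8: "untwisted_diagram 8 (chain 0 7 @ [(5, 8, -1, -1)])"
| F4: "untwisted_diagram 4 (chain 0 2 @ [(2, 3, -1, -2), (3, 4, -1, -1)])"
| G2: "untwisted_diagram 2 [(0, 1, -1, -1), (1, 2, -1, -3)]"

definition diagram_matrix :: "edge list \<Rightarrow> nat \<Rightarrow> nat \<Rightarrow> int" where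
  "diagram_matrix es i j = (if i = j then 2 else
     (\<Sum>(k, l, x, y)\<leftarrow>es. if (k, l) = (i, j) then x else if (k, l) = (j, i) then y else 0))"

definition generalized_cartan_matrix :: "nat \<Rightarrow> (nat \<Rightarrow> nat \<Rightarrow> int) \<Rightarrow> bool" where
  "generalized_cartan_matrix n C \<longleftrightarrow>
     (\<forall>i\<le>n. C i i = 2) \<and>
     (\<forall>i\<le>n. \<forall>j\<le>n. i \<noteq> j \<longrightarrow> C i j \<le> 0 \<and> (C i j = 0 \<longrightarrow> C j i = 0))"

definition indecomposable :: "nat \<Rightarrow> (nat \<Rightarrow> nat \<Rightarrow> int) \<Rightarrow> bool" where
  "indecomposable n C \<longleftrightarrow>
     (\<forall>S. S \<noteq> {} \<and> S \<subset> {0..n} \<longrightarrow> (\<exists>i\<in>S. \<exists>j\<in>{0..n} - S. C i j \<noteq> 0))"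

definition untwisted_affine :: "nat \<Rightarrow> (nat \<Rightarrow> nat \<Rightarrow> int) \<Rightarrow> bool" where
  "untwisted_affine n C \<longleftrightarrow> (\<exists>es \<pi>. untwisted_diagram n es \<and> bij_betw \<pi> {0..n} {0..n} \<and>
     (\<forall>i\<le>n. \<forall>j\<le>n. C i j = diagram_matrix es (\<pi> i) (\<pi> j)))"

record affine_datum =
  rank :: nat                         (* n *)
  cartan :: "nat \<Rightarrow> nat \<Rightarrow> int"       (* C i j *)
  symm :: "nat \<Rightarrow> nat"                (* d i *)
  mark :: "nat \<Rightarrow> nat"                (* a i *)

definition untwisted_affine_datum :: "affine_datum \<Rightarrow> bool" where
  "untwisted_affine_datum D \<longleftrightarrow> (let n = rank D; C = cartan D; d = symm D; a = mark D in
     n \<ge> 1 \<and> generalized_cartan_matrix n C \<and> indecomposable n C \<and> untwisted_affine n C \<and>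
     (\<forall>i\<le>n. d i > 0) \<and> Gcd (d ` {0..n}) = 1 \<and>
     (\<forall>i\<le>n. \<forall>j\<le>n. int (d i) * C i j = int (d j) * C j i) \<and>
     a 0 = 1 \<and> Gcd (a ` {0..n}) = 1 \<and>
     (\<forall>i\<le>n. (\<Sum>j=0..n. C i j * int (a j)) = 0))"


section \<open>The quantum loop algebra and its Borel subalgebra\<close>

text \<open>The deformation parameter is \<open>q = exp h\<close>, and \<open>q\<^sup>r\<close> means \<open>exp (h * r)\<close>. All
  constructions take \<open>h\<close> as an argument; those for \<open>q\<^sup>-\<^sup>1\<close> are obtained by passing \<open>- h\<close>.\<close>

definition qq :: "affine_datum \<Rightarrow> complex \<Rightarrow> nat \<Rightarrow> complex" where
  "qq D h i = exp h ^ symm D i"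

definition qint :: "complex \<Rightarrow> nat \<Rightarrow> complex" where
  "qint x m = (x ^ m - inverse x ^ m) / (x - inverse x)"

definition qfact :: "complex \<Rightarrow> nat \<Rightarrow> complex" where
  "qfact x m = (\<Prod>r=1..m. qint x r)"

datatype gen = E nat | F nat | K nat | Kinv nat

type_synonym fal = "gen free_alg"
type_synonym ual = "fal set"

definition gens :: "affine_datum \<Rightarrow> gen set" where
  "gens D = (\<Union>i\<in>{0..rank D}. {E i, F i, K i, Kinv i})"

definition serre :: "affine_datum \<Rightarrow> complex \<Rightarrow> (nat \<Rightarrow> gen) \<Rightarrow> nat \<Rightarrow> nat \<Rightarrow> fal" where
  "serre D h x i j = (let m = nat (1 - cartan D i j);
      dp = (\<lambda>r. cscale (1 / qfact (qq D h i) r) (var (x i) ^ r))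
    in (\<Sum>r=0..m. (-1) ^ r * dp (m - r) * var (x j) * dp r))"

definition relations :: "affine_datum \<Rightarrow> complex \<Rightarrow> fal set" where
  "relations D h = (let n = rank D; C = cartan D; q = qq D h;
      e = (\<lambda>i. var (E i)); f = (\<lambda>i. var (F i)); k = (\<lambda>i. var (K i)); l = (\<lambda>i. var (Kinv i))
    in {k i * k j - k j * k i | i j. i \<le> n \<and> j \<le> n}
     \<union> {k i * l i - 1 | i. i \<le> n}
     \<union> {l i * k i - 1 | i. i \<le> n}
     \<union> {prod_list (map (\<lambda>i. k i ^ mark D i) [0..<Suc n]) - 1}
     \<union> {k i * e j * l i - cscale (q i powi C i j) (e j) | i j. i \<le> n \<and> j \<le> n}
     \<union> {k i * f j * l i - cscale (q i powi (- C i j)) (f j) | i j. i \<le> n \<and> j \<le> n}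
     \<union> {e i * f j - f j * e i -
          (if i = j then cscale (1 / (q i - inverse (q i))) (k i - l i) else 0) | i j. i \<le> n \<and> j \<le> n}
     \<union> {serre D h E i j | i j. i \<le> n \<and> j \<le> n \<and> i \<noteq> j}
     \<union> {serre D h F i j | i j. i \<le> n \<and> j \<le> n \<and> i \<noteq> j})"

definition rel_ideal :: "affine_datum \<Rightarrow> complex \<Rightarrow> fal set" where
  "rel_ideal D h = genideal (free_algebra (gens D)) (relations D h)"

definition Uq :: "affine_datum \<Rightarrow> complex \<Rightarrow> (complex, ual) module" where
  "Uq D h = quot_algebra (free_algebra (gens D)) (rel_ideal D h)"

definition ugen :: "affine_datum \<Rightarrow> complex \<Rightarrow> gen \<Rightarrow> ual" where
  "ugen D h g = rel_ideal D h +>\<^bsub>free_algebra (gens D)\<^esub> var g"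

definition borel :: "affine_datum \<Rightarrow> complex \<Rightarrow> (complex, ual) module" where
  "borel D h = (Uq D h)\<lparr>carrier :=
     alg_span (Uq D h) (ugen D h ` (\<Union>i\<in>{0..rank D}. {E i, K i, Kinv i}))\<rparr>"

definition coproduct :: "affine_datum \<Rightarrow> complex \<Rightarrow> ual \<Rightarrow> (ual \<times> ual \<Rightarrow>\<^sub>0 complex) set" where
  "coproduct D h = (let U = Uq D h; T = tensor_algebra U U; g = ugen D h; p = pure_tensor U U in
     THE \<phi>. \<phi> \<in> extensional (carrier U) \<and> \<phi> \<in> alg_hom U T \<and> (\<forall>i\<le>rank D.
       \<phi> (g (E i)) = p (g (E i)) \<one>\<^bsub>U\<^esub> \<oplus>\<^bsub>T\<^esub> p (g (K i)) (g (E i)) \<and>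
       \<phi> (g (F i)) = p (g (F i)) (g (Kinv i)) \<oplus>\<^bsub>T\<^esub> p \<one>\<^bsub>U\<^esub> (g (F i)) \<and>
       \<phi> (g (K i)) = p (g (K i)) (g (K i))))"

text \<open>The restriction of the coproduct to \<open>U\<^sub>q(\<bb>) \<rightarrow> U\<^sub>q(\<bb>) \<otimes> U\<^sub>q(\<bb>)\<close>. The target is a
  tensor product in its own right, embedded in that of the whole algebra by \<^const>\<open>tensor_map\<close> of
  the inclusions.\<close>

definition borel_coproduct ::
    "affine_datum \<Rightarrow> complex \<Rightarrow> ual \<Rightarrow> (ual \<times> ual \<Rightarrow>\<^sub>0 complex) set" where
  "borel_coproduct D h x = (let U = Uq D h; B = borel D h in
     THE t. t \<in> carrier (tensor_algebra B B) \<and>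
       tensor_map B B U U (\<lambda>y. y) (\<lambda>y. y) t = coproduct D h x)"

text \<open>The isomorphism from \<open>U\<^sub>q(\<gg>)\<close> to the algebra with parameter \<open>q\<^sup>-\<^sup>1\<close>.\<close>

definition sigma :: "affine_datum \<Rightarrow> complex \<Rightarrow> ual \<Rightarrow> ual" where
  "sigma D h = (let U = Uq D h; U' = Uq D (- h); g = ugen D h; g' = ugen D (- h) in
     THE \<phi>. \<phi> \<in> extensional (carrier U) \<and> \<phi> \<in> alg_hom U U' \<and> (\<forall>i\<le>rank D.
       \<phi> (g (E i)) = \<ominus>\<^bsub>U'\<^esub> (g' (Kinv i) \<otimes>\<^bsub>U'\<^esub> g' (E i)) \<and>
       \<phi> (g (F i)) = \<ominus>\<^bsub>U'\<^esub> (g' (F i) \<otimes>\<^bsub>U'\<^esub> g' (K i)) \<and>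
       \<phi> (g (K i)) = g' (Kinv i)))"


section \<open>Category O\<close>

text \<open>Both elements of \<open>P\<^sub>\<rat>\<close>, given by their coefficients on the fundamental weights, and elements
  of \<open>\<tt>\<^sup>\<times>\<close> are functions of which only the values on \<open>{1..rank D}\<close> matter; for \<open>\<tt>\<^sup>\<times>\<close> the
  functions are extensional.\<close>

definition torus :: "affine_datum \<Rightarrow> (nat \<Rightarrow> complex) set" where
  "torus D = {1..rank D} \<rightarrow>\<^sub>E (UNIV - {0})"

definition Qplus :: "affine_datum \<Rightarrow> (nat \<Rightarrow> rat) set" where
  "Qplus D = {\<lambda>j. \<Sum>i=1..rank D. of_nat (m i) * of_int (cartan D j i) | m :: nat \<Rightarrow> nat. True}"

definition overline :: "affine_datum \<Rightarrow> complex \<Rightarrow> (nat \<Rightarrow> rat) \<Rightarrow> nat \<Rightarrow> complex" where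
  "overline D h \<omega> = (\<lambda>j\<in>{1..rank D}. exp (h * (of_nat (symm D j) * of_rat (\<omega> j))))"

definition weight_le ::
    "affine_datum \<Rightarrow> complex \<Rightarrow> (nat \<Rightarrow> complex) \<Rightarrow> (nat \<Rightarrow> complex) \<Rightarrow> bool" where
  "weight_le D h \<mu> \<nu> \<longleftrightarrow> (\<lambda>i\<in>{1..rank D}. \<nu> i * inverse (\<mu> i)) \<in> overline D h ` Qplus D"

definition weight_space ::
    "affine_datum \<Rightarrow> complex \<Rightarrow> (ual, 'v) rep \<Rightarrow> (nat \<Rightarrow> complex) \<Rightarrow> 'v set" where
  "weight_space D h V \<mu> =
     {v \<in> carrier V. \<forall>i\<in>{1..rank D}. act V (ugen D h (K i)) v = \<mu> i \<odot>\<^bsub>V\<^esub> v}"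

definition weights :: "affine_datum \<Rightarrow> complex \<Rightarrow> (ual, 'v) rep \<Rightarrow> (nat \<Rightarrow> complex) set" where
  "weights D h V = {\<mu> \<in> torus D. weight_space D h V \<mu> \<noteq> {\<zero>\<^bsub>V\<^esub>}}"

text \<open>The second conjunct says that \<open>V\<close> is the direct sum of its weight spaces.\<close>

definition category_O :: "affine_datum \<Rightarrow> complex \<Rightarrow> (ual, 'v) rep \<Rightarrow> bool" where
  "category_O D h V \<longleftrightarrow>
     is_rep (borel D h) V \<and>
     (\<forall>v\<in>carrier V. \<exists>!f. f \<in> (\<Pi>\<^sub>E \<mu>\<in>torus D. weight_space D h V \<mu>) \<and>
        finite {\<mu> \<in> torus D. f \<mu> \<noteq> \<zero>\<^bsub>V\<^esub>} \<and>
        v = (\<Oplus>\<^bsub>V\<^esub>\<mu>\<in>{\<mu> \<in> torus D. f \<mu> \<noteq> \<zero>\<^bsub>V\<^esub>}. f \<mu>)) \<and>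
     (\<forall>\<mu>\<in>torus D. \<exists>B. finite B \<and> B \<subseteq> weight_space D h V \<mu> \<and>
        weight_space D h V \<mu> \<subseteq> lin_span V B) \<and>
     (\<exists>L. finite L \<and> L \<subseteq> torus D \<and>
        weights D h V \<subseteq> (\<Union>\<nu>\<in>L. {\<mu> \<in> torus D. weight_le D h \<mu> \<nu>}))"

text \<open>The module \<open>V \<otimes> W\<close>: an element \<open>x\<close> acts by the image of its coproduct under the linear map
  \<open>y \<otimes> z \<mapsto> act V y \<otimes> act W z\<close>.\<close>

definition tensor_rep ::
    "affine_datum \<Rightarrow> complex \<Rightarrow> (ual, 'v) rep \<Rightarrow> (ual, 'w) rep \<Rightarrow>
     (ual, ('v \<times> 'w \<Rightarrow>\<^sub>0 complex) set) rep" where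
  "tensor_rep D h V W = module.extend (tensor_space V W) (rep.fields
     (\<lambda>x m. tensor_lift (borel D h) (borel D h) (tensor_space V W)
        (\<lambda>y z. tensor_map V W V W (act V y) (act W z) m) (borel_coproduct D h x)))"

definition functor_F :: "affine_datum \<Rightarrow> complex \<Rightarrow> (ual, 'v) rep \<Rightarrow> (ual, 'v) rep" where
  "functor_F D h V = pullback (sigma D h) V"

end

theory Submission
  imports Defs
begin

text \<open>
  The isomorphism is the flip \<open>v \<otimes> w \<mapsto> w \<otimes> v\<close>. It intertwines the actions because \<open>\<sigma>\<close> reverses
  the coproduct. For instance, writing \<open>e, k\<close> for \<open>e\<^sub>i, k\<^sub>i\<close> in the algebra for \<open>q\<^sup>-\<^sup>1\<close>,
  \<open>\<Delta>(\<sigma>(e\<^sub>i)) = - (k\<^sup>-\<^sup>1 \<otimes> k\<^sup>-\<^sup>1) (e \<otimes> 1 + k \<otimes> e) = \<sigma>(e\<^sub>i) \<otimes> \<sigma>(k\<^sub>i) + 1 \<otimes> \<sigma>(e\<^sub>i)\<close>,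
  which is the image under \<open>\<sigma> \<otimes> \<sigma>\<close> of \<open>\<Delta>(e\<^sub>i)\<close> with its tensor factors exchanged. The elements
  whose actions the flip intertwines form a subalgebra, so the generators \<open>e\<^sub>i, k\<^sub>i, k\<^sub>i\<^sup>-\<^sup>1\<close> suffice;
  this is \<open>flip_intertwines\<close>.

  Most of the work lies in showing that the maps involved exist. Each of them is described by its
  values on generators or on pure tensors, and says something only if exactly one map has these
  values.

  For linear maps on a tensor product this is its universal property. For \<open>\<Delta>\<close> and \<open>\<sigma>\<close> it is the
  universal property of an algebra given by generators and relations, and the point is that the
  proposed images of the generators satisfy the relations (\<open>qfamily_coproduct\<close>,
  \<open>qfamily_sigma\<close>). The only hard relations are those of Serre. By the q-binomial theorem
  (\<open>gauss_expansion\<close>) the Serre element is, up to a nonzero factor, an iterated q-commutator: the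
  result of applying the operators \<open>w \<mapsto> x w - t w x\<close> to \<open>z\<close>, for \<open>x = e\<^sub>i\<close>, \<open>z = e\<^sub>j\<close> and
  \<open>t = q\<^sub>i\<^sup>c, q\<^sub>i\<^sup>c\<^sup>+\<^sup>2, \<dots>, q\<^sub>i\<^sup>-\<^sup>c\<close> with \<open>c = C\<^sub>i\<^sub>j\<close>. This is where \<open>q\<close> must not be a root of unity.
  For fixed \<open>x\<close> these operators commute. Hence for the coproduct one may apply them in increasing
  order to one summand of \<open>\<Delta>(e\<^sub>j)\<close> and in decreasing order to the other, and then no cross terms
  arise (\<open>serre_sum\<close>). For \<open>\<sigma>\<close> they only pick up powers of \<open>k\<^sub>i\<^sup>-\<^sup>1\<close> and scalars
  (\<open>serre_twist\<close>).

  The coproduct of the Borel subalgebra \<open>B\<close> takes values in \<open>B \<otimes> B\<close>. It is determined by the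
  coproduct of the whole algebra \<open>U\<close> because \<open>B \<otimes> B \<rightarrow> U \<otimes> U\<close> is injective, which follows from
  the existence of a linear retraction of \<open>U\<close> onto \<open>B\<close> (\<open>linear_retraction\<close>).
\<close>

section \<open>Complex vector spaces\<close>

lemma complex_ring_simps [simp]:
  "carrier complex_ring = UNIV" "mult complex_ring = (*)" "one complex_ring = 1"
  "zero complex_ring = 0" "add complex_ring = (+)"
  by (simp_all add: complex_ring_def)

lemma cring_complex_ring: "cring complex_ring"
proof (rule cringI)
  show "abelian_group complex_ring"
    by (rule abelian_groupI) (auto simp: algebra_simps intro: exI[of _ "- x" for x])
  show "comm_monoid complex_ring"
    by (rule comm_monoidI) (auto simp: algebra_simps)
qed (auto simp: algebra_simps)

locale cvec = module complex_ring V for V (structure)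
begin

lemma smult_cl [simp, intro]: "x \<in> carrier V \<Longrightarrow> c \<odot> x \<in> carrier V"
  using smult_closed by simp

lemma smult_add_l: "x \<in> carrier V \<Longrightarrow> (a + b) \<odot> x = a \<odot> x \<oplus> b \<odot> x"
  using smult_l_distr[of a b x] by simp

lemma smult_add_r: "x \<in> carrier V \<Longrightarrow> y \<in> carrier V \<Longrightarrow> c \<odot> (x \<oplus> y) = c \<odot> x \<oplus> c \<odot> y"
  using smult_r_distr[of c x y] by simp

lemma smult_smult: "x \<in> carrier V \<Longrightarrow> a \<odot> (b \<odot> x) = (a * b) \<odot> x"
  using smult_assoc1[of a b x] by simp

lemma smult_1 [simp]: "x \<in> carrier V \<Longrightarrow> 1 \<odot> x = x"
  using smult_one by simp

lemma smult_0 [simp]: "x \<in> carrier V \<Longrightarrow> 0 \<odot> x = \<zero>"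
  using smult_l_null by simp

lemma smult_zero [simp]: "c \<odot> \<zero> = \<zero>"
  using smult_r_null by simp

lemma neg_smult: "x \<in> carrier V \<Longrightarrow> \<ominus> x = (-1) \<odot> x"
proof -
  assume x: "x \<in> carrier V"
  have "(-1) \<odot> x \<oplus> x = (-1 + 1) \<odot> x"
    using x smult_add_l[of x "-1" 1] by simp
  then have "(-1) \<odot> x \<oplus> x = \<zero>" using x by simp
  then show ?thesis using x M.minus_equality by simp
qed

lemma diff_eq_zero: "x \<in> carrier V \<Longrightarrow> y \<in> carrier V \<Longrightarrow> x \<oplus> (-1) \<odot> y = \<zero> \<Longrightarrow> x = y"
  using M.minus_equality[of x "(-1) \<odot> y"] by (simp add: neg_smult smult_smult)

lemma self_diff [simp]: "x \<in> carrier V \<Longrightarrow> x \<oplus> (-1) \<odot> x = \<zero>"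
  using M.r_neg by (simp add: neg_smult)

lemma submoduleI_cvec:
  assumes "H \<subseteq> carrier V" "\<zero> \<in> H" "\<And>x y. x \<in> H \<Longrightarrow> y \<in> H \<Longrightarrow> x \<oplus> y \<in> H"
    "\<And>c x. x \<in> H \<Longrightarrow> c \<odot> x \<in> H"
  shows "submodule H complex_ring V"
  using assms by (intro submoduleI) (auto simp: subset_iff neg_smult)

end

lemma submoduleD:
  assumes "submodule N complex_ring V" "cvec V"
  shows "N \<subseteq> carrier V" "\<zero>\<^bsub>V\<^esub> \<in> N"
    "\<And>x y. x \<in> N \<Longrightarrow> y \<in> N \<Longrightarrow> x \<oplus>\<^bsub>V\<^esub> y \<in> N" "\<And>c x. x \<in> N \<Longrightarrow> c \<odot>\<^bsub>V\<^esub> x \<in> N"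
proof -
  interpret cvec V by fact
  show N: "N \<subseteq> carrier V" "\<And>x y. x \<in> N \<Longrightarrow> y \<in> N \<Longrightarrow> x \<oplus>\<^bsub>V\<^esub> y \<in> N"
      "\<And>c x. x \<in> N \<Longrightarrow> c \<odot>\<^bsub>V\<^esub> x \<in> N"
    using submoduleE[OF assms(1)] by auto
  obtain x where "x \<in> N" using submoduleE(2)[OF assms(1)] by auto
  then have "0 \<odot>\<^bsub>V\<^esub> x \<in> N" using N by blast
  then show "\<zero>\<^bsub>V\<^esub> \<in> N" using N(1) \<open>x \<in> N\<close> smult_0[of x] by (auto simp: subset_iff)
qed

lemma cvecI:
  fixes V (structure)
  assumes "abelian_group V"
    "\<And>c x. x \<in> carrier V \<Longrightarrow> c \<odot> x \<in> carrier V"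
    "\<And>a b x. x \<in> carrier V \<Longrightarrow> (a + b) \<odot> x = a \<odot> x \<oplus> b \<odot> x"
    "\<And>c x y. x \<in> carrier V \<Longrightarrow> y \<in> carrier V \<Longrightarrow> c \<odot> (x \<oplus> y) = c \<odot> x \<oplus> c \<odot> y"
    "\<And>a b x. x \<in> carrier V \<Longrightarrow> (a * b) \<odot> x = a \<odot> (b \<odot> x)"
    "\<And>x. x \<in> carrier V \<Longrightarrow> 1 \<odot> x = x"
  shows "cvec V"
  unfolding cvec_def using assms by (intro moduleI cring_complex_ring) auto

lemma lin_homI:
  assumes "\<And>x. x \<in> carrier V \<Longrightarrow> f x \<in> carrier W"
    "\<And>x y. x \<in> carrier V \<Longrightarrow> y \<in> carrier V \<Longrightarrow> f (x \<oplus>\<^bsub>V\<^esub> y) = f x \<oplus>\<^bsub>W\<^esub> f y"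
    "\<And>c x. x \<in> carrier V \<Longrightarrow> f (c \<odot>\<^bsub>V\<^esub> x) = c \<odot>\<^bsub>W\<^esub> f x"
  shows "f \<in> lin_hom V W"
  using assms by (auto simp: lin_hom_def)

lemma lin_homD:
  assumes "f \<in> lin_hom V W"
  shows "x \<in> carrier V \<Longrightarrow> f x \<in> carrier W"
    "x \<in> carrier V \<Longrightarrow> y \<in> carrier V \<Longrightarrow> f (x \<oplus>\<^bsub>V\<^esub> y) = f x \<oplus>\<^bsub>W\<^esub> f y"
    "x \<in> carrier V \<Longrightarrow> f (c \<odot>\<^bsub>V\<^esub> x) = c \<odot>\<^bsub>W\<^esub> f x"
  using assms by (auto simp: lin_hom_def)

lemma lin_hom_zero:
  assumes "f \<in> lin_hom V W" "cvec V" "cvec W"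
  shows "f \<zero>\<^bsub>V\<^esub> = \<zero>\<^bsub>W\<^esub>"
proof -
  interpret V: cvec V by fact
  interpret W: cvec W by fact
  have "f (0 \<odot>\<^bsub>V\<^esub> \<zero>\<^bsub>V\<^esub>) = 0 \<odot>\<^bsub>W\<^esub> f \<zero>\<^bsub>V\<^esub>"
    by (rule lin_homD(3)[OF assms(1)]) simp
  then show ?thesis using lin_homD(1)[OF assms(1), of "\<zero>\<^bsub>V\<^esub>"] by simp
qed

lemma lin_hom_comp: "f \<in> lin_hom V W \<Longrightarrow> g \<in> lin_hom W Z \<Longrightarrow> (\<lambda>x. g (f x)) \<in> lin_hom V Z"
  by (rule lin_homI) (auto simp: lin_homD)

lemma lin_hom_cong:
  "f \<in> lin_hom V W \<Longrightarrow> cvec V \<Longrightarrow> (\<And>x. x \<in> carrier V \<Longrightarrow> g x = f x) \<Longrightarrow> g \<in> lin_hom V W"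
proof -
  assume f: "f \<in> lin_hom V W" and "cvec V" and eq: "\<And>x. x \<in> carrier V \<Longrightarrow> g x = f x"
  interpret cvec V by fact
  show ?thesis using f eq by (auto simp: lin_hom_def)
qed

lemma submodule_vimage:
  assumes "f \<in> lin_hom V W" "submodule N complex_ring W" "cvec V" "cvec W"
  shows "submodule {x \<in> carrier V. f x \<in> N} complex_ring V"
proof -
  interpret V: cvec V by fact
  show ?thesis
    by (rule V.submoduleI_cvec)
      (auto simp: lin_homD[OF assms(1)] lin_hom_zero[OF assms(1,3,4)] submoduleD[OF assms(2,4)])
qed

lemma (in cvec) submodule_zero: "submodule {\<zero>} complex_ring V"
  by (rule submoduleI_cvec) auto

subsection \<open>Linear spans\<close>

lemma (in cvec) submodule_lin_span:
  assumes "S \<subseteq> carrier V"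
  shows "submodule (lin_span V S) complex_ring V" "S \<subseteq> lin_span V S"
proof -
  have car: "submodule (carrier V) complex_ring V"
    by (rule submoduleI_cvec) auto
  show "submodule (lin_span V S) complex_ring V"
  proof (rule submoduleI_cvec)
    show "lin_span V S \<subseteq> carrier V" using car assms by (auto simp: lin_span_def)
  qed (auto simp: lin_span_def submoduleD[OF _ cvec_axioms])
  show "S \<subseteq> lin_span V S" by (auto simp: lin_span_def)
qed

lemma lin_span_minimal: "submodule N complex_ring V \<Longrightarrow> S \<subseteq> N \<Longrightarrow> lin_span V S \<subseteq> N"
  by (auto simp: lin_span_def)

subsection \<open>Quotient spaces\<close>

locale quot = cvec V + submodule N complex_ring V for V (structure) and N
begin

sublocale N: abelian_subgroup N V
  by (rule abelian_subgroupI3) (auto intro: additive_subgroupI M.a_comm subgroup_axioms M.abelian_group_axioms)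

lemmas N_simps [simp] = submoduleD(2-4)[OF submodule_axioms cvec_axioms]

lemma N_carrier: "x \<in> N \<Longrightarrow> x \<in> carrier V"
  using submoduleD(1)[OF submodule_axioms cvec_axioms] by auto

lemma coset_eq_iff:
  assumes "x \<in> carrier V" "y \<in> carrier V"
  shows "N +> x = N +> y \<longleftrightarrow> x \<oplus> (-1) \<odot> y \<in> N"
proof
  assume "N +> x = N +> y"
  then have "x \<in> N +> y" using N.a_rcos_self assms by auto
  then obtain n where n: "n \<in> N" "x = n \<oplus> y" by (auto simp: a_r_coset_def')
  then have "x \<oplus> (-1) \<odot> y = n"
    using assms N_carrier by (simp add: M.a_assoc)
  then show "x \<oplus> (-1) \<odot> y \<in> N" using n by simp
next
  assume *: "x \<oplus> (-1) \<odot> y \<in> N"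
  have "x = (x \<oplus> (-1) \<odot> y) \<oplus> y"
    using assms M.a_assoc[of x "(-1) \<odot> y" y] M.a_comm[of "(-1) \<odot> y" y] by simp
  then have "x \<in> N +> y" using * by (auto simp: a_r_coset_def')
  then show "N +> x = N +> y"
    using assms M.a_repr_independence[of x N y] subgroup_axioms by simp
qed

lemma quot_add: "x \<in> carrier V \<Longrightarrow> y \<in> carrier V \<Longrightarrow>
    (N +> x) \<oplus>\<^bsub>quot_space V N\<^esub> (N +> y) = N +> (x \<oplus> y)"
  by (simp add: quot_space_def N.a_rcos_sum)

lemma quot_zero: "\<zero>\<^bsub>quot_space V N\<^esub> = N +> \<zero>"
  using N.a_subset by (simp add: quot_space_def)

lemma quot_smult: "x \<in> carrier V \<Longrightarrow> c \<odot>\<^bsub>quot_space V N\<^esub> (N +> x) = N +> (c \<odot> x)"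
proof -
  assume x: "x \<in> carrier V"
  have "N +> (c \<odot> y) = N +> (c \<odot> x)" if "y \<in> N +> x" for y
  proof -
    from that obtain n where n: "n \<in> N" "y = n \<oplus> x" by (auto simp: a_r_coset_def')
    then have y: "y \<in> carrier V" using x N_carrier by auto
    have "N +> y = N +> x" using M.a_repr_independence[of y N x] that x subgroup_axioms by simp
    then have "c \<odot> (y \<oplus> (-1) \<odot> x) \<in> N" using coset_eq_iff x y by simp
    then show ?thesis
      using x y by (subst coset_eq_iff) (auto simp: smult_add_r smult_smult)
  qed
  then have "(\<Union>y\<in>N +> x. N +> (c \<odot> y)) = (\<Union>y\<in>N +> x. N +> (c \<odot> x))"
    by (intro SUP_cong) auto
  moreover have "N +> x \<noteq> {}" using N.a_rcos_self x by blast
  ultimately show ?thesis by (simp add: quot_space_def)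
qed

lemma quot_carrier: "carrier (quot_space V N) = (+>) N ` carrier V"
  by (auto simp: quot_space_def A_RCOSETS_def')

lemma coset_closed [simp]: "x \<in> carrier V \<Longrightarrow> N +> x \<in> carrier (quot_space V N)"
  by (simp add: quot_carrier)

lemma quot_cases:
  assumes "x \<in> carrier (quot_space V N)" obtains a where "a \<in> carrier V" "x = N +> a"
  using assms by (auto simp: quot_carrier)

lemma cvec_quot_space: "cvec (quot_space V N)" (is "cvec ?Q")
proof (rule cvecI)
  show "abelian_group ?Q"
  proof (rule abelian_groupI)
    fix x y assume "x \<in> carrier ?Q" "y \<in> carrier ?Q"
    then show "x \<oplus>\<^bsub>?Q\<^esub> y \<in> carrier ?Q" "x \<oplus>\<^bsub>?Q\<^esub> y = y \<oplus>\<^bsub>?Q\<^esub> x"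
      by (auto elim!: quot_cases simp: quot_add M.a_comm)
  next
    show "\<zero>\<^bsub>?Q\<^esub> \<in> carrier ?Q" by (simp add: quot_zero del: a_coset_add_zero)
  next
    fix x y z assume "x \<in> carrier ?Q" "y \<in> carrier ?Q" "z \<in> carrier ?Q"
    then show "x \<oplus>\<^bsub>?Q\<^esub> y \<oplus>\<^bsub>?Q\<^esub> z = x \<oplus>\<^bsub>?Q\<^esub> (y \<oplus>\<^bsub>?Q\<^esub> z)"
      by (auto elim!: quot_cases simp: quot_add M.a_assoc)
  next
    fix x assume "x \<in> carrier ?Q"
    then obtain a where a: "a \<in> carrier V" "x = N +> a" by (rule quot_cases)
    show "\<zero>\<^bsub>?Q\<^esub> \<oplus>\<^bsub>?Q\<^esub> x = x" using a quot_add[of "\<zero>" a] by (simp add: quot_zero del: a_coset_add_zero)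
    show "\<exists>y\<in>carrier ?Q. y \<oplus>\<^bsub>?Q\<^esub> x = \<zero>\<^bsub>?Q\<^esub>"
      using a by (intro bexI[of _ "N +> (\<ominus> a)"]) (simp_all add: quot_add quot_zero M.l_neg)
  qed
next
  fix a b c :: complex and x y assume "x \<in> carrier ?Q" "y \<in> carrier ?Q"
  then obtain u v where u: "u \<in> carrier V" "x = N +> u" "v \<in> carrier V" "y = N +> v"
    by (metis quot_cases)
  show "c \<odot>\<^bsub>?Q\<^esub> x \<in> carrier ?Q" using u by (simp add: quot_smult)
  show "(a + b) \<odot>\<^bsub>?Q\<^esub> x = a \<odot>\<^bsub>?Q\<^esub> x \<oplus>\<^bsub>?Q\<^esub> b \<odot>\<^bsub>?Q\<^esub> x"
    using u by (simp add: quot_smult quot_add smult_add_l)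
  show "c \<odot>\<^bsub>?Q\<^esub> (x \<oplus>\<^bsub>?Q\<^esub> y) = c \<odot>\<^bsub>?Q\<^esub> x \<oplus>\<^bsub>?Q\<^esub> c \<odot>\<^bsub>?Q\<^esub> y"
    using u by (simp add: quot_smult quot_add smult_add_r)
  show "(a * b) \<odot>\<^bsub>?Q\<^esub> x = a \<odot>\<^bsub>?Q\<^esub> (b \<odot>\<^bsub>?Q\<^esub> x)"
    using u by (simp add: quot_smult smult_smult)
  show "1 \<odot>\<^bsub>?Q\<^esub> x = x" using u by (simp add: quot_smult)
qed

lemma coset_lin_hom: "(+>) N \<in> lin_hom V (quot_space V N)"
  by (rule lin_homI) (auto simp: quot_add quot_smult)

lemma coset_zero_iff: "x \<in> carrier V \<Longrightarrow> N +> x = \<zero>\<^bsub>quot_space V N\<^esub> \<longleftrightarrow> x \<in> N"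
  by (simp add: quot_zero coset_eq_iff)

lemma quot_factor:
  assumes f: "f \<in> lin_hom V W" and ker: "\<And>n. n \<in> N \<Longrightarrow> f n = \<zero>\<^bsub>W\<^esub>" and "cvec W"
  obtains g where "g \<in> lin_hom (quot_space V N) W" "\<And>x. x \<in> carrier V \<Longrightarrow> g (N +> x) = f x"
proof -
  interpret W: cvec W by fact
  define g where "g = (\<lambda>Y. f (SOME x. x \<in> carrier V \<and> N +> x = Y))"
  have g: "g (N +> x) = f x" if x: "x \<in> carrier V" for x
  proof -
    define y where "y = (SOME y. y \<in> carrier V \<and> N +> y = N +> x)"
    have "y \<in> carrier V \<and> N +> y = N +> x" unfolding y_def by (rule someI[of _ x]) (use x in auto)
    then have y: "y \<in> carrier V" "y \<oplus> (-1) \<odot> x \<in> N" using x coset_eq_iff by auto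
    then have "f y \<oplus>\<^bsub>W\<^esub> (-1) \<odot>\<^bsub>W\<^esub> f x = \<zero>\<^bsub>W\<^esub>"
      using ker[OF y(2)] x by (simp add: lin_homD[OF f])
    then have "f y = f x" using W.diff_eq_zero lin_homD(1)[OF f] x y by auto
    then show ?thesis by (simp add: g_def y_def)
  qed
  have "g \<in> lin_hom (quot_space V N) W"
    by (rule lin_homI) (auto simp: quot_carrier quot_add quot_smult g lin_homD[OF f])
  then show ?thesis using g that by blast
qed

end

lemma quotI: "cvec V \<Longrightarrow> submodule N complex_ring V \<Longrightarrow> quot V N"
  by (simp add: quot_def)

subsection \<open>Free vector spaces\<close>

lemma lookup_cscale [simp]: "Poly_Mapping.lookup (cscale c p) b = c * Poly_Mapping.lookup p b"
  by (simp add: cscale_def Poly_Mapping.map.rep_eq when_def)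

lemma cscale_add_l: "cscale (a + b) p = cscale a p + cscale b p"
  by (rule poly_mapping_eqI) (simp add: lookup_add algebra_simps)

lemma cscale_add_r: "cscale c (p + p') = cscale c p + cscale c p'"
  by (rule poly_mapping_eqI) (simp add: lookup_add algebra_simps)

lemma cscale_cscale: "cscale a (cscale b p) = cscale (a * b) p"
  by (rule poly_mapping_eqI) simp

lemma cscale_1 [simp]: "cscale 1 p = p"
  by (rule poly_mapping_eqI) simp

lemma cscale_0 [simp]: "cscale 0 p = 0"
  by (rule poly_mapping_eqI) simp

lemma cscale_zero [simp]: "cscale c 0 = 0"
  by (rule poly_mapping_eqI) simp

lemma cscale_neg: "cscale (-1) p = - p"
  by (rule poly_mapping_eqI) simp

lemma cscale_single [simp]: "cscale c (Poly_Mapping.single b x) = Poly_Mapping.single b (c * x)"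
  by (rule poly_mapping_eqI) (simp add: lookup_single when_def)

lemma keys_cscale: "Poly_Mapping.keys (cscale c p) \<subseteq> Poly_Mapping.keys p"
  by (auto simp: in_keys_iff)

lemma free_space_simps [simp]:
  "carrier (free_space B) = {p. Poly_Mapping.keys p \<subseteq> B}" "zero (free_space B) = 0"
  "add (free_space B) = (+)" "smult (free_space B) = cscale"
  by (simp_all add: free_space_def)

lemma keys_add_subset: "Poly_Mapping.keys p \<subseteq> B \<Longrightarrow> Poly_Mapping.keys p' \<subseteq> B \<Longrightarrow> Poly_Mapping.keys (p + p') \<subseteq> B"
  using keys_add[of p p'] by blast

lemma keys_cscale_subset: "Poly_Mapping.keys p \<subseteq> B \<Longrightarrow> Poly_Mapping.keys (cscale c p) \<subseteq> B"
  using keys_cscale[of c p] by blast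

lemma cvec_free_space: "cvec (free_space B)"
proof (rule cvecI)
  show "abelian_group (free_space B)"
  proof (rule abelian_groupI)
    show "\<exists>y\<in>carrier (free_space B). y \<oplus>\<^bsub>free_space B\<^esub> x = \<zero>\<^bsub>free_space B\<^esub>"
      if "x \<in> carrier (free_space B)" for x
      using that keys_cscale_subset[of x B "-1"] by (intro bexI[of _ "- x"]) (auto simp: cscale_neg)
  qed (simp_all add: keys_add_subset algebra_simps)
qed (simp_all add: keys_cscale_subset cscale_add_l cscale_add_r cscale_cscale)

lemma free_space_induct [consumes 1, case_names zero add single]:
  fixes p :: "'b \<Rightarrow>\<^sub>0 complex"
  assumes "Poly_Mapping.keys p \<subseteq> B" and "P 0"
    and "\<And>p p'. Poly_Mapping.keys p \<subseteq> B \<Longrightarrow> Poly_Mapping.keys p' \<subseteq> B \<Longrightarrow> P p \<Longrightarrow> P p' \<Longrightarrow> P (p + p')"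
    and "\<And>b c. b \<in> B \<Longrightarrow> P (Poly_Mapping.single b c)"
  shows "P p"
proof -
  have eq: "p = (\<Sum>b\<in>Poly_Mapping.keys p. Poly_Mapping.single b (Poly_Mapping.lookup p b))"
  proof (rule poly_mapping_eqI)
    fix k
    show "Poly_Mapping.lookup p k = Poly_Mapping.lookup (\<Sum>b\<in>Poly_Mapping.keys p. Poly_Mapping.single b (Poly_Mapping.lookup p b)) k"
      by (simp add: lookup_sum lookup_single when_def sum.delta in_keys_iff)
  qed
  have "Poly_Mapping.keys (\<Sum>b\<in>S. Poly_Mapping.single b (Poly_Mapping.lookup p b)) \<subseteq> B \<and>
      P (\<Sum>b\<in>S. Poly_Mapping.single b (Poly_Mapping.lookup p b))"
    if "finite S" "S \<subseteq> B" for S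
    using that
  proof (induction S)
    case (insert b S)
    let ?s = "Poly_Mapping.single b (Poly_Mapping.lookup p b)"
    let ?t = "\<Sum>b\<in>S. Poly_Mapping.single b (Poly_Mapping.lookup p b)"
    have "Poly_Mapping.keys ?s \<subseteq> B" "b \<in> B" "Poly_Mapping.keys ?t \<subseteq> B" "P ?t"
      using insert by auto
    then have "Poly_Mapping.keys (?s + ?t) \<subseteq> B" "P (?s + ?t)"
      using assms(3)[of ?s ?t] assms(4)[of b] keys_add_subset[of ?s B ?t] by blast+
    then show ?case using insert.hyps by simp
  qed (use assms in auto)
  from this[of "Poly_Mapping.keys p"] show ?thesis using assms(1) eq by simp
qed

definition free_lift ::
    "(complex, 'z, 'p) module_scheme \<Rightarrow> ('b \<Rightarrow> 'z) \<Rightarrow> ('b \<Rightarrow>\<^sub>0 complex) \<Rightarrow> 'z" where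
  "free_lift Z f p = (\<Oplus>\<^bsub>Z\<^esub>b\<in>Poly_Mapping.keys p. Poly_Mapping.lookup p b \<odot>\<^bsub>Z\<^esub> f b)"

context cvec
begin

lemma free_lift_superset:
  assumes "finite S" "Poly_Mapping.keys p \<subseteq> S" "f \<in> S \<rightarrow> carrier V"
  shows "free_lift V f p = (\<Oplus>b\<in>S. Poly_Mapping.lookup p b \<odot> f b)"
  unfolding free_lift_def
  by (rule M.add.finprod_mono_neutral_cong_left) (use assms in \<open>auto simp: in_keys_iff Pi_iff\<close>)

lemma free_lift_lin_hom:
  assumes f: "f \<in> B \<rightarrow> carrier V"
  shows "free_lift V f \<in> lin_hom (free_space B) V"
proof (rule lin_homI)
  fix p assume "p \<in> carrier (free_space B)"
  then show "free_lift V f p \<in> carrier V"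
    unfolding free_lift_def using f by (intro M.finsum_closed) auto
next
  fix p p' assume p: "p \<in> carrier (free_space B)" "p' \<in> carrier (free_space B)"
  define S where "S = Poly_Mapping.keys p \<union> Poly_Mapping.keys p'"
  have S: "finite S" "Poly_Mapping.keys (p + p') \<subseteq> S" "Poly_Mapping.keys p \<subseteq> S"
    "Poly_Mapping.keys p' \<subseteq> S" "f \<in> S \<rightarrow> carrier V"
    using p f keys_add[of p p'] by (auto simp: S_def)
  have "(\<Oplus>b\<in>S. Poly_Mapping.lookup (p + p') b \<odot> f b)
      = (\<Oplus>b\<in>S. Poly_Mapping.lookup p b \<odot> f b \<oplus> Poly_Mapping.lookup p' b \<odot> f b)"
    by (rule M.finsum_cong') (use S in \<open>auto simp: lookup_add smult_add_l Pi_iff\<close>)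
  also have "\<dots> = (\<Oplus>b\<in>S. Poly_Mapping.lookup p b \<odot> f b) \<oplus> (\<Oplus>b\<in>S. Poly_Mapping.lookup p' b \<odot> f b)"
    by (rule M.finsum_addf) (use S in auto)
  finally show "free_lift V f (p \<oplus>\<^bsub>free_space B\<^esub> p') = free_lift V f p \<oplus> free_lift V f p'"
    using S by (simp add: free_lift_superset[OF S(1)])
next
  fix c p assume p: "p \<in> carrier (free_space B)"
  define S where "S = Poly_Mapping.keys p"
  have S: "finite S" "Poly_Mapping.keys (cscale c p) \<subseteq> S" "Poly_Mapping.keys p \<subseteq> S"
    "f \<in> S \<rightarrow> carrier V"
    using p f keys_cscale[of c p] by (auto simp: S_def)
  have "(\<Oplus>b\<in>S. Poly_Mapping.lookup (cscale c p) b \<odot> f b)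
      = (\<Oplus>b\<in>S. c \<odot> (Poly_Mapping.lookup p b \<odot> f b))"
    by (rule M.finsum_cong') (use S in \<open>auto simp: smult_smult Pi_iff\<close>)
  also have "\<dots> = c \<odot> (\<Oplus>b\<in>S. Poly_Mapping.lookup p b \<odot> f b)"
    using finsum_smult_ldistr[of S c "\<lambda>b. Poly_Mapping.lookup p b \<odot> f b"] S by (simp add: Pi_iff)
  finally show "free_lift V f (c \<odot>\<^bsub>free_space B\<^esub> p) = c \<odot> free_lift V f p"
    using S by (simp add: free_lift_superset[OF S(1)])
qed

lemma free_lift_single:
  assumes "f b \<in> carrier V"
  shows "free_lift V f (Poly_Mapping.single b c) = c \<odot> f b"
proof -
  have "free_lift V f (Poly_Mapping.single b c) = (\<Oplus>b'\<in>{b}. Poly_Mapping.lookup (Poly_Mapping.single b c) b' \<odot> f b')"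
    by (rule free_lift_superset) (use assms in auto)
  then show ?thesis using assms by (simp add: M.finsum_insert)
qed

end

subsection \<open>Linear retractions\<close>

text \<open>Every subspace \<open>N\<close> of \<open>V\<close> is a retract. The space \<open>V\<close> is a quotient of the free space on
  its elements. The latter lies in a vector space on a whole type, which has a linear projection onto
  the preimage of \<open>N\<close>. The projection fixes the kernel of the quotient map and therefore
  descends to \<open>V\<close>.\<close>

lemma (in cvec) linear_retraction:
  assumes N: "submodule N complex_ring V"
  obtains r where "r \<in> lin_hom V (V\<lparr>carrier := N\<rparr>)" "\<And>x. x \<in> N \<Longrightarrow> r x = x"
proof -
  let ?X = "free_space (carrier V)"
  define s where "s = free_lift V (\<lambda>x. x)"
  have s: "s \<in> lin_hom ?X V" unfolding s_def by (rule free_lift_lin_hom) auto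
  note sD = lin_homD[OF s, simplified]
  have sdiff: "Poly_Mapping.keys (p - p') \<subseteq> carrier V \<and> s (p - p') = s p \<oplus> (-1) \<odot> s p'"
    if "Poly_Mapping.keys p \<subseteq> carrier V" "Poly_Mapping.keys p' \<subseteq> carrier V" for p p'
  proof -
    have k: "Poly_Mapping.keys (cscale (-1) p') \<subseteq> carrier V"
      using that(2) by (rule keys_cscale_subset)
    have eq: "p - p' = p + cscale (-1) p'" by (simp add: cscale_neg)
    show ?thesis unfolding eq
      using keys_add_subset[OF that(1) k] sD(2)[OF that(1) k] sD(3)[OF that(2)] by simp
  qed
  interpret vs: vector_space_pair "cscale :: complex \<Rightarrow> ('a \<Rightarrow>\<^sub>0 complex) \<Rightarrow> _" "cscale :: complex \<Rightarrow> ('a \<Rightarrow>\<^sub>0 complex) \<Rightarrow> _"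
    by standard (auto simp: cscale_add_l cscale_add_r cscale_cscale)
  define P where "P = {p. Poly_Mapping.keys p \<subseteq> carrier V \<and> s p \<in> N}"
  have "submodule {p \<in> carrier ?X. s p \<in> N} complex_ring ?X"
    by (rule submodule_vimage[OF s N cvec_free_space cvec_axioms])
  note PD = submoduleD[OF this cvec_free_space, simplified]
  have "vs.vs1.subspace P"
    unfolding vs.vs1.subspace_def using PD by (auto simp: P_def)
  moreover have "Vector_Spaces.linear cscale cscale (\<lambda>p :: 'a \<Rightarrow>\<^sub>0 complex. p)"
    by unfold_locales auto
  ultimately obtain \<pi> where \<pi>: "\<pi> ` UNIV \<subseteq> P" "Vector_Spaces.linear cscale cscale \<pi>" "\<And>p. p \<in> P \<Longrightarrow> \<pi> p = p"
    using vs.linear_exists_left_inverse_on[of "\<lambda>p. p" P] by auto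
  interpret \<pi>: Vector_Spaces.linear cscale cscale \<pi> by fact
  let ?d = "\<lambda>x. Poly_Mapping.single x (1 :: complex)"
  have sd: "s (?d x) = x" if "x \<in> carrier V" for x
    unfolding s_def using that by (subst free_lift_single) auto
  have \<pi>P: "Poly_Mapping.keys (\<pi> p) \<subseteq> carrier V" "s (\<pi> p) \<in> N" for p
    using \<pi>(1) by (auto simp: P_def)
  have ker: "s (\<pi> p) = s (\<pi> p')" if "s p = s p'"
    "Poly_Mapping.keys p \<subseteq> carrier V" "Poly_Mapping.keys p' \<subseteq> carrier V" for p p'
  proof -
    have n0: "s (p - p') = \<zero>" using that sdiff sD(1) by simp
    have "p - p' \<in> P" using that n0 sdiff by (simp add: P_def submoduleD[OF N cvec_axioms])
    then have "\<pi> p - \<pi> p' = p - p'" using \<pi>(3)[of "p - p'"] \<pi>.diff[of p p'] by metis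
    then have "s (\<pi> p) \<oplus> (-1) \<odot> s (\<pi> p') = \<zero>"
      using sdiff[of "\<pi> p" "\<pi> p'"] \<pi>P n0 by simp
    then show ?thesis using diff_eq_zero sD(1) \<pi>P by blast
  qed
  define r where "r = (\<lambda>x. s (\<pi> (?d x)))"
  have "r \<in> lin_hom V (V\<lparr>carrier := N\<rparr>)"
  proof (rule lin_homI)
    fix x y assume xy: "x \<in> carrier V" "y \<in> carrier V"
    have "r (x \<oplus> y) = s (\<pi> (?d x + ?d y))"
      unfolding r_def using xy keys_add[of "?d x" "?d y"] by (intro ker) (auto simp: sd sD)
    then show "r (x \<oplus>\<^bsub>V\<^esub> y) = r x \<oplus>\<^bsub>V\<lparr>carrier := N\<rparr>\<^esub> r y"
      using \<pi>P by (simp add: r_def \<pi>.add sD)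
  next
    fix c x assume x: "x \<in> carrier V"
    have k: "Poly_Mapping.keys (?d x) \<subseteq> carrier V" using x by simp
    have "s (?d (c \<odot> x)) = s (cscale c (?d x))"
      using sD(3)[OF k, of c] sd[OF x] sd[OF smult_cl[OF x], of c] by metis
    then have "r (c \<odot> x) = s (\<pi> (cscale c (?d x)))"
      unfolding r_def by (rule ker) (use x keys_cscale_subset[OF k] in auto)
    then show "r (c \<odot>\<^bsub>V\<^esub> x) = c \<odot>\<^bsub>V\<lparr>carrier := N\<rparr>\<^esub> r x"
      using \<pi>P by (simp add: r_def \<pi>.scale sD del: cscale_single)
  qed (use \<pi>P in \<open>auto simp: r_def\<close>)
  moreover have "r x = x" if "x \<in> N" for x
  proof -
    have "x \<in> carrier V" using that submoduleD(1)[OF N cvec_axioms] by auto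
    then have "?d x \<in> P" using that sd by (auto simp: P_def)
    then show ?thesis using \<pi>(3) sd \<open>x \<in> carrier V\<close> by (simp add: r_def)
  qed
  ultimately show ?thesis using that by blast
qed

lemma cvec_cong:
  assumes "cvec V" "carrier V' = carrier V" "add V' = add V" "zero V' = zero V" "smult V' = smult V"
  shows "cvec V'"
proof -
  interpret cvec V by fact
  show ?thesis
  proof (rule cvecI)
    show "abelian_group V'"
    proof (rule abelian_groupI)
      show "\<exists>y\<in>carrier V'. y \<oplus>\<^bsub>V'\<^esub> x = \<zero>\<^bsub>V'\<^esub>" if "x \<in> carrier V'" for x
        using that assms by (intro bexI[of _ "\<ominus>\<^bsub>V\<^esub> x"]) (simp_all add: M.l_neg)
    qed (simp_all add: assms M.a_ac)
  qed (simp_all add: assms smult_add_l smult_add_r smult_smult)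
qed

section \<open>Tensor products of vector spaces\<close>

definition bilin_hom ::
    "(complex, 'v, 'm) module_scheme \<Rightarrow> (complex, 'w, 'n) module_scheme \<Rightarrow>
     (complex, 'z, 'p) module_scheme \<Rightarrow> ('v \<Rightarrow> 'w \<Rightarrow> 'z) set" where
  "bilin_hom V W Z = {f. (\<forall>v\<in>carrier V. f v \<in> lin_hom W Z) \<and>
     (\<forall>w\<in>carrier W. (\<lambda>v. f v w) \<in> lin_hom V Z)}"

lemma bilin_homI:
  assumes "\<And>v w. v \<in> carrier V \<Longrightarrow> w \<in> carrier W \<Longrightarrow> f v w \<in> carrier Z"
    "\<And>v w w'. v \<in> carrier V \<Longrightarrow> w \<in> carrier W \<Longrightarrow> w' \<in> carrier W \<Longrightarrow>
       f v (w \<oplus>\<^bsub>W\<^esub> w') = f v w \<oplus>\<^bsub>Z\<^esub> f v w'"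
    "\<And>c v w. v \<in> carrier V \<Longrightarrow> w \<in> carrier W \<Longrightarrow> f v (c \<odot>\<^bsub>W\<^esub> w) = c \<odot>\<^bsub>Z\<^esub> f v w"
    "\<And>v v' w. v \<in> carrier V \<Longrightarrow> v' \<in> carrier V \<Longrightarrow> w \<in> carrier W \<Longrightarrow>
       f (v \<oplus>\<^bsub>V\<^esub> v') w = f v w \<oplus>\<^bsub>Z\<^esub> f v' w"
    "\<And>c v w. v \<in> carrier V \<Longrightarrow> w \<in> carrier W \<Longrightarrow> f (c \<odot>\<^bsub>V\<^esub> v) w = c \<odot>\<^bsub>Z\<^esub> f v w"
  shows "f \<in> bilin_hom V W Z"
  using assms by (auto simp: bilin_hom_def intro!: lin_homI)

lemma bilin_homD:
  assumes "f \<in> bilin_hom V W Z"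
  shows "v \<in> carrier V \<Longrightarrow> w \<in> carrier W \<Longrightarrow> f v w \<in> carrier Z"
    "v \<in> carrier V \<Longrightarrow> w \<in> carrier W \<Longrightarrow> w' \<in> carrier W \<Longrightarrow>
       f v (w \<oplus>\<^bsub>W\<^esub> w') = f v w \<oplus>\<^bsub>Z\<^esub> f v w'"
    "v \<in> carrier V \<Longrightarrow> w \<in> carrier W \<Longrightarrow> f v (c \<odot>\<^bsub>W\<^esub> w) = c \<odot>\<^bsub>Z\<^esub> f v w"
    "v \<in> carrier V \<Longrightarrow> v' \<in> carrier V \<Longrightarrow> w \<in> carrier W \<Longrightarrow>
       f (v \<oplus>\<^bsub>V\<^esub> v') w = f v w \<oplus>\<^bsub>Z\<^esub> f v' w"
    "v \<in> carrier V \<Longrightarrow> w \<in> carrier W \<Longrightarrow> f (c \<odot>\<^bsub>V\<^esub> v) w = c \<odot>\<^bsub>Z\<^esub> f v w"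
  using assms by (simp_all add: bilin_hom_def lin_hom_def Pi_iff)

locale tens = V: cvec V + W: cvec W
  for V :: "(complex, 'v, 'm) module_scheme" and W :: "(complex, 'w, 'n) module_scheme"
begin

abbreviation "X \<equiv> free_space (carrier V \<times> carrier W)"
abbreviation "T \<equiv> tensor_space V W"
abbreviation "pt \<equiv> pure_tensor V W"

lemma tensor_rels_carrier: "tensor_rels V W \<subseteq> carrier X"
proof -
  have k: "Poly_Mapping.keys (p - p') \<subseteq> B"
    if "Poly_Mapping.keys p \<subseteq> B" "Poly_Mapping.keys p' \<subseteq> B" for p p' :: "'v \<times> 'w \<Rightarrow>\<^sub>0 complex" and B
    using keys_add_subset[of p B "cscale (-1) p'"] keys_cscale_subset[of p' B "-1"] that
    by (simp add: cscale_neg)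
  show ?thesis
    unfolding tensor_rels_def Let_def
    by (intro subsetI) (elim UnE CollectE exE conjE; simp add: k)
qed

lemma submodule_null: "submodule (tensor_null V W) complex_ring X"
  unfolding tensor_null_def
  by (rule cvec.submodule_lin_span(1)[OF cvec_free_space tensor_rels_carrier])

sublocale Q: quot X "tensor_null V W"
  rewrites "quot_space X (tensor_null V W) = T"
  by (simp_all add: quotI cvec_free_space submodule_null tensor_space_def)

sublocale T: cvec T
  using Q.cvec_quot_space .

lemma rels_null: "r \<in> tensor_rels V W \<Longrightarrow> r \<in> tensor_null V W"
  unfolding tensor_null_def
  using cvec.submodule_lin_span(2)[OF cvec_free_space tensor_rels_carrier] by auto

lemma pure_closed [simp]: "v \<in> carrier V \<Longrightarrow> w \<in> carrier W \<Longrightarrow> pt v w \<in> carrier T"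
  unfolding pure_tensor_def by (rule Q.coset_closed) simp

lemma pure_bilin: "pt \<in> bilin_hom V W T"
proof -
  let ?s = "\<lambda>v w. Poly_Mapping.single (v, w) (1::complex)"
  have eqI: "tensor_null V W +>\<^bsub>X\<^esub> p = tensor_null V W +>\<^bsub>X\<^esub> p'"
    if "p \<in> carrier X" "p' \<in> carrier X" "p - p' \<in> tensor_rels V W" for p p'
    using that Q.coset_eq_iff[of p p'] rels_null by (simp add: cscale_neg)
  have s: "?s v w \<in> carrier X" "cscale c (?s v w) \<in> carrier X"
    if "v \<in> carrier V" "w \<in> carrier W" for c v w using that by auto
  have s_add: "?s v w + ?s v' w' \<in> carrier X"
    if "v \<in> carrier V" "w \<in> carrier W" "v' \<in> carrier V" "w' \<in> carrier W" for v w v' w'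
    using that by (simp add: keys_add_subset)
  show ?thesis
  proof (rule bilin_homI)
    fix v w w' assume *: "v \<in> carrier V" "w \<in> carrier W" "w' \<in> carrier W"
    have "?s v (w \<oplus>\<^bsub>W\<^esub> w') - ?s v w - ?s v w' \<in> tensor_rels V W"
      using * unfolding tensor_rels_def Let_def by blast
    then show "pt v (w \<oplus>\<^bsub>W\<^esub> w') = pt v w \<oplus>\<^bsub>T\<^esub> pt v w'"
      using * unfolding pure_tensor_def
      by (subst Q.quot_add) (simp_all only: s free_space_simps(3) diff_diff_eq, intro eqI s s_add, simp_all)
  next
    fix v v' w assume *: "v \<in> carrier V" "v' \<in> carrier V" "w \<in> carrier W"
    have "?s (v \<oplus>\<^bsub>V\<^esub> v') w - ?s v w - ?s v' w \<in> tensor_rels V W"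
      using * unfolding tensor_rels_def Let_def by blast
    then show "pt (v \<oplus>\<^bsub>V\<^esub> v') w = pt v w \<oplus>\<^bsub>T\<^esub> pt v' w"
      using * unfolding pure_tensor_def
      by (subst Q.quot_add) (simp_all only: s free_space_simps(3) diff_diff_eq, intro eqI s s_add, simp_all)
  next
    fix c v w assume *: "v \<in> carrier V" "w \<in> carrier W"
    have "?s (c \<odot>\<^bsub>V\<^esub> v) w - cscale c (?s v w) \<in> tensor_rels V W"
      using * unfolding tensor_rels_def Let_def by blast
    then show "pt (c \<odot>\<^bsub>V\<^esub> v) w = c \<odot>\<^bsub>T\<^esub> pt v w"
      using * unfolding pure_tensor_def
      by (subst Q.quot_smult) (simp_all only: s free_space_simps(4), intro eqI s, simp_all)
    have "?s v (c \<odot>\<^bsub>W\<^esub> w) - cscale c (?s v w) \<in> tensor_rels V W"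
      using * unfolding tensor_rels_def Let_def by blast
    then show "pt v (c \<odot>\<^bsub>W\<^esub> w) = c \<odot>\<^bsub>T\<^esub> pt v w"
      using * unfolding pure_tensor_def
      by (subst Q.quot_smult) (simp_all only: s free_space_simps(4), intro eqI s, simp_all)
  qed simp
qed

lemmas pureD = bilin_homD[OF pure_bilin]

lemma pure_zero [simp]:
  "w \<in> carrier W \<Longrightarrow> pt \<zero>\<^bsub>V\<^esub> w = \<zero>\<^bsub>T\<^esub>" "v \<in> carrier V \<Longrightarrow> pt v \<zero>\<^bsub>W\<^esub> = \<zero>\<^bsub>T\<^esub>"
  using pureD(5)[of "\<zero>\<^bsub>V\<^esub>" w 0] pureD(3)[of v "\<zero>\<^bsub>W\<^esub>" 0] by simp_all

text \<open>Scalars can be moved into a pure tensor, so sums of pure tensors exhaust the space.\<close>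

lemma tensor_induct [consumes 1, case_names pure add]:
  assumes "t \<in> carrier T"
    and "\<And>v w. v \<in> carrier V \<Longrightarrow> w \<in> carrier W \<Longrightarrow> P (pt v w)"
    and "\<And>t u. t \<in> carrier T \<Longrightarrow> u \<in> carrier T \<Longrightarrow> P t \<Longrightarrow> P u \<Longrightarrow> P (t \<oplus>\<^bsub>T\<^esub> u)"
  shows "P t"
proof -
  from assms(1) obtain p where p: "p \<in> carrier X" "t = tensor_null V W +>\<^bsub>X\<^esub> p"
    by (rule Q.quot_cases)
  from p(1) have "Poly_Mapping.keys p \<subseteq> carrier V \<times> carrier W" by simp
  then have "P (tensor_null V W +>\<^bsub>X\<^esub> p)"
  proof (induction p rule: free_space_induct)
    case zero
    show ?case using assms(2)[of "\<zero>\<^bsub>V\<^esub>" "\<zero>\<^bsub>W\<^esub>"] Q.quot_zero by simp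
  next
    case (add p p')
    then have "P ((tensor_null V W +>\<^bsub>X\<^esub> p) \<oplus>\<^bsub>T\<^esub> (tensor_null V W +>\<^bsub>X\<^esub> p'))"
      by (intro assms(3) Q.coset_closed) simp_all
    then show ?case using add Q.quot_add[of p p'] by simp
  next
    case (single b c)
    obtain v w where b: "b = (v, w)" "v \<in> carrier V" "w \<in> carrier W" using single by auto
    have "P (pt (c \<odot>\<^bsub>V\<^esub> v) w)" using b assms(2) by simp
    also have "pt (c \<odot>\<^bsub>V\<^esub> v) w = c \<odot>\<^bsub>T\<^esub> pt v w" using b by (simp add: pureD)
    also have "\<dots> = tensor_null V W +>\<^bsub>X\<^esub> Poly_Mapping.single b c"
      using b Q.quot_smult[of "Poly_Mapping.single (v, w) 1" c] by (simp add: pure_tensor_def)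
    finally show ?case .
  qed
  then show ?thesis using p by simp
qed

lemma tensor_eqI:
  assumes "g \<in> lin_hom T Z" "g' \<in> lin_hom T Z"
    "\<And>v w. v \<in> carrier V \<Longrightarrow> w \<in> carrier W \<Longrightarrow> g (pt v w) = g' (pt v w)" "t \<in> carrier T"
  shows "g t = g' t"
  using assms(4) by (induction t rule: tensor_induct)
    (simp_all add: assms(3) lin_homD[OF assms(1)] lin_homD[OF assms(2)])

lemma bilin_factor:
  assumes f: "f \<in> bilin_hom V W Z" and "cvec Z"
  obtains g where "g \<in> lin_hom T Z"
    "\<And>v w. v \<in> carrier V \<Longrightarrow> w \<in> carrier W \<Longrightarrow> g (pt v w) = f v w"
proof -
  interpret Z: cvec Z by fact
  note fD = bilin_homD[OF f]
  define k where "k = free_lift Z (\<lambda>(v, w). f v w)"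
  have k: "k \<in> lin_hom X Z" unfolding k_def
    by (rule Z.free_lift_lin_hom) (auto simp: fD)
  note kD = lin_homD[OF k, simplified]
  have ks: "k (Poly_Mapping.single (v, w) c) = c \<odot>\<^bsub>Z\<^esub> f v w"
    if "v \<in> carrier V" "w \<in> carrier W" for v w c
    unfolding k_def using that by (subst Z.free_lift_single) (auto simp: fD)
  have kdiff: "k (p - p') = k p \<oplus>\<^bsub>Z\<^esub> (-1) \<odot>\<^bsub>Z\<^esub> k p'"
    "Poly_Mapping.keys (p - p') \<subseteq> carrier V \<times> carrier W"
    if "Poly_Mapping.keys p \<subseteq> carrier V \<times> carrier W" "Poly_Mapping.keys p' \<subseteq> carrier V \<times> carrier W" for p p'
  proof -
    have eq: "p - p' = p + cscale (-1) p'" by (simp add: cscale_neg)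
    note k = keys_cscale_subset[OF that(2), of "-1"]
    show "k (p - p') = k p \<oplus>\<^bsub>Z\<^esub> (-1) \<odot>\<^bsub>Z\<^esub> k p'" unfolding eq
      using kD(2)[OF that(1) k] kD(3)[OF that(2)] by simp
    show "Poly_Mapping.keys (p - p') \<subseteq> carrier V \<times> carrier W" unfolding eq
      by (rule keys_add_subset[OF that(1) k])
  qed
  \<comment> \<open>This sum is the image of each of the additivity relations.\<close>
  have Zc: "a \<oplus>\<^bsub>Z\<^esub> b \<oplus>\<^bsub>Z\<^esub> (-1) \<odot>\<^bsub>Z\<^esub> a \<oplus>\<^bsub>Z\<^esub> (-1) \<odot>\<^bsub>Z\<^esub> b = \<zero>\<^bsub>Z\<^esub>"
    if "a \<in> carrier Z" "b \<in> carrier Z" for a b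
  proof -
    have "a \<oplus>\<^bsub>Z\<^esub> b \<oplus>\<^bsub>Z\<^esub> (-1) \<odot>\<^bsub>Z\<^esub> a \<oplus>\<^bsub>Z\<^esub> (-1) \<odot>\<^bsub>Z\<^esub> b
        = (a \<oplus>\<^bsub>Z\<^esub> (-1) \<odot>\<^bsub>Z\<^esub> a) \<oplus>\<^bsub>Z\<^esub> (b \<oplus>\<^bsub>Z\<^esub> (-1) \<odot>\<^bsub>Z\<^esub> b)"
      using that by (simp add: Z.M.a_ac del: Z.self_diff)
    then show ?thesis using that by simp
  qed
  have "k r = \<zero>\<^bsub>Z\<^esub>" if "r \<in> tensor_rels V W" for r
    using that unfolding tensor_rels_def Let_def
    by (elim UnE CollectE exE conjE; simp add: kdiff ks fD Zc)
  then have "tensor_rels V W \<subseteq> {p \<in> carrier X. k p \<in> {\<zero>\<^bsub>Z\<^esub>}}"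
    using tensor_rels_carrier by blast
  then have "tensor_null V W \<subseteq> {p \<in> carrier X. k p \<in> {\<zero>\<^bsub>Z\<^esub>}}"
    unfolding tensor_null_def
    by (intro lin_span_minimal submodule_vimage[OF k Z.submodule_zero cvec_free_space Z.cvec_axioms])
  then have "k n = \<zero>\<^bsub>Z\<^esub>" if "n \<in> tensor_null V W" for n using that by auto
  from Q.quot_factor[OF k this Z.cvec_axioms] obtain g where
    g: "g \<in> lin_hom T Z" "\<And>p. p \<in> carrier X \<Longrightarrow> g (tensor_null V W +>\<^bsub>X\<^esub> p) = k p" by blast
  show ?thesis
    by (rule that[OF g(1)]) (simp add: pure_tensor_def g ks fD)
qed

lemma tensor_lift:
  assumes f: "f \<in> bilin_hom V W Z" and Z: "cvec Z"
  shows "tensor_lift V W Z f \<in> lin_hom T Z"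
    "v \<in> carrier V \<Longrightarrow> w \<in> carrier W \<Longrightarrow> tensor_lift V W Z f (pt v w) = f v w"
proof -
  obtain g where g: "g \<in> lin_hom T Z"
    "\<And>v w. v \<in> carrier V \<Longrightarrow> w \<in> carrier W \<Longrightarrow> g (pt v w) = f v w"
    using bilin_factor[OF assms] by blast
  let ?P = "\<lambda>g. g \<in> extensional (carrier T) \<and> g \<in> lin_hom T Z \<and>
     (\<forall>v\<in>carrier V. \<forall>w\<in>carrier W. g (pt v w) = f v w)"
  have P: "?P (restrict g (carrier T))"
    using g(2) lin_hom_cong[OF g(1) T.cvec_axioms, of "restrict g (carrier T)"] by simp
  have "?P (tensor_lift V W Z f)" unfolding tensor_lift_def
  proof (rule theI[of ?P, OF P])
    fix g' assume g': "?P g'"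
    show "g' = restrict g (carrier T)"
    proof (rule extensionalityI[of _ "carrier T"])
      fix t assume "t \<in> carrier T"
      then show "g' t = restrict g (carrier T) t"
        by (rule tensor_eqI[where Z = Z, rotated 3]) (use P g' in \<open>simp_all del: restrict_apply\<close>)
    qed (use g' in auto)
  qed
  then show "tensor_lift V W Z f \<in> lin_hom T Z"
    "v \<in> carrier V \<Longrightarrow> w \<in> carrier W \<Longrightarrow> tensor_lift V W Z f (pt v w) = f v w" by auto
qed

end

lemma tensI: "cvec V \<Longrightarrow> cvec W \<Longrightarrow> tens V W"
  by (simp add: tens_def)

lemma tensor_map:
  assumes f: "f \<in> lin_hom V V'" and g: "g \<in> lin_hom W W'"
    and "cvec V" "cvec W" "cvec V'" "cvec W'"
  shows "tensor_map V W V' W' f g \<in> lin_hom (tensor_space V W) (tensor_space V' W')"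
    "v \<in> carrier V \<Longrightarrow> w \<in> carrier W \<Longrightarrow>
       tensor_map V W V' W' f g (pure_tensor V W v w) = pure_tensor V' W' (f v) (g w)"
proof -
  interpret S: tens V W using assms by (simp add: tensI)
  interpret T: tens V' W' using assms by (simp add: tensI)
  have "(\<lambda>v w. pure_tensor V' W' (f v) (g w)) \<in> bilin_hom V W (tensor_space V' W')"
    by (rule bilin_homI) (simp_all add: lin_homD[OF f] lin_homD[OF g] T.pureD)
  note * = S.tensor_lift[OF this T.T.cvec_axioms]
  show "tensor_map V W V' W' f g \<in> lin_hom (tensor_space V W) (tensor_space V' W')"
    "v \<in> carrier V \<Longrightarrow> w \<in> carrier W \<Longrightarrow>
       tensor_map V W V' W' f g (pure_tensor V W v w) = pure_tensor V' W' (f v) (g w)"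
    unfolding tensor_map_def using * by auto
qed

lemma cvec_sub:
  assumes "cvec V" "submodule N complex_ring V"
  shows "cvec (V\<lparr>carrier := N\<rparr>)"
proof -
  interpret V: cvec V by fact
  show ?thesis unfolding cvec_def
    by (rule submodule.submodule_is_module[OF assms(2) V.module_axioms])
qed

text \<open>A subspace is a retract of the whole space, so the tensor product of two inclusions has a
  left inverse. This makes the tensor square of a subalgebra a subspace of that of the algebra.\<close>

lemma tensor_map_inclusion_inj:
  assumes "cvec V" "cvec W" "submodule M complex_ring V" "submodule N complex_ring W"
  defines "V' \<equiv> V\<lparr>carrier := M\<rparr>" and "W' \<equiv> W\<lparr>carrier := N\<rparr>"
  shows "inj_on (tensor_map V' W' V W (\<lambda>x. x) (\<lambda>x. x)) (carrier (tensor_space V' W'))"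
proof -
  interpret V: cvec V by fact
  interpret W: cvec W by fact
  have V': "cvec V'" and W': "cvec W'" using assms cvec_sub by auto
  interpret T': tens V' W' using V' W' by (rule tensI)
  have sub: "M \<subseteq> carrier V" "N \<subseteq> carrier W" using assms submoduleD(1) by blast+
  obtain r where r: "r \<in> lin_hom V V'" "\<And>x. x \<in> M \<Longrightarrow> r x = x"
    using V.linear_retraction[OF assms(3)] V'_def by metis
  obtain s where s: "s \<in> lin_hom W W'" "\<And>x. x \<in> N \<Longrightarrow> s x = x"
    using W.linear_retraction[OF assms(4)] W'_def by metis
  have i: "(\<lambda>x. x) \<in> lin_hom V' V" "(\<lambda>x. x) \<in> lin_hom W' W"
    using sub by (auto simp: lin_hom_def V'_def W'_def)
  note \<iota> = tensor_map[OF i V' W' assms(1,2)] and \<rho> = tensor_map[OF r(1) s(1) assms(1,2) V' W']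
  have "(\<lambda>t. tensor_map V W V' W' r s (tensor_map V' W' V W (\<lambda>x. x) (\<lambda>x. x) t)) t = (\<lambda>t. t) t"
    if "t \<in> carrier (tensor_space V' W')" for t
  proof (rule T'.tensor_eqI[OF lin_hom_comp[OF \<iota>(1) \<rho>(1)] _ _ that])
    show "(\<lambda>t. t) \<in> lin_hom (tensor_space V' W') (tensor_space V' W')" by (auto simp: lin_hom_def)
    fix v w assume *: "v \<in> carrier V'" "w \<in> carrier W'"
    then have "v \<in> carrier V" "w \<in> carrier W" "r v = v" "s w = w"
      using sub r s by (auto simp: V'_def W'_def)
    then show "tensor_map V W V' W' r s (tensor_map V' W' V W (\<lambda>x. x) (\<lambda>x. x) (pure_tensor V' W' v w))
        = pure_tensor V' W' v w"
      using \<iota>(2)[OF *] \<rho>(2) by simp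
  qed
  then show ?thesis by (metis inj_on_inverseI)
qed

section \<open>Associative algebras\<close>

locale calg = cvec A + ring A for A (structure) +
  assumes smult_mult_l: "x \<in> carrier A \<Longrightarrow> y \<in> carrier A \<Longrightarrow> (c \<odot> x) \<otimes> y = c \<odot> (x \<otimes> y)"
    and smult_mult_r: "x \<in> carrier A \<Longrightarrow> y \<in> carrier A \<Longrightarrow> x \<otimes> (c \<odot> y) = c \<odot> (x \<otimes> y)"

lemma calgI:
  fixes A (structure)
  assumes "cvec A" "\<one> \<in> carrier A"
    and cl: "\<And>x y. x \<in> carrier A \<Longrightarrow> y \<in> carrier A \<Longrightarrow> x \<otimes> y \<in> carrier A"
    and "\<And>x. x \<in> carrier A \<Longrightarrow> \<one> \<otimes> x = x" "\<And>x. x \<in> carrier A \<Longrightarrow> x \<otimes> \<one> = x"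
    and "\<And>x y z. x \<in> carrier A \<Longrightarrow> y \<in> carrier A \<Longrightarrow> z \<in> carrier A \<Longrightarrow> x \<otimes> y \<otimes> z = x \<otimes> (y \<otimes> z)"
    and "\<And>x y z. x \<in> carrier A \<Longrightarrow> y \<in> carrier A \<Longrightarrow> z \<in> carrier A \<Longrightarrow> (x \<oplus> y) \<otimes> z = x \<otimes> z \<oplus> y \<otimes> z"
    and "\<And>x y z. x \<in> carrier A \<Longrightarrow> y \<in> carrier A \<Longrightarrow> z \<in> carrier A \<Longrightarrow> z \<otimes> (x \<oplus> y) = z \<otimes> x \<oplus> z \<otimes> y"
    and "\<And>c x y. x \<in> carrier A \<Longrightarrow> y \<in> carrier A \<Longrightarrow> (c \<odot> x) \<otimes> y = c \<odot> (x \<otimes> y)"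
    and "\<And>c x y. x \<in> carrier A \<Longrightarrow> y \<in> carrier A \<Longrightarrow> x \<otimes> (c \<odot> y) = c \<odot> (x \<otimes> y)"
  shows "calg A"
proof -
  interpret cvec A by fact
  have "ring A"
    by (rule ringI[OF M.abelian_group_axioms monoidI]) (use assms in auto)
  then show ?thesis
    by (intro calg.intro calg_axioms.intro) (use assms in auto)
qed

lemma alg_homI:
  assumes "f \<in> lin_hom A C" "f \<one>\<^bsub>A\<^esub> = \<one>\<^bsub>C\<^esub>"
    "\<And>x y. x \<in> carrier A \<Longrightarrow> y \<in> carrier A \<Longrightarrow> f (x \<otimes>\<^bsub>A\<^esub> y) = f x \<otimes>\<^bsub>C\<^esub> f y"
  shows "f \<in> alg_hom A C"
  using assms by (auto simp: alg_hom_def ring_hom_def lin_hom_def)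

lemma alg_homD:
  assumes "f \<in> alg_hom A C"
  shows "f \<in> lin_hom A C" "f \<one>\<^bsub>A\<^esub> = \<one>\<^bsub>C\<^esub>"
    "x \<in> carrier A \<Longrightarrow> y \<in> carrier A \<Longrightarrow> f (x \<otimes>\<^bsub>A\<^esub> y) = f x \<otimes>\<^bsub>C\<^esub> f y"
    "x \<in> carrier A \<Longrightarrow> f x \<in> carrier C"
    "x \<in> carrier A \<Longrightarrow> y \<in> carrier A \<Longrightarrow> f (x \<oplus>\<^bsub>A\<^esub> y) = f x \<oplus>\<^bsub>C\<^esub> f y"
    "x \<in> carrier A \<Longrightarrow> f (c \<odot>\<^bsub>A\<^esub> x) = c \<odot>\<^bsub>C\<^esub> f x"
  using assms by (auto simp: alg_hom_def ring_hom_def lin_hom_def)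

lemma alg_hom_cong:
  assumes "f \<in> alg_hom A C" "calg A" "\<And>x. x \<in> carrier A \<Longrightarrow> g x = f x"
  shows "g \<in> alg_hom A C"
proof -
  interpret calg A by fact
  show ?thesis
    by (rule alg_homI[OF lin_hom_cong[OF alg_homD(1)[OF assms(1)] cvec_axioms]])
      (auto simp: assms(3) alg_homD[OF assms(1)])
qed

subsection \<open>Generation\<close>

definition subalg :: "'a set \<Rightarrow> (complex, 'a, 'm) module_scheme \<Rightarrow> bool" where
  "subalg S A \<longleftrightarrow> subring S A \<and> submodule S complex_ring A"

context calg
begin

lemma subalgI:
  assumes "S \<subseteq> carrier A" "\<one> \<in> S" "\<And>x y. x \<in> S \<Longrightarrow> y \<in> S \<Longrightarrow> x \<otimes> y \<in> S"
    "\<And>x y. x \<in> S \<Longrightarrow> y \<in> S \<Longrightarrow> x \<oplus> y \<in> S" "\<And>c x. x \<in> S \<Longrightarrow> c \<odot> x \<in> S"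
  shows "subalg S A"
proof -
  have "\<zero> \<in> S" using assms(5)[OF assms(2), of 0] by simp
  then have "submodule S complex_ring A" using assms by (intro submoduleI_cvec)
  moreover have "subring S A"
    using assms by (intro subringI) (auto simp: neg_smult subset_iff)
  ultimately show ?thesis by (simp add: subalg_def)
qed

lemma subalgD:
  assumes "subalg S A"
  shows "S \<subseteq> carrier A" "\<one> \<in> S" "\<And>x y. x \<in> S \<Longrightarrow> y \<in> S \<Longrightarrow> x \<otimes> y \<in> S"
    "\<And>x y. x \<in> S \<Longrightarrow> y \<in> S \<Longrightarrow> x \<oplus> y \<in> S" "\<And>c x. x \<in> S \<Longrightarrow> c \<odot> x \<in> S"
    "submodule S complex_ring A"
  using assms subringE[of S A] submoduleD[OF _ cvec_axioms, of S] by (auto simp: subalg_def)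

lemma alg_span_subalg:
  assumes "S \<subseteq> carrier A"
  shows "subalg (alg_span A S) A" "S \<subseteq> alg_span A S" "alg_span A S \<subseteq> carrier A"
proof -
  have eq: "alg_span A S = \<Inter>{B. subalg B A \<and> S \<subseteq> B}" by (simp add: alg_span_def subalg_def conj_assoc)
  have car: "subalg (carrier A) A" by (rule subalgI) auto
  show *: "alg_span A S \<subseteq> carrier A" using car assms eq by auto
  show "subalg (alg_span A S) A"
    by (rule subalgI[OF *]) (auto simp: eq dest: subalgD)
  show "S \<subseteq> alg_span A S" by (auto simp: eq)
qed

lemma alg_span_minimal: "subalg B A \<Longrightarrow> S \<subseteq> B \<Longrightarrow> alg_span A S \<subseteq> B"
  by (auto simp: alg_span_def subalg_def)

lemma calg_sub:
  assumes "subalg S A" shows "calg (A\<lparr>carrier := S\<rparr>)"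
proof -
  note D = subalgD[OF assms]
  have c: "x \<in> carrier A" if "x \<in> S" for x using that D by auto
  show ?thesis
    by (rule calgI[OF cvec_sub[OF cvec_axioms D(6)]])
      (use D(2-5) in \<open>simp_all add: c smult_mult_l smult_mult_r m_assoc l_distr r_distr\<close>)
qed

end

lemma subalg_equalizer:
  assumes f: "f \<in> alg_hom A C" and g: "g \<in> alg_hom A C" and "calg A"
  shows "subalg {x \<in> carrier A. f x = g x} A"
proof -
  interpret A: calg A by fact
  show ?thesis
    by (rule A.subalgI) (auto simp: alg_homD[OF f] alg_homD[OF g])
qed

lemma alg_hom_eqI:
  assumes "f \<in> alg_hom A C" "g \<in> alg_hom A C" "calg A" "S \<subseteq> carrier A"
    "\<And>s. s \<in> S \<Longrightarrow> f s = g s" "x \<in> alg_span A S"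
  shows "f x = g x"
  using calg.alg_span_minimal[OF assms(3) subalg_equalizer[OF assms(1-3)], of S] assms(4-6) by auto

lemma subalg_vimage:
  assumes f: "f \<in> alg_hom A C" and "calg A" "calg C" "subalg S C"
  shows "subalg {x \<in> carrier A. f x \<in> S} A"
proof -
  interpret A: calg A by fact
  show ?thesis
    by (rule A.subalgI) (auto simp: alg_homD[OF f] calg.subalgD[OF assms(3,4)])
qed

lemma subalg_image:
  assumes f: "f \<in> alg_hom A C" and "calg A" "calg C"
  shows "subalg (f ` carrier A) C"
proof -
  interpret A: calg A by fact
  interpret C: calg C by fact
  note D = alg_homD[OF f]
  show ?thesis
  proof (rule C.subalgI)
    show "\<one>\<^bsub>C\<^esub> \<in> f ` carrier A" using D(2) by (metis A.one_closed imageI)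
  next
    fix x y assume "x \<in> f ` carrier A" "y \<in> f ` carrier A"
    then obtain a b where *: "a \<in> carrier A" "b \<in> carrier A" "x = f a" "y = f b" by auto
    show "x \<otimes>\<^bsub>C\<^esub> y \<in> f ` carrier A" using * D(3)[of a b] by (metis A.m_closed imageI)
    show "x \<oplus>\<^bsub>C\<^esub> y \<in> f ` carrier A" using * D(5)[of a b] by (metis A.M.a_closed imageI)
  next
    fix c x assume "x \<in> f ` carrier A"
    then show "c \<odot>\<^bsub>C\<^esub> x \<in> f ` carrier A" using D(6) by (metis (no_types, lifting) A.smult_cl image_iff)
  qed (auto simp: D)
qed

subsection \<open>Tensor products of algebras\<close>

locale tens_alg = A: calg A + C: calg C
  for A :: "(complex, 'a, 'm) module_scheme" and C :: "(complex, 'b, 'n) module_scheme"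
begin

sublocale tens A C by (rule tensI) unfold_locales

abbreviation "TA \<equiv> tensor_algebra A C"

lemma TA_simps [simp]:
  "carrier TA = carrier T" "zero TA = zero T" "add TA = add T" "smult TA = smult T"
  "one TA = pt \<one>\<^bsub>A\<^esub> \<one>\<^bsub>C\<^esub>"
  by (simp_all add: tensor_algebra_def)

definition left_mult :: "'a \<Rightarrow> 'b \<Rightarrow> ('a \<times> 'b \<Rightarrow>\<^sub>0 complex) set \<Rightarrow> ('a \<times> 'b \<Rightarrow>\<^sub>0 complex) set" where
  "left_mult a c = tensor_map A C A C (\<lambda>a'. a \<otimes>\<^bsub>A\<^esub> a') (\<lambda>c'. c \<otimes>\<^bsub>C\<^esub> c')"

lemma left_mult:
  assumes "a \<in> carrier A" "c \<in> carrier C"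
  shows "left_mult a c \<in> lin_hom T T"
    "a' \<in> carrier A \<Longrightarrow> c' \<in> carrier C \<Longrightarrow> left_mult a c (pt a' c') = pt (a \<otimes>\<^bsub>A\<^esub> a') (c \<otimes>\<^bsub>C\<^esub> c')"
proof -
  have *: "(\<lambda>a'. a \<otimes>\<^bsub>A\<^esub> a') \<in> lin_hom A A" "(\<lambda>c'. c \<otimes>\<^bsub>C\<^esub> c') \<in> lin_hom C C"
    using assms by (auto simp: lin_hom_def A.r_distr C.r_distr A.smult_mult_r C.smult_mult_r)
  note tm = tensor_map[OF * A.cvec_axioms C.cvec_axioms A.cvec_axioms C.cvec_axioms]
  show "left_mult a c \<in> lin_hom T T"
    "a' \<in> carrier A \<Longrightarrow> c' \<in> carrier C \<Longrightarrow> left_mult a c (pt a' c') = pt (a \<otimes>\<^bsub>A\<^esub> a') (c \<otimes>\<^bsub>C\<^esub> c')"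
    unfolding left_mult_def using tm by auto
qed

lemmas left_mult_closed [simp] = lin_homD(1)[OF left_mult(1)]
lemmas left_mult_add = lin_homD(2)[OF left_mult(1)]
lemmas left_mult_smult = lin_homD(3)[OF left_mult(1)]

lemma left_mult_bilin:
  assumes "t \<in> carrier T" shows "(\<lambda>a c. left_mult a c t) \<in> bilin_hom A C T"
proof (rule bilin_homI)
  fix a c c' assume *: "a \<in> carrier A" "c \<in> carrier C" "c' \<in> carrier C"
  show "left_mult a (c \<oplus>\<^bsub>C\<^esub> c') t = left_mult a c t \<oplus>\<^bsub>T\<^esub> left_mult a c' t" using assms
    by (induction t rule: tensor_induct)
      (use * in \<open>auto simp: left_mult left_mult_add C.l_distr pureD T.M.a_ac\<close>)
next
  fix a a' c assume *: "a \<in> carrier A" "a' \<in> carrier A" "c \<in> carrier C"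
  show "left_mult (a \<oplus>\<^bsub>A\<^esub> a') c t = left_mult a c t \<oplus>\<^bsub>T\<^esub> left_mult a' c t" using assms
    by (induction t rule: tensor_induct)
      (use * in \<open>auto simp: left_mult left_mult_add A.l_distr pureD T.M.a_ac\<close>)
next
  fix s a c assume *: "a \<in> carrier A" "c \<in> carrier C"
  show "left_mult (s \<odot>\<^bsub>A\<^esub> a) c t = s \<odot>\<^bsub>T\<^esub> left_mult a c t" using assms
    by (induction t rule: tensor_induct)
      (use * in \<open>auto simp: left_mult left_mult_add A.smult_mult_l pureD T.smult_add_r\<close>)
  show "left_mult a (s \<odot>\<^bsub>C\<^esub> c) t = s \<odot>\<^bsub>T\<^esub> left_mult a c t" using assms
    by (induction t rule: tensor_induct)
      (use * in \<open>auto simp: left_mult left_mult_add C.smult_mult_l pureD T.smult_add_r\<close>)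
qed (use assms in auto)

lemma mult_TA: "s \<otimes>\<^bsub>TA\<^esub> t = tensor_lift A C T (\<lambda>a c. left_mult a c t) s"
  by (simp add: tensor_algebra_def left_mult_def)

lemma mult_lin_l: "t \<in> carrier T \<Longrightarrow> (\<lambda>s. s \<otimes>\<^bsub>TA\<^esub> t) \<in> lin_hom T T"
  unfolding mult_TA using tensor_lift(1)[OF left_mult_bilin T.cvec_axioms] .

lemma mult_pure_l: "t \<in> carrier T \<Longrightarrow> a \<in> carrier A \<Longrightarrow> c \<in> carrier C \<Longrightarrow> pt a c \<otimes>\<^bsub>TA\<^esub> t = left_mult a c t"
  unfolding mult_TA using tensor_lift(2)[OF left_mult_bilin T.cvec_axioms] by simp

lemma mult_pure [simp]:
  "a \<in> carrier A \<Longrightarrow> c \<in> carrier C \<Longrightarrow> a' \<in> carrier A \<Longrightarrow> c' \<in> carrier C \<Longrightarrow>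
    pt a c \<otimes>\<^bsub>TA\<^esub> pt a' c' = pt (a \<otimes>\<^bsub>A\<^esub> a') (c \<otimes>\<^bsub>C\<^esub> c')"
  by (simp add: mult_pure_l left_mult)

lemmas mult_closed = lin_homD(1)[OF mult_lin_l]
lemmas mult_add_l = lin_homD(2)[OF mult_lin_l]
lemmas mult_smult_l = lin_homD(3)[OF mult_lin_l]

lemma mult_lin_r: 
  assumes "s \<in> carrier T" shows "(\<lambda>t. s \<otimes>\<^bsub>TA\<^esub> t) \<in> lin_hom T T"
proof (rule lin_homI)
  fix t u assume tu: "t \<in> carrier T" "u \<in> carrier T"
  show "s \<otimes>\<^bsub>TA\<^esub> (t \<oplus>\<^bsub>T\<^esub> u) = s \<otimes>\<^bsub>TA\<^esub> t \<oplus>\<^bsub>T\<^esub> s \<otimes>\<^bsub>TA\<^esub> u" using assms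
    by (induction s rule: tensor_induct)
      (use tu in \<open>auto simp: mult_pure_l left_mult_add mult_add_l mult_closed T.M.a_ac\<close>)
next
  fix c t assume t: "t \<in> carrier T"
  show "s \<otimes>\<^bsub>TA\<^esub> (c \<odot>\<^bsub>T\<^esub> t) = c \<odot>\<^bsub>T\<^esub> (s \<otimes>\<^bsub>TA\<^esub> t)" using assms
    by (induction s rule: tensor_induct)
      (use t in \<open>auto simp: mult_pure_l left_mult_smult mult_add_l mult_closed T.smult_add_r\<close>)
qed (use assms mult_closed in auto)

lemmas mult_add_r = lin_homD(2)[OF mult_lin_r]
lemmas mult_smult_r = lin_homD(3)[OF mult_lin_r]

lemma cvec_TA: "cvec TA"
  by (rule cvec_cong[OF T.cvec_axioms]) simp_all

lemma TA_assoc: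
  assumes "s \<in> carrier T" "t \<in> carrier T" "u \<in> carrier T"
  shows "s \<otimes>\<^bsub>TA\<^esub> t \<otimes>\<^bsub>TA\<^esub> u = s \<otimes>\<^bsub>TA\<^esub> (t \<otimes>\<^bsub>TA\<^esub> u)"
  using assms(1)
proof (induction s rule: tensor_induct)
  case (pure a c)
  show ?case using assms(2)
  proof (induction t rule: tensor_induct)
    case (pure a' c')
    note * = pure \<open>a \<in> carrier A\<close> \<open>c \<in> carrier C\<close>
    show ?case using assms(3)
    proof (induction u rule: tensor_induct)
      case (pure a'' c'')
      then show ?case using * by (simp add: A.m_assoc C.m_assoc)
    next
      case (add t u)
      then show ?case using * by (simp add: mult_add_r mult_closed)
    qed
  next
    case (add t t')
    then show ?case using pure assms(3) by (simp add: mult_add_r mult_add_l mult_closed)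
  qed
next
  case (add s s')
  then show ?case using assms by (simp add: mult_add_l mult_closed)
qed

lemma TA_one:
  assumes "t \<in> carrier T"
  shows "pt \<one>\<^bsub>A\<^esub> \<one>\<^bsub>C\<^esub> \<otimes>\<^bsub>TA\<^esub> t = t" "t \<otimes>\<^bsub>TA\<^esub> pt \<one>\<^bsub>A\<^esub> \<one>\<^bsub>C\<^esub> = t"
  using assms by (induction t rule: tensor_induct) (auto simp: mult_add_l mult_add_r)

lemma calg_TA: "calg TA"
  by (rule calgI[OF cvec_TA])
    (auto simp: mult_closed TA_one TA_assoc mult_add_l mult_add_r mult_smult_l mult_smult_r)

end

lemma tens_algI: "calg A \<Longrightarrow> calg C \<Longrightarrow> tens_alg A C"
  by (simp add: tens_alg_def)

lemma tensor_map_alg_hom: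
  assumes f: "f \<in> alg_hom A A'" and g: "g \<in> alg_hom C C'"
    and "calg A" "calg C" "calg A'" "calg C'"
  shows "tensor_map A C A' C' f g \<in> alg_hom (tensor_algebra A C) (tensor_algebra A' C')"
proof -
  interpret S: tens_alg A C using assms by (simp add: tens_algI)
  interpret S': tens_alg A' C' using assms by (simp add: tens_algI)
  note tm = tensor_map[OF alg_homD(1)[OF f] alg_homD(1)[OF g] S.A.cvec_axioms S.C.cvec_axioms
      S'.A.cvec_axioms S'.C.cvec_axioms]
  let ?m = "tensor_map A C A' C' f g"
  note D = lin_homD[OF tm(1)]
  have mult: "?m (s \<otimes>\<^bsub>S.TA\<^esub> t) = ?m s \<otimes>\<^bsub>S'.TA\<^esub> ?m t"
    if "s \<in> carrier S.T" "t \<in> carrier S.T" for s t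
    using that(1)
  proof (induction s rule: S.tensor_induct)
    case (pure a c)
    show ?case using that(2)
      by (induction t rule: S.tensor_induct)
        (use pure in \<open>auto simp: tm alg_homD[OF f] alg_homD[OF g] D S.mult_add_r S'.mult_add_r S.mult_closed\<close>)
  next
    case (add s s')
    then show ?case using that(2) by (simp add: S.mult_add_l S'.mult_add_l D S.mult_closed)
  qed
  show ?thesis
  proof (rule alg_homI)
    show "?m \<in> lin_hom S.TA S'.TA" using tm(1) by (simp add: lin_hom_def)
  qed (simp_all add: mult tm alg_homD[OF f] alg_homD[OF g])
qed

section \<open>Free algebras and presentations\<close>

definition word_val :: "(complex, 'a, 'm) module_scheme \<Rightarrow> ('g \<Rightarrow> 'a) \<Rightarrow> 'g free_monoid \<Rightarrow> 'a" where
  "word_val A f w = foldr (\<lambda>g x. f g \<otimes>\<^bsub>A\<^esub> x) (letters w) \<one>\<^bsub>A\<^esub>"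

text \<open>Assignments of values to generators are total functions, so evaluation is defined on the whole
  type of noncommutative polynomials and its rules carry no side conditions.\<close>

definition ev :: "(complex, 'a, 'm) module_scheme \<Rightarrow> ('g \<Rightarrow> 'a) \<Rightarrow> 'g free_alg \<Rightarrow> 'a" where
  "ev A f = free_lift A (word_val A f)"

locale assignment = calg A for A (structure) +
  fixes f :: "'g \<Rightarrow> 'a"
  assumes f_closed [simp, intro]: "f g \<in> carrier A"
begin

lemma word_val_closed [simp]: "word_val A f w \<in> carrier A"
proof -
  have "foldr (\<lambda>g x. f g \<otimes> x) xs \<one> \<in> carrier A" for xs by (induction xs) auto
  then show ?thesis by (simp add: word_val_def)
qed

lemma word_val_add: "word_val A f (v + w) = word_val A f v \<otimes> word_val A f w"
proof -
  have "foldr (\<lambda>g x. f g \<otimes> x) xs \<one> \<in> carrier A" for xs by (induction xs) auto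
  then have "foldr (\<lambda>g x. f g \<otimes> x) (xs @ ys) \<one>
      = foldr (\<lambda>g x. f g \<otimes> x) xs \<one> \<otimes> foldr (\<lambda>g x. f g \<otimes> x) ys \<one>" for xs ys
    by (induction xs) (simp_all add: m_assoc)
  then show ?thesis by (simp add: word_val_def plus_free_monoid_def)
qed

lemma ev_lin_hom: "ev A f \<in> lin_hom (free_space UNIV) A"
  unfolding ev_def by (rule free_lift_lin_hom) auto

lemma ev_closed [simp]: "ev A f p \<in> carrier A"
  using lin_homD(1)[OF ev_lin_hom, of p] by simp

lemma ev_add: "ev A f (p + p') = ev A f p \<oplus> ev A f p'"
  using lin_homD(2)[OF ev_lin_hom, of p p'] by simp

lemma ev_cscale: "ev A f (cscale c p) = c \<odot> ev A f p"
  using lin_homD(3)[OF ev_lin_hom, of p] by simp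

lemma ev_zero: "ev A f 0 = \<zero>"
  using ev_cscale[of 0 0] by simp

lemma ev_uminus: "ev A f (- p) = (-1) \<odot> ev A f p"
  using ev_cscale[of "-1" p] by (simp add: cscale_neg)

lemma ev_diff: "ev A f (p - p') = ev A f p \<oplus> (-1) \<odot> ev A f p'"
  using ev_add[of p "- p'"] by (simp add: ev_uminus)

lemma ev_single: "ev A f (Poly_Mapping.single w c) = c \<odot> word_val A f w"
  unfolding ev_def by (rule free_lift_single) simp

lemma ev_one: "ev A f 1 = \<one>"
proof -
  have "word_val A f 0 = \<one>" by (simp add: word_val_def zero_free_monoid_def)
  then show ?thesis using ev_single[of 0 1] by simp
qed

lemma ev_var: "ev A f (var g) = f g"
  by (simp add: var_def ev_single word_val_def)

lemma ev_mult: "ev A f (p * p') = ev A f p \<otimes> ev A f p'"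
proof -
  have "Poly_Mapping.keys p \<subseteq> UNIV" "Poly_Mapping.keys p' \<subseteq> UNIV" by auto
  then show ?thesis
  proof (induction p rule: free_space_induct)
    case (single w c)
    from single(2) show ?case
    proof (induction p' rule: free_space_induct)
      case (single w' c')
      show ?case
        by (simp add: mult_single ev_single word_val_add smult_mult_l smult_mult_r smult_smult mult.commute)
    qed (simp_all add: ev_zero ev_add r_distr distrib_left)
  qed (simp_all add: ev_zero ev_add l_distr distrib_right)
qed

lemma ev_power: "ev A f (p ^ n) = ev A f p [^] n"
  by (induction n) (simp_all add: ev_one ev_mult power_Suc2 del: power_Suc)

lemmas ev_simps = ev_add ev_cscale ev_zero ev_uminus ev_diff ev_one ev_var ev_mult ev_power

end

lemma assignmentI: "calg A \<Longrightarrow> (\<And>g. f g \<in> carrier A) \<Longrightarrow> assignment A f"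
  by (simp add: assignment_def assignment_axioms_def)

subsection \<open>The free algebra on a set of generators\<close>

lemma free_algebra_simps [simp]:
  "carrier (free_algebra G) = {p. Poly_Mapping.keys p \<subseteq> {w. set (letters w) \<subseteq> G}}"
  "zero (free_algebra G) = 0" "add (free_algebra G) = (+)" "smult (free_algebra G) = cscale"
  "mult (free_algebra G) = (*)" "one (free_algebra G) = 1"
  by (simp_all add: free_algebra_def)

lemma keys_mult_subset:
  assumes "Poly_Mapping.keys p \<subseteq> {w. set (letters w) \<subseteq> G}"
    "Poly_Mapping.keys p' \<subseteq> {w. set (letters w) \<subseteq> G}"
  shows "Poly_Mapping.keys (p * p') \<subseteq> {w. set (letters w) \<subseteq> G}"
proof
  fix w assume "w \<in> Poly_Mapping.keys (p * p')"
  then obtain a b where ab: "w = a + b" "a \<in> Poly_Mapping.keys p" "b \<in> Poly_Mapping.keys p'"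
    using keys_mult[of p p'] by blast
  then have "set (letters a) \<subseteq> G" "set (letters b) \<subseteq> G" using assms by auto
  then show "w \<in> {w. set (letters w) \<subseteq> G}" using ab by (simp add: plus_free_monoid_def)
qed

lemma cscale_eq_mult: "cscale c (p :: 'g free_alg) = Poly_Mapping.single 0 c * p"
  by (simp add: cscale_def mult_map_scale_conv_mult)

lemma cscale_mult_l: "cscale c p * p' = cscale c (p * (p' :: 'g free_alg))"
  by (simp add: cscale_eq_mult mult.assoc)

lemma cscale_mult_r: "p * cscale c p' = cscale c (p * (p' :: 'g free_alg))"
proof -
  have "Poly_Mapping.keys p \<subseteq> UNIV" by simp
  then have "p * Poly_Mapping.single 0 c = Poly_Mapping.single 0 c * p"
    by (induction p rule: free_space_induct)
      (simp_all add: distrib_left distrib_right mult_single mult.commute)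
  then show ?thesis by (simp add: cscale_eq_mult mult.assoc[symmetric])
qed

lemma keys_one_subset: "Poly_Mapping.keys (1 :: 'g free_alg) \<subseteq> {w. set (letters w) \<subseteq> G}"
  by (simp add: zero_free_monoid_def)

lemma calg_free_algebra: "calg (free_algebra G)"
proof (rule calgI)
  show "cvec (free_algebra G)"
    by (rule cvec_cong[OF cvec_free_space[of "{w. set (letters w) \<subseteq> G}"]]) simp_all
qed (simp_all add: keys_mult_subset keys_one_subset algebra_simps cscale_mult_l cscale_mult_r
    del: keys_one)

text \<open>Every element is a linear combination of words, and words are products of variables.\<close>

lemma free_algebra_generated:
  fixes G :: "'g set"
  assumes "subalg S (free_algebra G)" "var ` G \<subseteq> S"
  shows "carrier (free_algebra G) \<subseteq> S"
proof
  interpret calg "free_algebra G" by (rule calg_free_algebra)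
  note D = subalgD[OF assms(1), simplified]
  have word: "set xs \<subseteq> G \<Longrightarrow> Poly_Mapping.single (Word xs) 1 \<in> S" for xs
  proof (induction xs)
    case Nil
    then show ?case using D(2) by (simp add: zero_free_monoid_def[symmetric])
  next
    case (Cons x xs)
    then have "var x * Poly_Mapping.single (Word xs) 1 \<in> S" using assms(2) D(3) by auto
    then show ?case by (simp add: var_def mult_single plus_free_monoid_def)
  qed
  fix p assume "p \<in> carrier (free_algebra G)"
  then have "Poly_Mapping.keys p \<subseteq> {w. set (letters w) \<subseteq> G}" by simp
  then show "p \<in> S"
  proof (induction p rule: free_space_induct)
    case zero
    show ?case using D(5)[OF D(2), of 0] by simp
  next
    case (single w c)
    then show ?case using D(5)[OF word, of "letters w" c] by simp
  qed (use D(4) in auto)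
qed

lemma (in assignment) ev_alg_hom: "ev A f \<in> alg_hom (free_algebra G) A"
  by (rule alg_homI[OF lin_homI]) (simp_all add: ev_simps)

subsection \<open>Quotient algebras\<close>

locale quot_alg = calg A + J: ideal J A for A (structure) and J
begin

text \<open>A multiple \<open>c x\<close> is the product of \<open>c 1\<close> and \<open>x\<close>, so an ideal is a subspace.\<close>

lemma submodule_J: "submodule J complex_ring A"
proof (rule submoduleI_cvec)
  fix c x assume x: "x \<in> J"
  then have "(c \<odot> \<one>) \<otimes> x \<in> J" using J.I_l_closed by simp
  moreover have "x \<in> carrier A" using x J.Icarr by simp
  ultimately show "c \<odot> x \<in> J" by (simp add: smult_mult_l)
qed (use J.Icarr in \<open>auto simp: J.a_closed\<close>)

sublocale Q: quot A J by (rule quotI[OF cvec_axioms submodule_J])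

abbreviation "QA \<equiv> quot_algebra A J"

lemma QA_simps [simp]:
  "carrier QA = carrier (quot_space A J)" "zero QA = zero (quot_space A J)"
  "add QA = add (quot_space A J)" "smult QA = smult (quot_space A J)" "one QA = J +> \<one>"
  by (simp_all add: quot_algebra_def FactRing_def)

lemma mult_QA: "x \<in> carrier A \<Longrightarrow> y \<in> carrier A \<Longrightarrow> (J +> x) \<otimes>\<^bsub>QA\<^esub> (J +> y) = J +> (x \<otimes> y)"
  by (simp add: quot_algebra_def FactRing_def J.rcoset_mult_add)

lemma cvec_QA: "cvec QA"
  by (rule cvec_cong[OF Q.cvec_quot_space]) simp_all

lemma calg_QA: "calg QA"
proof (rule calgI[OF cvec_QA])
  fix x y z :: "'a set" and c assume "x \<in> carrier QA" "y \<in> carrier QA" "z \<in> carrier QA"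
  then obtain a b d where *: "a \<in> carrier A" "x = J +> a" "b \<in> carrier A" "y = J +> b"
    "d \<in> carrier A" "z = J +> d" by (metis Q.quot_cases QA_simps(1))
  show "x \<otimes>\<^bsub>QA\<^esub> y \<in> carrier QA" using * by (simp add: mult_QA)
  show "\<one>\<^bsub>QA\<^esub> \<otimes>\<^bsub>QA\<^esub> x = x" "x \<otimes>\<^bsub>QA\<^esub> \<one>\<^bsub>QA\<^esub> = x" using * by (simp_all add: mult_QA)
  show "x \<otimes>\<^bsub>QA\<^esub> y \<otimes>\<^bsub>QA\<^esub> z = x \<otimes>\<^bsub>QA\<^esub> (y \<otimes>\<^bsub>QA\<^esub> z)" using * by (simp add: mult_QA m_assoc)
  show "(x \<oplus>\<^bsub>QA\<^esub> y) \<otimes>\<^bsub>QA\<^esub> z = x \<otimes>\<^bsub>QA\<^esub> z \<oplus>\<^bsub>QA\<^esub> y \<otimes>\<^bsub>QA\<^esub> z"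
    "z \<otimes>\<^bsub>QA\<^esub> (x \<oplus>\<^bsub>QA\<^esub> y) = z \<otimes>\<^bsub>QA\<^esub> x \<oplus>\<^bsub>QA\<^esub> z \<otimes>\<^bsub>QA\<^esub> y"
    using * by (simp_all add: mult_QA Q.quot_add l_distr r_distr)
  show "(c \<odot>\<^bsub>QA\<^esub> x) \<otimes>\<^bsub>QA\<^esub> y = c \<odot>\<^bsub>QA\<^esub> (x \<otimes>\<^bsub>QA\<^esub> y)"
    "x \<otimes>\<^bsub>QA\<^esub> (c \<odot>\<^bsub>QA\<^esub> y) = c \<odot>\<^bsub>QA\<^esub> (x \<otimes>\<^bsub>QA\<^esub> y)"
    using * by (simp_all add: mult_QA Q.quot_smult smult_mult_l smult_mult_r)
qed simp

lemma coset_alg_hom: "(+>) J \<in> alg_hom A QA"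
proof (rule alg_homI)
  show "(+>) J \<in> lin_hom A QA" using Q.coset_lin_hom by (simp add: lin_hom_def)
qed (simp_all add: mult_QA)

lemma alg_hom_factor:
  assumes f: "f \<in> alg_hom A C" and ker: "\<And>n. n \<in> J \<Longrightarrow> f n = \<zero>\<^bsub>C\<^esub>" and "calg C"
  obtains g where "g \<in> alg_hom QA C" "\<And>x. x \<in> carrier A \<Longrightarrow> g (J +> x) = f x"
proof -
  interpret C: calg C by fact
  obtain g where g: "g \<in> lin_hom (quot_space A J) C" "\<And>x. x \<in> carrier A \<Longrightarrow> g (J +> x) = f x"
    using Q.quot_factor[OF alg_homD(1)[OF f] ker C.cvec_axioms] by blast
  have "g \<in> alg_hom QA C"
  proof (rule alg_homI)
    show "g \<in> lin_hom QA C" using g(1) by (simp add: lin_hom_def)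
    show "g \<one>\<^bsub>QA\<^esub> = \<one>\<^bsub>C\<^esub>" using g(2) by (simp add: alg_homD[OF f])
    fix x y assume "x \<in> carrier QA" "y \<in> carrier QA"
    then obtain a b where "a \<in> carrier A" "x = J +> a" "b \<in> carrier A" "y = J +> b"
      by (metis Q.quot_cases QA_simps(1))
    then show "g (x \<otimes>\<^bsub>QA\<^esub> y) = g x \<otimes>\<^bsub>C\<^esub> g y"
      using g(2) by (simp add: mult_QA alg_homD[OF f])
  qed
  then show ?thesis using g(2) that by blast
qed

end

lemma ideal_kernel:
  assumes f: "f \<in> alg_hom A C" and "calg A" "calg C"
  shows "ideal {x \<in> carrier A. f x = \<zero>\<^bsub>C\<^esub>} A"
proof -
  interpret A: calg A by fact
  interpret C: calg C by fact
  note D = alg_homD[OF f]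
  have "submodule {x \<in> carrier A. f x \<in> {\<zero>\<^bsub>C\<^esub>}} complex_ring A"
    by (rule submodule_vimage[OF D(1) C.submodule_zero A.cvec_axioms C.cvec_axioms])
  then have "subgroup {x \<in> carrier A. f x = \<zero>\<^bsub>C\<^esub>} (add_monoid A)"
    by (simp add: submodule_def)
  then show ?thesis
    by (rule idealI[OF A.ring_axioms]) (auto simp: D)
qed

section \<open>The quantum loop algebra as a presented algebra\<close>

lemma relations_carrier: "relations D h \<subseteq> carrier (free_algebra (gens D))"
proof -
  interpret calg "free_algebra (gens D)" by (rule calg_free_algebra)
  let ?S = "{p :: fal. Poly_Mapping.keys p \<subseteq> {w. set (letters w) \<subseteq> gens D}}"
  have v: "var (E i) \<in> ?S" "var (F i) \<in> ?S" "var (K i) \<in> ?S" "var (Kinv i) \<in> ?S" if "i \<le> rank D" for i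
    using that by (auto simp: var_def gens_def)
  have c: "1 \<in> ?S" "0 \<in> ?S" "\<And>p p'. p \<in> ?S \<Longrightarrow> p' \<in> ?S \<Longrightarrow> p + p' \<in> ?S"
    "\<And>p p'. p \<in> ?S \<Longrightarrow> p' \<in> ?S \<Longrightarrow> p * p' \<in> ?S" "\<And>c p. p \<in> ?S \<Longrightarrow> cscale c p \<in> ?S"
    using keys_one_subset[of "gens D"] by (simp_all add: keys_add_subset keys_mult_subset keys_cscale_subset del: keys_one)
  have d: "p - p' \<in> ?S" if "p \<in> ?S" "p' \<in> ?S" for p p'
    using c(3)[OF that(1) c(5)[OF that(2), of "-1"]] by (simp only: cscale_neg) simp
  have pw: "p ^ n \<in> ?S" if "p \<in> ?S" for p n
    using that by (induction n) (simp_all only: power_0 power_Suc c)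
  have pl: "prod_list xs \<in> ?S" if "set xs \<subseteq> ?S" for xs
    using that by (induction xs) (simp_all only: prod_list.Nil prod_list.Cons c set_simps insert_subset)
  have sm: "sum g I \<in> ?S" if "\<And>i. i \<in> I \<Longrightarrow> g i \<in> ?S" for g and I :: "nat set"
    using that by (induction I rule: infinite_finite_induct) (simp_all only: sum.infinite sum.empty sum.insert c insert_iff simp_thms)
  have m1: "(-1) ^ r \<in> ?S" for r
    using pw[OF d[OF c(2,1)]] by simp
  have sr: "serre D h x i j \<in> ?S" if "var (x i) \<in> ?S" "var (x j) \<in> ?S" for x i j
    unfolding serre_def Let_def by (intro sm c pw m1 that)
  have ifc: "(if b then p else p') \<in> ?S" if "p \<in> ?S" "p' \<in> ?S" for b p p'
    using that by simp
  have pk: "prod_list (map (\<lambda>i. var (K i) ^ mark D i) [0..<Suc (rank D)]) \<in> ?S"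
    by (intro pl) (auto intro!: pw v simp del: upt_Suc)
  have "r \<in> ?S" if "r \<in> relations D h" for r
    using that unfolding relations_def Let_def
    by (elim UnE CollectE exE conjE singletonE; hypsubst)
      (intro ifc d c v sr pk; assumption)+
  then show ?thesis by auto
qed

text \<open>The family of generators, extended by \<open>1\<close> to a total assignment.\<close>

definition rel_gen :: "affine_datum \<Rightarrow> complex \<Rightarrow> gen \<Rightarrow> ual" where
  "rel_gen D h g = (if g \<in> gens D then ugen D h g else \<one>\<^bsub>Uq D h\<^esub>)"

locale presentation =
  fixes D :: affine_datum and h :: complex
begin

abbreviation "FA \<equiv> free_algebra (gens D)"
abbreviation "J \<equiv> rel_ideal D h"
abbreviation "U \<equiv> Uq D h"

sublocale FA: calg FA by (rule calg_free_algebra)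

lemma ideal_J: "ideal J FA"
  unfolding rel_ideal_def by (rule FA.genideal_ideal[OF relations_carrier])

sublocale QA: quot_alg FA J
  rewrites "quot_algebra FA J = U"
  by (simp_all add: quot_alg_def FA.calg_axioms ideal_J Uq_def)

declare QA.QA_simps [simp del]

sublocale U: calg U by (rule QA.calg_QA)

lemma var_carrier: "g \<in> gens D \<Longrightarrow> var g \<in> carrier FA"
  by (simp add: var_def)

lemma ugen_closed [simp]: "g \<in> gens D \<Longrightarrow> ugen D h g \<in> carrier U"
  unfolding ugen_def by (rule alg_homD(4)[OF QA.coset_alg_hom var_carrier])

lemma rel_gen_closed [simp]: "rel_gen D h g \<in> carrier U"
  by (simp add: rel_gen_def)

lemma U_generated: "alg_span U (ugen D h ` gens D) = carrier U"
proof
  have sub: "ugen D h ` gens D \<subseteq> carrier U" by auto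
  show "alg_span U (ugen D h ` gens D) \<subseteq> carrier U" by (rule U.alg_span_subalg[OF sub])
  have "subalg {p \<in> carrier FA. J +>\<^bsub>FA\<^esub> p \<in> alg_span U (ugen D h ` gens D)} FA"
    by (rule subalg_vimage[OF QA.coset_alg_hom FA.calg_axioms U.calg_axioms U.alg_span_subalg(1)[OF sub]])
  moreover have "var ` gens D \<subseteq> {p \<in> carrier FA. J +>\<^bsub>FA\<^esub> p \<in> alg_span U (ugen D h ` gens D)}"
    using U.alg_span_subalg(2)[OF sub] by (auto simp: var_carrier ugen_def simp del: free_algebra_simps)
  ultimately have "carrier FA \<subseteq> {p \<in> carrier FA. J +>\<^bsub>FA\<^esub> p \<in> alg_span U (ugen D h ` gens D)}"
    by (rule free_algebra_generated)
  then show "carrier U \<subseteq> alg_span U (ugen D h ` gens D)"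
    by (auto simp: QA.Q.quot_carrier QA.QA_simps simp del: free_algebra_simps)
qed

lemma U_hom_eqI:
  assumes "\<phi> \<in> alg_hom U A" "\<psi> \<in> alg_hom U A"
    "\<And>g. g \<in> gens D \<Longrightarrow> \<phi> (ugen D h g) = \<psi> (ugen D h g)" "x \<in> carrier U"
  shows "\<phi> x = \<psi> x"
proof (rule alg_hom_eqI[OF assms(1,2) U.calg_axioms])
  show "ugen D h ` gens D \<subseteq> carrier U" by auto
  show "x \<in> alg_span U (ugen D h ` gens D)" using assms(4) U_generated by simp
qed (use assms(3) in auto)

text \<open>Evaluation at the generators is the quotient map, since both are homomorphisms that agree on
  variables.\<close>

lemma U_relation: 
  assumes "r \<in> relations D h" shows "ev U (rel_gen D h) r = \<zero>\<^bsub>U\<^esub>"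
proof -
  interpret as: assignment U "rel_gen D h"
    by (rule assignmentI[OF U.calg_axioms]) simp
  have "subalg {p \<in> carrier FA. ev U (rel_gen D h) p = J +>\<^bsub>FA\<^esub> p} FA"
    by (rule subalg_equalizer[OF as.ev_alg_hom QA.coset_alg_hom FA.calg_axioms])
  moreover have "var ` gens D \<subseteq> {p \<in> carrier FA. ev U (rel_gen D h) p = J +>\<^bsub>FA\<^esub> p}"
    by (auto simp: var_carrier as.ev_var rel_gen_def ugen_def simp del: free_algebra_simps)
  ultimately have "carrier FA \<subseteq> {p \<in> carrier FA. ev U (rel_gen D h) p = J +>\<^bsub>FA\<^esub> p}"
    by (rule free_algebra_generated)
  then have "ev U (rel_gen D h) r = J +>\<^bsub>FA\<^esub> r" using assms relations_carrier by blast
  also have "\<dots> = \<zero>\<^bsub>quot_space FA J\<^esub>"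
  proof (subst QA.Q.coset_zero_iff)
    show "r \<in> carrier FA" using assms relations_carrier by blast
    show "r \<in> J" using assms FA.genideal_self[OF relations_carrier] unfolding rel_ideal_def by blast
  qed
  finally show ?thesis by (simp add: QA.QA_simps)
qed

lemma U_hom_exists:
  assumes "calg A" and f: "\<And>g. f g \<in> carrier A"
    and rel: "\<And>r. r \<in> relations D h \<Longrightarrow> ev A f r = \<zero>\<^bsub>A\<^esub>"
  obtains \<phi> where "\<phi> \<in> alg_hom U A" "\<And>g. g \<in> gens D \<Longrightarrow> \<phi> (ugen D h g) = f g"
proof -
  interpret A: calg A by fact
  interpret as: assignment A f by (rule assignmentI[OF A.calg_axioms f])
  have "J \<subseteq> {p \<in> carrier FA. ev A f p = \<zero>\<^bsub>A\<^esub>}"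
    unfolding rel_ideal_def
    by (rule FA.genideal_minimal[OF ideal_kernel[OF as.ev_alg_hom FA.calg_axioms A.calg_axioms]])
      (use rel relations_carrier in blast)
  then have "ev A f n = \<zero>\<^bsub>A\<^esub>" if "n \<in> J" for n using that by auto
  from QA.alg_hom_factor[OF as.ev_alg_hom this A.calg_axioms] obtain \<phi> where
    \<phi>: "\<phi> \<in> alg_hom U A" "\<And>p. p \<in> carrier FA \<Longrightarrow> \<phi> (J +>\<^bsub>FA\<^esub> p) = ev A f p" by blast
  show ?thesis
    by (rule that[OF \<phi>(1)]) (simp add: ugen_def \<phi>(2) var_carrier as.ev_var del: free_algebra_simps)
qed

end

section \<open>Iterated q-commutators and the quantum Serre relations\<close>

text \<open>The classical adjoint action \<open>w \<mapsto> x w - k w k\<^sup>-\<^sup>1 x\<close> of \<open>x = e\<^sub>i\<close> is of this form on an element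
  \<open>w\<close> with \<open>k w k\<^sup>-\<^sup>1 = t w\<close>.\<close>

definition qcomm :: "(complex, 'a, 'm) module_scheme \<Rightarrow> 'a \<Rightarrow> complex \<Rightarrow> 'a \<Rightarrow> 'a" where
  "qcomm A x t w = x \<otimes>\<^bsub>A\<^esub> w \<oplus>\<^bsub>A\<^esub> (- t) \<odot>\<^bsub>A\<^esub> (w \<otimes>\<^bsub>A\<^esub> x)"

definition qcomms :: "(complex, 'a, 'm) module_scheme \<Rightarrow> 'a \<Rightarrow> complex list \<Rightarrow> 'a \<Rightarrow> 'a" where
  "qcomms A x ts w = fold (qcomm A x) ts w"

definition geo :: "complex \<Rightarrow> complex \<Rightarrow> nat \<Rightarrow> complex list" where
  "geo t Q m = map (\<lambda>r. t * Q ^ r) [0..<m]"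

lemma geo_0 [simp]: "geo t Q 0 = []"
  by (simp add: geo_def)

lemma geo_Suc: "geo t Q (Suc m) = t # geo (t * Q) Q m"
  by (rule nth_equalityI) (auto simp: geo_def nth_Cons' nth_append power_eq_if mult_ac simp del: upt_Suc)

lemma geo_snoc: "geo t Q (Suc m) = geo t Q m @ [t * Q ^ m]"
  by (simp add: geo_def)

lemma rev_geo:
  assumes "Q \<noteq> 0" shows "rev (geo t Q m) = geo (t * Q ^ (m - 1)) (1 / Q) m"
proof (rule nth_equalityI)
  fix i assume "i < length (rev (geo t Q m))"
  then have i: "i < m" by (simp add: geo_def)
  have "Q ^ (m - 1) = Q ^ (m - Suc i) * Q ^ i" using i by (simp add: power_add[symmetric])
  then have "t * Q ^ (m - Suc i) = t * Q ^ (m - 1) * (1 / Q) ^ i"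
    using assms by (simp add: field_simps)
  then show "rev (geo t Q m) ! i = geo (t * Q ^ (m - 1)) (1 / Q) m ! i"
    using i by (simp add: geo_def rev_nth)
qed (simp add: geo_def)

text \<open>Commutation up to a scalar. All relations between the \<open>k\<^sub>i\<close> and the other generators are of
  this form, and it is stable under products, sums and inverses, as the following lemmas show.\<close>

definition scomm :: "(complex, 'a, 'm) module_scheme \<Rightarrow> 'a \<Rightarrow> 'a \<Rightarrow> complex \<Rightarrow> bool" where
  "scomm A k w t \<longleftrightarrow> k \<otimes>\<^bsub>A\<^esub> w = t \<odot>\<^bsub>A\<^esub> (w \<otimes>\<^bsub>A\<^esub> k)"

context calg
begin

lemma scommD: "scomm A k w t \<Longrightarrow> k \<otimes> w = t \<odot> (w \<otimes> k)"
  by (simp add: scomm_def)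

lemma scomm_l:
  assumes "scomm A k w t" "k \<in> carrier A" "w \<in> carrier A" "z \<in> carrier A"
  shows "k \<otimes> (w \<otimes> z) = t \<odot> (w \<otimes> (k \<otimes> z))"
proof -
  have "k \<otimes> (w \<otimes> z) = (k \<otimes> w) \<otimes> z" using assms by (simp add: m_assoc)
  also have "\<dots> = t \<odot> (w \<otimes> (k \<otimes> z))"
    using assms by (simp only: scommD) (simp add: smult_mult_l m_assoc)
  finally show ?thesis .
qed

lemma scomm_mult_r:
  assumes "scomm A k w t" "scomm A k v s" "k \<in> carrier A" "w \<in> carrier A" "v \<in> carrier A"
  shows "scomm A k (w \<otimes> v) (t * s)"
  unfolding scomm_def using assms
  by (simp add: scomm_l m_assoc scommD[OF assms(2)] smult_mult_r smult_smult)

lemma scomm_mult_l: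
  assumes "scomm A k w t" "scomm A l w s" "k \<in> carrier A" "w \<in> carrier A" "l \<in> carrier A"
  shows "scomm A (k \<otimes> l) w (t * s)"
  unfolding scomm_def using assms
  by (simp add: m_assoc scommD[OF assms(2)] smult_mult_r scomm_l smult_smult mult.commute)

lemma scomm_add:
  assumes "scomm A k w t" "scomm A k v t" "k \<in> carrier A" "w \<in> carrier A" "v \<in> carrier A"
  shows "scomm A k (w \<oplus> v) t"
  using assms by (simp add: scomm_def r_distr l_distr smult_add_r)

lemma scomm_smult:
  assumes "scomm A k w t" "k \<in> carrier A" "w \<in> carrier A"
  shows "scomm A k (c \<odot> w) t" "scomm A (c \<odot> k) w t"
  using assms by (simp_all add: scomm_def smult_mult_l smult_mult_r smult_smult mult.commute)

lemma scomm_sym: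
  assumes "scomm A k w t" "t \<noteq> 0" "k \<in> carrier A" "w \<in> carrier A"
  shows "scomm A w k (1 / t)"
  using assms by (simp add: scomm_def smult_smult)

lemma scomm_one: "w \<in> carrier A \<Longrightarrow> scomm A \<one> w 1" "w \<in> carrier A \<Longrightarrow> scomm A w \<one> 1"
  by (simp_all add: scomm_def)

lemma scomm_inverse:
  assumes "scomm A k w t" "t \<noteq> 0" "k \<otimes> l = \<one>" "l \<otimes> k = \<one>"
    "k \<in> carrier A" "l \<in> carrier A" "w \<in> carrier A"
  shows "scomm A l w (1 / t)"
proof -
  have "l \<otimes> (k \<otimes> (w \<otimes> l)) = t \<odot> (l \<otimes> (w \<otimes> (k \<otimes> l)))"
    using assms(5-7) by (simp add: scomm_l[OF assms(1)] smult_mult_r)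
  then have "w \<otimes> l = t \<odot> (l \<otimes> w)"
    using assms(3-7) m_assoc[of l k "w \<otimes> l"] by simp
  then show ?thesis using assms by (simp add: scomm_def smult_smult)
qed

lemma qcomm_closed [simp]: "x \<in> carrier A \<Longrightarrow> w \<in> carrier A \<Longrightarrow> qcomm A x t w \<in> carrier A"
  by (simp add: qcomm_def)

lemma qcomms_Nil [simp]: "qcomms A x [] w = w"
  by (simp add: qcomms_def)

lemma qcomms_Cons [simp]: "qcomms A x (t # ts) w = qcomms A x ts (qcomm A x t w)"
  by (simp add: qcomms_def)

lemma qcomms_append: "qcomms A x (ts @ us) w = qcomms A x us (qcomms A x ts w)"
  by (simp add: qcomms_def)

lemma qcomms_closed [simp]: "x \<in> carrier A \<Longrightarrow> w \<in> carrier A \<Longrightarrow> qcomms A x ts w \<in> carrier A"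
  by (induction ts arbitrary: w) simp_all

lemma qcomm_add: "x \<in> carrier A \<Longrightarrow> v \<in> carrier A \<Longrightarrow> w \<in> carrier A \<Longrightarrow>
    qcomm A x t (v \<oplus> w) = qcomm A x t v \<oplus> qcomm A x t w"
  by (simp add: qcomm_def r_distr l_distr smult_add_r M.a_ac)

lemma qcomms_add: "x \<in> carrier A \<Longrightarrow> v \<in> carrier A \<Longrightarrow> w \<in> carrier A \<Longrightarrow>
    qcomms A x ts (v \<oplus> w) = qcomms A x ts v \<oplus> qcomms A x ts w"
  by (induction ts arbitrary: v w) (simp_all add: qcomm_add)

lemma qcomm_smult: "x \<in> carrier A \<Longrightarrow> w \<in> carrier A \<Longrightarrow>
    qcomm A x t (c \<odot> w) = c \<odot> qcomm A x t w"
  by (simp add: qcomm_def smult_mult_r smult_mult_l smult_add_r smult_smult mult.commute)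

lemma qcomms_smult: "x \<in> carrier A \<Longrightarrow> w \<in> carrier A \<Longrightarrow>
    qcomms A x ts (c \<odot> w) = c \<odot> qcomms A x ts w"
  by (induction ts arbitrary: w) (simp_all add: qcomm_smult)

lemma qcomms_smult_l:
  assumes x: "x \<in> carrier A" and "w \<in> carrier A"
  shows "qcomms A (c \<odot> x) ts w = c ^ length ts \<odot> qcomms A x ts w"
  using assms(2)
proof (induction ts arbitrary: w)
  case (Cons t ts)
  have "qcomm A (c \<odot> x) t w = c \<odot> qcomm A x t w"
    using x Cons.prems by (simp add: qcomm_def smult_mult_r smult_mult_l smult_add_r smult_smult mult.commute)
  then show ?case using Cons x by (simp add: qcomms_smult smult_smult mult.commute)
qed simp

lemma qcomm_commute: "x \<in> carrier A \<Longrightarrow> w \<in> carrier A \<Longrightarrow>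
    qcomm A x s (qcomm A x t w) = qcomm A x t (qcomm A x s w)"
  by (simp add: qcomm_def r_distr l_distr smult_add_r smult_mult_r smult_mult_l smult_smult m_assoc
      M.a_ac mult.commute)

lemma qcomms_qcomm: "x \<in> carrier A \<Longrightarrow> w \<in> carrier A \<Longrightarrow>
    qcomms A x ts (qcomm A x t w) = qcomm A x t (qcomms A x ts w)"
proof (induction ts arbitrary: w)
  case (Cons s ts)
  then show ?case using Cons.IH[of "qcomm A x s w"] by (simp add: qcomm_commute[of x w s t])
qed simp

lemma qcomms_rev: "x \<in> carrier A \<Longrightarrow> w \<in> carrier A \<Longrightarrow> qcomms A x (rev ts) w = qcomms A x ts w"
  by (induction ts arbitrary: w) (simp_all add: qcomms_append qcomms_qcomm)

lemma scomm_qcomm: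
  assumes "scomm A k x a" "scomm A k w b" "k \<in> carrier A" "x \<in> carrier A" "w \<in> carrier A"
  shows "scomm A k (qcomm A x t w) (a * b)"
  unfolding qcomm_def
  using scomm_mult_r[OF assms(1,2)] scomm_mult_r[OF assms(2,1)] assms
  by (intro scomm_add scomm_smult) (simp_all add: mult.commute)

lemma scomm_qcomm_l:
  assumes "scomm A x k a" "scomm A w k b" "k \<in> carrier A" "x \<in> carrier A" "w \<in> carrier A"
  shows "scomm A (qcomm A x t w) k (a * b)"
  using scomm_mult_l[OF assms(1,2)] scomm_mult_l[OF assms(2,1)] assms
  by (simp add: scomm_def qcomm_def r_distr l_distr smult_add_r smult_mult_l smult_mult_r smult_smult mult_ac)

lemma add_cancel_middle:
  assumes "a \<in> carrier A" "b \<in> carrier A" "p \<in> carrier A"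
  shows "(a \<oplus> t \<odot> p) \<oplus> (- t) \<odot> (b \<oplus> p) = a \<oplus> (- t) \<odot> b"
proof -
  have "(a \<oplus> t \<odot> p) \<oplus> (- t) \<odot> (b \<oplus> p) = (a \<oplus> (- t) \<odot> b) \<oplus> (t \<odot> p \<oplus> (- t) \<odot> p)"
    using assms by (simp add: smult_add_r M.a_ac)
  also have "t \<odot> p \<oplus> (- t) \<odot> p = \<zero>"
    using assms smult_add_l[of p t "- t"] by simp
  finally show ?thesis using assms by simp
qed

text \<open>Moving \<open>k y\<close> past \<open>w\<close> produces the scalar \<open>t\<close>, so the contribution of \<open>k y\<close> to the
  q-commutator with parameter \<open>t\<close> cancels. The new element commutes with \<open>k\<close> up to \<open>t Q\<close>, which is
  the next parameter of the list.\<close>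

lemma qcomms_sum_first:
  assumes "x \<in> carrier A" "y \<in> carrier A" "k \<in> carrier A" "w \<in> carrier A"
    and "scomm A k x Q" "scomm A y x 1" "scomm A k w t" "scomm A y w 1"
  shows "qcomms A (x \<oplus> k \<otimes> y) (geo t Q m) w = qcomms A x (geo t Q m) w"
  using assms(4,7,8)
proof (induction m arbitrary: w t)
  case (Suc m)
  have kyw: "k \<otimes> (y \<otimes> w) = t \<odot> (w \<otimes> (k \<otimes> y))"
    using Suc.prems assms(1-3) by (simp add: scommD[OF Suc.prems(3)] scomm_l)
  have "qcomm A (x \<oplus> k \<otimes> y) t w
      = (x \<otimes> w \<oplus> t \<odot> (w \<otimes> (k \<otimes> y))) \<oplus> (- t) \<odot> (w \<otimes> x \<oplus> w \<otimes> (k \<otimes> y))"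
    using assms(1-3) Suc.prems by (simp add: qcomm_def l_distr r_distr m_assoc kyw)
  also have "\<dots> = qcomm A x t w"
    using assms(1-3) Suc.prems by (simp add: add_cancel_middle qcomm_def)
  finally have step: "qcomm A (x \<oplus> k \<otimes> y) t w = qcomm A x t w" .
  have "scomm A k (qcomm A x t w) (t * Q)" "scomm A y (qcomm A x t w) 1"
    using scomm_qcomm[OF assms(5) Suc.prems(2)] scomm_qcomm[OF assms(6) Suc.prems(3)]
      assms(1-3) Suc.prems by (simp_all add: mult.commute)
  then show ?case using Suc.IH[of "qcomm A x t w" "t * Q"] assms(1) Suc.prems(1)
    by (simp add: geo_Suc step)
qed simp

text \<open>Moving \<open>x\<close> past \<open>g w\<close> produces the scalar \<open>\<tau>\<close>, so for \<open>t \<tau> = 1\<close> the contribution of \<open>x\<close>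
  cancels. What remains is \<open>k g\<close> times a q-commutator with \<open>y\<close>. For \<open>k g\<close> the scalar is \<open>Q \<tau>\<close>, which
  matches the next parameter \<open>t / Q\<close>.\<close>

lemma qcomms_sum_second:
  assumes "x \<in> carrier A" "y \<in> carrier A" "k \<in> carrier A" "w \<in> carrier A" "g \<in> carrier A"
    and "scomm A k x Q" "Q \<noteq> 0" "scomm A g x \<tau>" "t * \<tau> = 1" "scomm A g k 1"
    and "scomm A y x 1" "scomm A y k 1" "scomm A y g 1" "scomm A w x 1" "scomm A w k 1"
  shows "\<exists>G\<in>carrier A. qcomms A (x \<oplus> k \<otimes> y) (geo t (1 / Q) m) (g \<otimes> w)
      = G \<otimes> qcomms A y (geo t (1 / Q) m) w"
  using assms(4,5,8-10,13-15)
proof (induction m arbitrary: w g t \<tau>)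
  case 0
  then show ?case by auto
next
  case (Suc m)
  note [simp] = assms(1-3) Suc.prems(1,2)
  let ?P = "x \<otimes> (g \<otimes> w)"
  have gwx: "(g \<otimes> w) \<otimes> x = \<tau> \<odot> ?P"
    by (simp add: m_assoc scommD[OF \<open>scomm A w x 1\<close>] scomm_l[OF \<open>scomm A g x \<tau>\<close>])
  have gwky: "(g \<otimes> w) \<otimes> (k \<otimes> y) = (k \<otimes> g) \<otimes> (w \<otimes> y)"
    by (simp add: m_assoc scomm_l[OF \<open>scomm A w k 1\<close>] scomm_l[OF \<open>scomm A g k 1\<close>])
  have kygw: "(k \<otimes> y) \<otimes> (g \<otimes> w) = (k \<otimes> g) \<otimes> (y \<otimes> w)"
    by (simp add: m_assoc scomm_l[OF \<open>scomm A y g 1\<close>])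
  have "(- t) \<odot> (\<tau> \<odot> ?P) = (-1) \<odot> ?P" using \<open>t * \<tau> = 1\<close> by (simp add: smult_smult)
  then have "qcomm A (x \<oplus> k \<otimes> y) t (g \<otimes> w)
      = (?P \<oplus> (-1) \<odot> ?P) \<oplus> ((k \<otimes> g) \<otimes> (y \<otimes> w) \<oplus> (- t) \<odot> ((k \<otimes> g) \<otimes> (w \<otimes> y)))"
    by (simp add: qcomm_def l_distr r_distr smult_add_r gwx gwky kygw M.a_ac del: self_diff)
  also have "\<dots> = (k \<otimes> g) \<otimes> qcomm A y t w"
    by (simp add: qcomm_def r_distr smult_mult_r)
  finally have step: "qcomm A (x \<oplus> k \<otimes> y) t (g \<otimes> w) = (k \<otimes> g) \<otimes> qcomm A y t w" .
  have *: "scomm A (k \<otimes> g) x (Q * \<tau>)" "t * (1 / Q) * (Q * \<tau>) = 1"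
    using scomm_mult_l[OF assms(6) \<open>scomm A g x \<tau>\<close>] \<open>t * \<tau> = 1\<close> assms(7) by auto
  have "scomm A k k 1" by (simp add: scomm_def)
  from scomm_mult_l[OF this \<open>scomm A g k 1\<close>] scomm_mult_r[OF assms(12) \<open>scomm A y g 1\<close>]
    scomm_qcomm_l[OF assms(11) \<open>scomm A w x 1\<close>, of t] scomm_qcomm_l[OF assms(12) \<open>scomm A w k 1\<close>, of t]
  have "scomm A (k \<otimes> g) k 1" "scomm A y (k \<otimes> g) 1" "scomm A (qcomm A y t w) x 1"
    "scomm A (qcomm A y t w) k 1" by simp_all
  from Suc.IH[of "qcomm A y t w" "k \<otimes> g", OF _ _ * this] show ?case
    by (simp add: geo_Suc step)
qed

text \<open>The heart of the compatibility of the Serre relations with the coproduct. The factors of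
  the iterated q-commutator commute, so it may be evaluated in either order. On the first summand
  the increasing order makes the second component of \<open>x + k y\<close> drop out at every step; on the
  second summand the decreasing order makes the first one drop out. No cross terms arise.\<close>

lemma serre_sum:
  assumes [simp]: "x \<in> carrier A" "y \<in> carrier A" "k \<in> carrier A" "k' \<in> carrier A"
      "z \<in> carrier A" "w \<in> carrier A"
    and kx: "scomm A k x Q" "scomm A k z s" "scomm A k' x s" "scomm A k' k 1"
    and comm: "scomm A y x 1" "scomm A y k 1" "scomm A y z 1" "scomm A y k' 1"
      "scomm A w x 1" "scomm A w k 1"
    and s: "s * (s * Q ^ (m - 1)) = 1"  "Q \<noteq> 0"
    and zero: "qcomms A x (geo s Q m) z = \<zero>" "qcomms A y (geo s Q m) w = \<zero>"
  shows "qcomms A (x \<oplus> k \<otimes> y) (geo s Q m) (z \<oplus> k' \<otimes> w) = \<zero>"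
proof -
  have r: "rev (geo s Q m) = geo (s * Q ^ (m - 1)) (1 / Q) m"
    using s by (intro rev_geo)
  have "\<exists>G\<in>carrier A. qcomms A (x \<oplus> k \<otimes> y) (rev (geo s Q m)) (k' \<otimes> w)
      = G \<otimes> qcomms A y (rev (geo s Q m)) w"
    unfolding r using s kx comm by (intro qcomms_sum_second[where \<tau> = s]) (simp_all add: mult.commute)
  then obtain G where "G \<in> carrier A" "qcomms A (x \<oplus> k \<otimes> y) (geo s Q m) (k' \<otimes> w)
      = G \<otimes> qcomms A y (geo s Q m) w"
    by (auto simp: qcomms_rev)
  then have "qcomms A (x \<oplus> k \<otimes> y) (geo s Q m) (k' \<otimes> w) = \<zero>" using zero by simp
  moreover have "qcomms A (x \<oplus> k \<otimes> y) (geo s Q m) z = \<zero>"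
    using qcomms_sum_first[of x y k z Q s m] kx comm zero by simp
  ultimately show ?thesis by (simp add: qcomms_add)
qed

text \<open>Moving \<open>x\<close> past \<open>g\<close> and \<open>w\<close> past \<open>l\<close> produces the same scalar \<open>a\<close>, which therefore factors out of
  both terms of the q-commutator. The hypotheses are inherited by \<open>l g\<close> and \<open>qcomm A x t w\<close>, with
  \<open>b a\<close> in place of \<open>a\<close>, so this can be repeated for arbitrary parameters.\<close>

lemma qcomms_twist:
  assumes "x \<in> carrier A" "l \<in> carrier A" "g \<in> carrier A" "w \<in> carrier A"
    and "scomm A x l b" "scomm A x g a" "scomm A w l a" "scomm A g l 1"
  shows "\<exists>c. \<exists>G\<in>carrier A. qcomms A (l \<otimes> x) ts (g \<otimes> w) = c \<odot> (G \<otimes> qcomms A x ts w)"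
  using assms(3,4,6-8)
proof (induction ts arbitrary: g w a)
  case Nil
  then show ?case by (intro exI[of _ 1] bexI[of _ g]) auto
next
  case (Cons t ts)
  note [simp] = assms(1,2) Cons.prems(1,2)
  have lxgw: "(l \<otimes> x) \<otimes> (g \<otimes> w) = a \<odot> ((l \<otimes> g) \<otimes> (x \<otimes> w))"
    by (simp add: m_assoc scomm_l[OF \<open>scomm A x g a\<close>] smult_mult_r)
  have gwlx: "(g \<otimes> w) \<otimes> (l \<otimes> x) = a \<odot> ((l \<otimes> g) \<otimes> (w \<otimes> x))"
    by (simp add: m_assoc scomm_l[OF \<open>scomm A w l a\<close>] scomm_l[OF \<open>scomm A g l 1\<close>] smult_mult_r)
  have step: "qcomm A (l \<otimes> x) t (g \<otimes> w) = a \<odot> ((l \<otimes> g) \<otimes> qcomm A x t w)"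
    unfolding qcomm_def lxgw gwlx by (simp add: r_distr smult_mult_r smult_add_r smult_smult mult.commute)
  have "scomm A l l 1" by (simp add: scomm_def)
  from scomm_mult_l[OF this \<open>scomm A g l 1\<close>] scomm_mult_r[OF assms(5) \<open>scomm A x g a\<close>]
    scomm_qcomm_l[OF assms(5) \<open>scomm A w l a\<close>, of t]
  have "scomm A x (l \<otimes> g) (b * a)" "scomm A (qcomm A x t w) l (b * a)" "scomm A (l \<otimes> g) l 1" by simp_all
  from Cons.IH[OF _ _ this] obtain c G where "G \<in> carrier A"
    "qcomms A (l \<otimes> x) ts ((l \<otimes> g) \<otimes> qcomm A x t w) = c \<odot> (G \<otimes> qcomms A x ts (qcomm A x t w))" by auto
  then show ?case
    by (intro exI[of _ "a * c"] bexI[of _ G]) (simp_all add: step qcomms_smult smult_smult)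
qed

lemma serre_twist:
  assumes [simp]: "x \<in> carrier A" "l \<in> carrier A" "g \<in> carrier A" "w \<in> carrier A"
    and "scomm A x l b" "scomm A x g a" "scomm A w l a" "scomm A g l 1"
    and "qcomms A x ts w = \<zero>"
  shows "qcomms A (c \<odot> (l \<otimes> x)) ts (d \<odot> (g \<otimes> w)) = \<zero>"
proof -
  obtain e G where "G \<in> carrier A" "qcomms A (l \<otimes> x) ts (g \<otimes> w) = e \<odot> (G \<otimes> qcomms A x ts w)"
    using qcomms_twist[OF assms(1-8)] by blast
  then show ?thesis using assms(9) by (simp add: qcomms_smult_l qcomms_smult)
qed

end

lemma (in assignment) ev_qcomms:
  "ev A f (qcomms (free_algebra UNIV) x ts w) = qcomms A (ev A f x) ts (ev A f w)"
  unfolding qcomms_def by (induction ts arbitrary: w) (simp_all add: qcomm_def ev_simps)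

subsection \<open>The Serre element as an iterated q-commutator\<close>

text \<open>Up to the first two factors this is a Gaussian binomial coefficient. The value \<open>0\<close> for \<open>r > m\<close>
  lets the recursion in \<open>m\<close> hold at the end \<open>r = m + 1\<close> too.\<close>

definition gauss_coeff :: "complex \<Rightarrow> complex \<Rightarrow> nat \<Rightarrow> nat \<Rightarrow> complex" where
  "gauss_coeff q t m r = (if r \<le> m then (- t / q) ^ r * q ^ (r * m) * (qfact q m / (qfact q r * qfact q (m - r))) else 0)"

lemma qfact_0 [simp]: "qfact q 0 = 1"
  by (simp add: qfact_def)

lemma qfact_Suc: "qfact q (Suc m) = qint q (Suc m) * qfact q m"
  by (simp add: qfact_def mult.commute)

lemma qfact_nonzero: "(\<And>r. r > 0 \<Longrightarrow> qint q r \<noteq> 0) \<Longrightarrow> qfact q m \<noteq> 0"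
  by (induction m) (simp_all add: qfact_Suc)

lemma qint_pascal:
  assumes "q \<noteq> 0" "r \<le> m"
  shows "qint q (Suc m) * q ^ r = qint q (Suc m - r) + q ^ Suc m * qint q r"
proof -
  obtain d where d: "m = r + d" using assms(2) le_Suc_ex by blast
  have "(q ^ Suc m - inverse q ^ Suc m) * q ^ r
      = (q ^ (Suc m - r) - inverse q ^ (Suc m - r)) + q ^ Suc m * (q ^ r - inverse q ^ r)"
    using assms(1) by (simp add: d power_add field_simps)
  then show ?thesis by (simp add: qint_def add_divide_distrib[symmetric])
qed

text \<open>The recursion reduces to the identity \<open>qint_pascal\<close> once the common factors are removed.\<close>

lemma gauss_coeff_Suc:
  assumes q: "q \<noteq> 0" and nz: "\<And>r. r > 0 \<Longrightarrow> qint q r \<noteq> 0"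
  shows "gauss_coeff q t (Suc m) (Suc r) = gauss_coeff q t m (Suc r) + - (t * (q ^ 2) ^ m) * gauss_coeff q t m r"
proof -
  note nz' = qfact_nonzero[OF nz]
  define u where "u = - t / q"
  have t: "t = - (u * q)" using q by (simp add: u_def)
  have gc: "gauss_coeff q t m r = u ^ r * q ^ (r * m) * (qfact q m / (qfact q r * qfact q (m - r)))"
    if "r \<le> m" for r m
    using that by (simp add: gauss_coeff_def u_def)
  have q2: "(q ^ 2) ^ m = q ^ m * q ^ m" by (simp add: power_mult[symmetric] mult_2 power_add)
  consider "Suc r \<le> m" | "r = m" | "r > m" by linarith
  then show ?thesis
  proof cases
    case 1
    then obtain d where d: "m = Suc r + d" using le_Suc_ex by blast
    let ?X = "qfact q m / (qfact q r * qfact q d)"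
    have 2: "qint q (Suc m) * q ^ Suc r = qint q (Suc d) + q ^ Suc m * qint q (Suc r)"
      using qint_pascal[OF q 1] d by simp
    have "gauss_coeff q t (Suc m) (Suc r) = u ^ Suc r * q ^ (Suc r * m) * ?X
        * ((qint q (Suc m) * q ^ Suc r) / (qint q (Suc r) * qint q (Suc d)))"
      using nz' nz q by (simp add: gc d qfact_Suc power_add field_simps)
    also have "\<dots> = u ^ Suc r * q ^ (Suc r * m) * ?X * (1 / qint q (Suc r) + q ^ Suc m / qint q (Suc d))"
      unfolding 2 using nz by (simp add: field_simps)
    also have "\<dots> = gauss_coeff q t m (Suc r) + - (t * (q ^ 2) ^ m) * gauss_coeff q t m r"
    proof -
      have a: "gauss_coeff q t m (Suc r) = u ^ Suc r * q ^ (Suc r * m) * ?X * (1 / qint q (Suc r))"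
        using nz' nz by (simp add: gc d qfact_Suc field_simps)
      have "gauss_coeff q t m r = u ^ r * q ^ (r * m) * (qfact q m / (qfact q r * (qint q (Suc d) * qfact q d)))"
        by (simp add: gc d qfact_Suc)
      then have b: "- (t * (q ^ 2) ^ m) * gauss_coeff q t m r
          = u ^ Suc r * q ^ (Suc r * m) * ?X * (q ^ Suc m / qint q (Suc d))"
        unfolding q2 using t by (simp add: power_add field_simps)
      show ?thesis unfolding a b by (simp add: distrib_left)
    qed
    finally show ?thesis .
  next
    case 2
    have "gauss_coeff q t (Suc m) (Suc m) = u ^ Suc m * q ^ (Suc m * Suc m)"
      "gauss_coeff q t m m = u ^ m * q ^ (m * m)" "gauss_coeff q t m (Suc m) = 0"
      using nz' gc[of "Suc m" "Suc m"] gc[of m m] by (simp_all add: gauss_coeff_def[of _ _ m "Suc m"])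
    then show ?thesis
      unfolding q2 2 using t by (simp add: power_add)
  next
    case 3
    then show ?thesis by (simp add: gauss_coeff_def)
  qed
qed

lemma gauss_coeff_0:
  assumes "\<And>r. r > 0 \<Longrightarrow> qint q r \<noteq> 0"
  shows "gauss_coeff q t m 0 = 1"
  using qfact_nonzero[OF assms] by (simp add: gauss_coeff_def)

lemma cscale_sum: "cscale c (sum g I) = (\<Sum>i\<in>I. cscale c (g i))"
  by (induction I rule: infinite_finite_induct) (simp_all add: cscale_add_r)

text \<open>The q-binomial theorem for the commuting operators of left and right multiplication by \<open>x\<close>:
  the left-hand side is the product of \<open>L - t q\<^sup>2\<^sup>r R\<close> over \<open>r < m\<close>, applied to \<open>z\<close>.\<close>

lemma gauss_expansion:
  fixes x z :: "'g free_alg"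
  assumes "q \<noteq> 0" and nz: "\<And>r. r > 0 \<Longrightarrow> qint q r \<noteq> 0"
  shows "qcomms (free_algebra UNIV) x (geo t (q ^ 2) m) z
    = (\<Sum>r=0..m. cscale (gauss_coeff q t m r) (x ^ (m - r) * z * x ^ r))"
proof (induction m)
  case 0
  then show ?case by (simp add: gauss_coeff_0[OF nz] qcomms_def)
next
  case (Suc m)
  let ?c = "gauss_coeff q t m" and ?s = "- (t * (q ^ 2) ^ m)"
  let ?M = "\<lambda>r. x ^ (Suc m - r) * z * x ^ r"
  interpret calg "free_algebra (UNIV :: 'g set)" by (rule calg_free_algebra)
  have 1: "x * (\<Sum>r=0..m. cscale (?c r) (x ^ (m - r) * z * x ^ r)) = (\<Sum>r=0..m. cscale (?c r) (?M r))"
    unfolding sum_distrib_left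
    by (rule sum.cong) (simp_all add: cscale_mult_r mult.assoc[symmetric] Suc_diff_le)
  have "\<dots> = cscale (?c 0) (?M 0) + (\<Sum>r=0..m. cscale (?c (Suc r)) (?M (Suc r)))"
  proof -
    have "(\<Sum>r=0..m. cscale (?c r) (?M r)) = (\<Sum>r=0..Suc m. cscale (?c r) (?M r))"
      by (simp add: gauss_coeff_def)
    then show ?thesis by (simp only: sum.atLeast0_atMost_Suc_shift o_def)
  qed
  note 1 = 1[unfolded this]
  have 2: "(\<Sum>r=0..m. cscale (?c r) (x ^ (m - r) * z * x ^ r)) * x = (\<Sum>r=0..m. cscale (?c r) (?M (Suc r)))"
    unfolding sum_distrib_right
    by (rule sum.cong) (simp_all add: cscale_mult_l mult.assoc power_commutes)
  have "qcomms (free_algebra UNIV) x (geo t (q ^ 2) (Suc m)) z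
      = cscale (?c 0) (?M 0) + (\<Sum>r=0..m. cscale (?c (Suc r)) (?M (Suc r)))
        + cscale ?s (\<Sum>r=0..m. cscale (?c r) (?M (Suc r)))"
    unfolding geo_snoc qcomms_append Suc by (simp add: qcomm_def 1 2)
  also have "\<dots> = cscale (gauss_coeff q t (Suc m) 0) (?M 0)
      + (\<Sum>r=0..m. cscale (gauss_coeff q t (Suc m) (Suc r)) (?M (Suc r)))"
    by (simp only: gauss_coeff_0[OF nz] gauss_coeff_Suc[OF assms] cscale_sum cscale_cscale
        cscale_add_l sum.distrib add.assoc)
  also have "\<dots> = (\<Sum>r=0..Suc m. cscale (gauss_coeff q t (Suc m) r) (?M r))"
    by (simp only: sum.atLeast0_atMost_Suc_shift o_def)
  finally show ?case .
qed

locale qdatum =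
  fixes D :: affine_datum and h :: complex
  assumes datum: "untwisted_affine_datum D"
    and generic: "\<And>m. m > 0 \<Longrightarrow> exp h ^ m \<noteq> 1"
begin

abbreviation "n \<equiv> rank D"
abbreviation "q \<equiv> qq D h"
abbreviation "C \<equiv> cartan D"

lemma q_nonzero [simp]: "q i \<noteq> 0"
  by (simp add: qq_def)

lemma cartan_nonpos: "i \<le> n \<Longrightarrow> j \<le> n \<Longrightarrow> i \<noteq> j \<Longrightarrow> C i j \<le> 0"
  using datum by (auto simp: untwisted_affine_datum_def Let_def generalized_cartan_matrix_def)

lemma q_generic: "i \<le> n \<Longrightarrow> m > 0 \<Longrightarrow> q i ^ m \<noteq> 1"
  using datum generic[of "symm D i * m"]
  by (auto simp: untwisted_affine_datum_def Let_def qq_def power_mult)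

lemma q_symm: "i \<le> n \<Longrightarrow> j \<le> n \<Longrightarrow> q i powi C i j = q j powi C j i"
proof -
  assume "i \<le> n" "j \<le> n"
  then have "int (symm D i) * C i j = int (symm D j) * C j i"
    using datum by (auto simp: untwisted_affine_datum_def Let_def)
  moreover have "q i powi c = exp h powi (int (symm D i) * c)" for i c
    by (simp add: qq_def power_int_mult)
  ultimately show ?thesis by simp
qed

lemma qint_nonzero: "i \<le> n \<Longrightarrow> r > 0 \<Longrightarrow> qint (q i) r \<noteq> 0"
proof -
  assume i: "i \<le> n" and r: "r > 0"
  have "q i ^ m \<noteq> inverse (q i) ^ m" if "m > 0" for m
  proof
    assume "q i ^ m = inverse (q i) ^ m"
    then have "q i ^ m * q i ^ m = 1" by (metis q_nonzero power_inverse power_not_zero right_inverse)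
    then show False using q_generic[OF i, of "m + m"] that by (simp add: power_add)
  qed
  from this[of r] this[of 1] show ?thesis using r by (simp add: qint_def)
qed

text \<open>For \<open>m = 1 - C\<^sub>i\<^sub>j\<close> the first parameter is \<open>q\<^sub>i\<^sup>1\<^sup>-\<^sup>m\<close>. Then the powers of \<open>q\<^sub>i\<close> in the coefficients
  of the q-binomial theorem cancel, and the coefficients of the Serre element remain.\<close>

lemma serre_qcomms:
  assumes "i \<le> n" "j \<le> n" "i \<noteq> j"
  shows "serre D h x i j = cscale (1 / qfact (q i) (nat (1 - C i j)))
    (qcomms (free_algebra UNIV) (var (x i)) (geo (q i powi C i j) (q i ^ 2) (nat (1 - C i j))) (var (x j)))"
    and "qfact (q i) m \<noteq> 0"
proof -
  define m where "m = nat (1 - C i j)"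
  have m: "C i j = 1 - int m" "m > 0" using cartan_nonpos[OF assms] by (auto simp: m_def)
  note nz = qint_nonzero[OF assms(1)]
  show "qfact (q i) m \<noteq> 0" for m using qfact_nonzero[OF nz] by blast
  note nz' = this
  have t: "- (q i powi C i j) / q i = - (inverse (q i) ^ m)"
    by (simp add: m power_int_diff power_inverse field_simps)
  have g: "gauss_coeff (q i) (q i powi C i j) m r = (-1) ^ r * (qfact (q i) m / (qfact (q i) r * qfact (q i) (m - r)))"
    if "r \<le> m" for r
  proof -
    have "(- (inverse (q i) ^ m)) ^ r * q i ^ (r * m) = (-1) ^ r"
    proof -
      have "(inverse (q i) ^ m) ^ r * q i ^ (r * m) = (inverse (q i) ^ m * q i ^ m) ^ r"
        by (simp only: power_mult_distrib power_mult[symmetric] mult.commute[of m r])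
      also have "\<dots> = 1" by (simp add: power_mult_distrib[symmetric])
      finally show ?thesis by (simp only: power_minus[of "inverse (q i) ^ m"] mult.assoc mult_1_right)
    qed
    then show ?thesis using that unfolding gauss_coeff_def t by simp
  qed
  have gauss: "qcomms (free_algebra UNIV) (var (x i)) (geo (q i powi C i j) (q i ^ 2) m) (var (x j))
      = (\<Sum>r=0..m. cscale (gauss_coeff (q i) (q i powi C i j) m r) (var (x i) ^ (m - r) * var (x j) * var (x i) ^ r))"
    by (rule gauss_expansion[OF q_nonzero]) (rule nz)
  have neg: "(-1) ^ r * p = cscale ((-1) ^ r) p" for r and p :: fal
    by (cases "even r") (simp_all add: cscale_neg)
  have "serre D h x i j = (\<Sum>r=0..m. cscale ((-1) ^ r * (1 / (qfact (q i) r * qfact (q i) (m - r))))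
      (var (x i) ^ (m - r) * var (x j) * var (x i) ^ r))"
    unfolding serre_def Let_def m_def[symmetric]
    by (rule sum.cong) (simp_all add: neg cscale_mult_l cscale_mult_r cscale_cscale mult.assoc mult.commute)
  also have "\<dots> = cscale (1 / qfact (q i) m)
      (qcomms (free_algebra UNIV) (var (x i)) (geo (q i powi C i j) (q i ^ 2) m) (var (x j)))"
    unfolding gauss cscale_sum
    by (rule sum.cong) (simp_all add: cscale_cscale g nz')
  finally show "serre D h x i j = cscale (1 / qfact (q i) (nat (1 - C i j)))
    (qcomms (free_algebra UNIV) (var (x i)) (geo (q i powi C i j) (q i ^ 2) (nat (1 - C i j))) (var (x j)))"
    by (simp add: m_def)
qed

end

section \<open>Families satisfying the defining relations\<close>

definition kprod :: "(complex, 'a, 'm) module_scheme \<Rightarrow> affine_datum \<Rightarrow> (nat \<Rightarrow> 'a) \<Rightarrow> nat list \<Rightarrow> 'a" where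
  "kprod A D k xs = foldr (\<lambda>i x. (k i [^]\<^bsub>A\<^esub> mark D i) \<otimes>\<^bsub>A\<^esub> x) xs \<one>\<^bsub>A\<^esub>"

definition serre_list :: "affine_datum \<Rightarrow> complex \<Rightarrow> nat \<Rightarrow> nat \<Rightarrow> complex list" where
  "serre_list D h i j = geo (qq D h i powi cartan D i j) (qq D h i ^ 2) (nat (1 - cartan D i j))" 

locale qfamily = qdatum D h + calg A
  for D h and A (structure) +
  fixes e f k l :: "nat \<Rightarrow> 'a"
  assumes fam_closed [simp, intro]: "e i \<in> carrier A" "f i \<in> carrier A" "k i \<in> carrier A" "l i \<in> carrier A"
    and kk: "i \<le> n \<Longrightarrow> j \<le> n \<Longrightarrow> scomm A (k i) (k j) 1"
    and kl: "i \<le> n \<Longrightarrow> k i \<otimes> l i = \<one>" "i \<le> n \<Longrightarrow> l i \<otimes> k i = \<one>"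
    and kprod: "kprod A D k [0..<Suc n] = \<one>"
    and ke: "i \<le> n \<Longrightarrow> j \<le> n \<Longrightarrow> scomm A (k i) (e j) (q i powi C i j)"
    and kf: "i \<le> n \<Longrightarrow> j \<le> n \<Longrightarrow> scomm A (k i) (f j) (q i powi (- C i j))"
    and ef: "i \<le> n \<Longrightarrow> j \<le> n \<Longrightarrow> e i \<otimes> f j \<oplus> (-1) \<odot> (f j \<otimes> e i)
        = (if i = j then (1 / (q i - inverse (q i))) \<odot> (k i \<oplus> (-1) \<odot> l i) else \<zero>)"
    and serre_e: "i \<le> n \<Longrightarrow> j \<le> n \<Longrightarrow> i \<noteq> j \<Longrightarrow> qcomms A (e i) (serre_list D h i j) (e j) = \<zero>"
    and serre_f: "i \<le> n \<Longrightarrow> j \<le> n \<Longrightarrow> i \<noteq> j \<Longrightarrow> qcomms A (f i) (serre_list D h i j) (f j) = \<zero>"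

text \<open>The nine kinds of relations as separate conditions, so that they can be treated one by one.\<close>

lemma relations_ball:
  fixes D h defines "n \<equiv> rank D"
  shows "(\<forall>r\<in>relations D h. P r) \<longleftrightarrow>
    (\<forall>i\<le>n. \<forall>j\<le>n. P (var (K i) * var (K j) - var (K j) * var (K i))) \<and>
    (\<forall>i\<le>n. P (var (K i) * var (Kinv i) - 1)) \<and>
    (\<forall>i\<le>n. P (var (Kinv i) * var (K i) - 1)) \<and>
    P (prod_list (map (\<lambda>i. var (K i) ^ mark D i) [0..<Suc n]) - 1) \<and>
    (\<forall>i\<le>n. \<forall>j\<le>n. P (var (K i) * var (E j) * var (Kinv i) - cscale (qq D h i powi cartan D i j) (var (E j)))) \<and>
    (\<forall>i\<le>n. \<forall>j\<le>n. P (var (K i) * var (F j) * var (Kinv i) - cscale (qq D h i powi (- cartan D i j)) (var (F j)))) \<and>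
    (\<forall>i\<le>n. \<forall>j\<le>n. P (var (E i) * var (F j) - var (F j) * var (E i) - (if i = j
        then cscale (1 / (qq D h i - inverse (qq D h i))) (var (K i) - var (Kinv i)) else 0))) \<and>
    (\<forall>i\<le>n. \<forall>j\<le>n. i \<noteq> j \<longrightarrow> P (serre D h E i j)) \<and>
    (\<forall>i\<le>n. \<forall>j\<le>n. i \<noteq> j \<longrightarrow> P (serre D h F i j))"
  unfolding relations_def Let_def ball_Un n_def[symmetric] conj_assoc
  by (intro arg_cong2[where f = "(\<and>)"]; blast)

lemma (in cvec) diff_zero_iff:
  "x \<in> carrier V \<Longrightarrow> y \<in> carrier V \<Longrightarrow> x \<oplus> (-1) \<odot> y = \<zero> \<longleftrightarrow> x = y"
  using diff_eq_zero by auto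

lemma (in cvec) smult_eq_zero_iff:
  assumes "x \<in> carrier V" "c \<noteq> 0" shows "c \<odot> x = \<zero> \<longleftrightarrow> x = \<zero>"
proof
  assume "c \<odot> x = \<zero>"
  then have "(1 / c) \<odot> (c \<odot> x) = \<zero>" by simp
  then show "x = \<zero>" using assms by (simp add: smult_smult)
qed simp

lemma (in calg) scomm_conj_iff:
  assumes "k \<otimes> l = \<one>" "l \<otimes> k = \<one>" "k \<in> carrier A" "l \<in> carrier A" "w \<in> carrier A"
  shows "k \<otimes> w \<otimes> l = t \<odot> w \<longleftrightarrow> scomm A k w t"
proof
  assume "k \<otimes> w \<otimes> l = t \<odot> w"
  then have "k \<otimes> w \<otimes> l \<otimes> k = (t \<odot> w) \<otimes> k" by simp
  then show "scomm A k w t" using assms by (simp add: scomm_def smult_mult_l m_assoc)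
next
  assume "scomm A k w t"
  then have "k \<otimes> w \<otimes> l = (t \<odot> (w \<otimes> k)) \<otimes> l" by (simp add: scomm_def)
  then show "k \<otimes> w \<otimes> l = t \<odot> w" using assms by (simp add: smult_mult_l m_assoc)
qed

lemma (in calg) kprod_closed: "(\<And>i. k i \<in> carrier A) \<Longrightarrow> kprod A D k xs \<in> carrier A"
  unfolding kprod_def by (induction xs) auto

lemma (in calg) gen_assignment:
  assumes "\<And>i. e i \<in> carrier A" "\<And>i. f i \<in> carrier A" "\<And>i. k i \<in> carrier A" "\<And>i. l i \<in> carrier A"
  shows "assignment A (case_gen e f k l)"
  using assms by (intro assignmentI calg_axioms) (simp split: gen.split)

lemma ev_prod_list_kprod:
  assumes "assignment A f"
  shows "ev A f (prod_list (map (\<lambda>i. var (K i) ^ mark D i) xs)) = kprod A D (\<lambda>i. f (K i)) xs"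
proof -
  interpret assignment A f by fact
  show ?thesis unfolding kprod_def by (induction xs) (simp_all add: ev_simps)
qed

text \<open>The normalising factor is nonzero because \<open>q\<close> is not a root of unity.\<close>

lemma (in qdatum) ev_serre_zero_iff:
  assumes "assignment A f" "i \<le> n" "j \<le> n" "i \<noteq> j"
  shows "ev A f (serre D h x i j) = \<zero>\<^bsub>A\<^esub> \<longleftrightarrow> qcomms A (f (x i)) (serre_list D h i j) (f (x j)) = \<zero>\<^bsub>A\<^esub>"
proof -
  interpret as: assignment A f by fact
  show ?thesis
    using serre_qcomms(2)[OF assms(2-4)]
    by (simp add: serre_qcomms(1)[OF assms(2-4)] as.ev_cscale as.ev_qcomms as.ev_var serre_list_def
        as.smult_eq_zero_iff)
qed

lemma (in qfamily) relations_hold: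
  assumes "r \<in> relations D h" shows "ev A (case_gen e f k l) r = \<zero>"
proof -
  interpret as: assignment A "case_gen e f k l" by (rule gen_assignment) auto
  have kprod': "kprod A D (\<lambda>i. k i) [0..<Suc n] = \<one>" by (rule kprod)
  have kk': "k i \<otimes> k j = k j \<otimes> k i" if "i \<le> n" "j \<le> n" for i j
    using kk[OF that] by (simp add: scomm_def)
  have "\<forall>r\<in>relations D h. ev A (case_gen e f k l) r = \<zero>"
    unfolding relations_ball
    by (intro conjI allI impI)
      (simp_all add: as.ev_simps ev_serre_zero_iff[OF as.assignment_axioms] diff_zero_iff kk'[THEN eqTrueI]
        kl ev_prod_list_kprod[OF as.assignment_axioms] kprod' scomm_conj_iff ke kf serre_e serre_f ef del: upt_Suc)
  then show ?thesis using assms by blast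
qed

lemma (in qdatum) qfamilyI:
  assumes "calg A" "\<And>i. e i \<in> carrier A" "\<And>i. f i \<in> carrier A" "\<And>i. k i \<in> carrier A" "\<And>i. l i \<in> carrier A"
    and rel: "\<And>r. r \<in> relations D h \<Longrightarrow> ev A (case_gen e f k l) r = \<zero>\<^bsub>A\<^esub>"
  shows "qfamily D h A e f k l"
proof -
  interpret A: calg A by fact
  interpret as: assignment A "case_gen e f k l" by (rule A.gen_assignment) (rule assms)+
  note [simp] = assms(2-5)
  have "\<forall>r\<in>relations D h. ev A (case_gen e f k l) r = \<zero>\<^bsub>A\<^esub>" using rel by blast
  note * = this[unfolded relations_ball]
  note c4 = *[THEN conjunct2, THEN conjunct2, THEN conjunct2]
  note c5 = c4[THEN conjunct2] note c6 = c5[THEN conjunct2] note c7 = c6[THEN conjunct2]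
  note c8 = c7[THEN conjunct2]
  have kl: "k i \<otimes>\<^bsub>A\<^esub> l i = \<one>\<^bsub>A\<^esub>" "l i \<otimes>\<^bsub>A\<^esub> k i = \<one>\<^bsub>A\<^esub>" if "i \<le> n" for i
    using * that by (simp_all add: as.ev_simps A.diff_zero_iff del: upt_Suc)
  note e = as.ev_simps A.diff_zero_iff kl A.scomm_conj_iff
  show ?thesis
  proof (intro qfamily.intro qfamily_axioms.intro qdatum_axioms A.calg_axioms assms(2-5) kl)
    show "scomm A (k i) (k j) 1" if "i \<le> n" "j \<le> n" for i j
      using *[THEN conjunct1, rule_format, OF that] by (simp add: e scomm_def)
    show "kprod A D k [0..<Suc n] = \<one>\<^bsub>A\<^esub>"
      using c4[THEN conjunct1]
      by (simp add: e ev_prod_list_kprod[OF as.assignment_axioms] A.kprod_closed del: upt_Suc)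
    show "scomm A (k i) (e j) (q i powi C i j)" if "i \<le> n" "j \<le> n" for i j
      using c5[THEN conjunct1, rule_format, OF that] that
      by (simp add: e)
    show "scomm A (k i) (f j) (q i powi (- C i j))" if "i \<le> n" "j \<le> n" for i j
      using c6[THEN conjunct1, rule_format, OF that] that
      by (simp add: e)
    show "e i \<otimes>\<^bsub>A\<^esub> f j \<oplus>\<^bsub>A\<^esub> (-1) \<odot>\<^bsub>A\<^esub> (f j \<otimes>\<^bsub>A\<^esub> e i)
        = (if i = j then (1 / (q i - inverse (q i))) \<odot>\<^bsub>A\<^esub> (k i \<oplus>\<^bsub>A\<^esub> (-1) \<odot>\<^bsub>A\<^esub> l i) else \<zero>\<^bsub>A\<^esub>)"
      if "i \<le> n" "j \<le> n" for i j
      using c7[THEN conjunct1, rule_format, OF that] that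
      by (auto simp add: as.ev_simps A.diff_zero_iff split: if_splits)
    show "qcomms A (e i) (serre_list D h i j) (e j) = \<zero>\<^bsub>A\<^esub>" if "i \<le> n" "j \<le> n" "i \<noteq> j" for i j
      using c8[THEN conjunct1, rule_format, OF that]
        ev_serre_zero_iff[OF as.assignment_axioms that, of E] by simp
    show "qcomms A (f i) (serre_list D h i j) (f j) = \<zero>\<^bsub>A\<^esub>" if "i \<le> n" "j \<le> n" "i \<noteq> j" for i j
      using c8[THEN conjunct2, rule_format, OF that]
        ev_serre_zero_iff[OF as.assignment_axioms that, of F] by simp
  qed
qed

context calg
begin

lemma scomm_pow:
  assumes "scomm A x y 1" "x \<in> carrier A" "y \<in> carrier A"
  shows "scomm A x (y [^] (a::nat)) 1"
proof (induction a)
  case (Suc a)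
  show ?case using scomm_mult_r[OF Suc assms(1)] assms by simp
qed (use assms in \<open>simp add: scomm_one\<close>)

lemma scomm_pow_l:
  assumes "scomm A x y 1" "x \<in> carrier A" "y \<in> carrier A"
  shows "scomm A (x [^] (a::nat)) y 1"
proof (induction a)
  case (Suc a)
  show ?case using scomm_mult_l[OF Suc assms(1)] assms by simp
qed (use assms in \<open>simp add: scomm_one\<close>)

lemma scomm_kprod:
  assumes "\<And>i. k i \<in> carrier A" "x \<in> carrier A" "\<And>i. i \<in> set xs \<Longrightarrow> scomm A x (k i) 1"
  shows "scomm A x (kprod A D k xs) 1"
  using assms(3)
proof (induction xs)
  case Nil
  then show ?case using assms(2) by (simp add: kprod_def scomm_one)
next
  case (Cons i xs)
  have "scomm A x (k i [^] mark D i) 1" using Cons assms by (intro scomm_pow) auto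
  from scomm_mult_r[OF this Cons.IH] show ?case
    using assms Cons kprod_closed[of k] by (simp add: kprod_def)
qed

end

context qfamily
begin

lemma le: "i \<le> n \<Longrightarrow> j \<le> n \<Longrightarrow> scomm A (l i) (e j) (1 / (q i powi C i j))"
  by (rule scomm_inverse[OF ke]) (simp_all add: kl power_int_not_zero)

lemma lf: "i \<le> n \<Longrightarrow> j \<le> n \<Longrightarrow> scomm A (l i) (f j) (q i powi C i j)"
  using scomm_inverse[OF kf, of i j "l i"] by (simp add: kl power_int_not_zero power_int_minus divide_inverse)

lemma lk: "i \<le> n \<Longrightarrow> j \<le> n \<Longrightarrow> scomm A (l i) (k j) 1"
  using scomm_inverse[OF kk, of i j "l i"] by (simp add: kl)

lemma kl_comm: "i \<le> n \<Longrightarrow> j \<le> n \<Longrightarrow> scomm A (k i) (l j) 1"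
  using scomm_sym[OF lk, of j i] by simp

lemma ll: "i \<le> n \<Longrightarrow> j \<le> n \<Longrightarrow> scomm A (l i) (l j) 1"
  using scomm_inverse[OF kl_comm, of i j "l i"] by (simp add: kl)

lemma el: "i \<le> n \<Longrightarrow> j \<le> n \<Longrightarrow> scomm A (e i) (l j) (q j powi C j i)"
  using scomm_sym[OF le, of j i] by (simp add: power_int_not_zero)

lemma fk: "i \<le> n \<Longrightarrow> j \<le> n \<Longrightarrow> scomm A (f i) (k j) (q j powi C j i)"
  using scomm_sym[OF kf, of j i] by (simp add: power_int_not_zero power_int_minus divide_inverse)

text \<open>The \<open>k\<^sub>i\<close> commute, so the product of the powers of their inverses is the inverse of the product.\<close>

lemma kprod_inverse: "kprod A D l [0..<Suc n] = \<one>"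
proof -
  have "set xs \<subseteq> {0..n} \<Longrightarrow> kprod A D k xs \<otimes> kprod A D l xs = \<one>" for xs
  proof (induction xs)
    case Nil
    then show ?case by (simp add: kprod_def)
  next
    case (Cons i xs)
    let ?a = "mark D i" and ?P = "kprod A D k xs" and ?P' = "kprod A D l xs"
    have cl: "?P \<in> carrier A" "?P' \<in> carrier A" by (rule kprod_closed; simp)+
    have i: "i \<le> n" using Cons.prems by auto
    have "scomm A (l i) ?P 1"
      using Cons.prems i by (intro scomm_kprod lk) auto
    then have "scomm A (l i [^] ?a) ?P 1" using cl by (intro scomm_pow_l) auto
    then have c: "?P \<otimes> (l i [^] ?a \<otimes> ?P') = l i [^] ?a \<otimes> (?P \<otimes> ?P')"
      using scomm_l[of "l i [^] ?a" ?P 1 ?P'] cl by simp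
    have inv: "k i [^] ?a \<otimes> l i [^] ?a = \<one>"
      using pow_mult_distrib[of "k i" "l i" ?a] kl[OF i] by simp
    have "kprod A D k (i # xs) \<otimes> kprod A D l (i # xs) = k i [^] ?a \<otimes> (?P \<otimes> (l i [^] ?a \<otimes> ?P'))"
      using cl by (simp add: kprod_def m_assoc)
    also have "\<dots> = k i [^] ?a \<otimes> l i [^] ?a"
      using c Cons cl by simp
    finally show ?case using inv by simp
  qed
  moreover have "set [0..<Suc n] \<subseteq> {0..n}" by auto
  ultimately have "kprod A D k [0..<Suc n] \<otimes> kprod A D l [0..<Suc n] = \<one>" by blast
  then show ?thesis using kprod kprod_closed[of l D "[0..<Suc n]"] by (simp del: upt_Suc)
qed

text \<open>The first and the last parameter are inverse to each other: they are \<open>q\<^sub>i\<^sup>c\<close> and \<open>q\<^sub>i\<^sup>-\<^sup>c\<close> for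
  \<open>c = C\<^sub>i\<^sub>j\<close>.\<close>

lemma serre_scalar: "i \<le> n \<Longrightarrow> j \<le> n \<Longrightarrow> i \<noteq> j \<Longrightarrow>
    q i powi C i j * (q i powi C i j * (q i ^ 2) ^ (nat (1 - C i j) - 1)) = 1"
proof -
  assume "i \<le> n" "j \<le> n" "i \<noteq> j"
  then have m: "C i j = - int (nat (- C i j))" using cartan_nonpos by simp
  define m where "m = nat (- C i j)"
  note m = m[folded m_def]
  have mm: "nat (1 - C i j) - 1 = m" by (simp add: m)
  have "(q i ^ 2) ^ m = q i ^ m * q i ^ m" by (simp add: power_mult[symmetric] mult_2 power_add)
  then show ?thesis unfolding mm by (simp add: m power_int_minus field_simps)
qed

end

context tens_alg
begin

interpretation TA: calg TA by (rule calg_TA)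

lemma scomm_pure:
  assumes "scomm A a b s" "scomm C c d t"
    "a \<in> carrier A" "b \<in> carrier A" "c \<in> carrier C" "d \<in> carrier C"
  shows "scomm TA (pt a c) (pt b d) (s * t)"
  using assms by (simp add: scomm_def pureD T.smult_smult mult.commute)

lemma pure_pow: "a \<in> carrier A \<Longrightarrow> c \<in> carrier C \<Longrightarrow> pt a c [^]\<^bsub>TA\<^esub> (m::nat) = pt (a [^]\<^bsub>A\<^esub> m) (c [^]\<^bsub>C\<^esub> m)"
  by (induction m) simp_all

lemma kprod_pure:
  assumes "\<And>i. k i \<in> carrier A" "\<And>i. k' i \<in> carrier C"
  shows "kprod TA D (\<lambda>i. pt (k i) (k' i)) xs = pt (kprod A D k xs) (kprod C D k' xs)"
proof (induction xs)
  case (Cons i xs)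
  have "kprod A D k xs \<in> carrier A" "kprod C D k' xs \<in> carrier C"
    using A.kprod_closed C.kprod_closed assms by auto
  then show ?case using Cons assms by (simp add: kprod_def pure_pow)
qed (simp add: kprod_def)

lemma qcomms_pure_l:
  assumes "a \<in> carrier A" "b \<in> carrier A"
  shows "qcomms TA (pt a \<one>\<^bsub>C\<^esub>) ts (pt b \<one>\<^bsub>C\<^esub>) = pt (qcomms A a ts b) \<one>\<^bsub>C\<^esub>"
  using assms(2)
proof (induction ts arbitrary: b)
  case (Cons t ts)
  have "qcomm TA (pt a \<one>\<^bsub>C\<^esub>) t (pt b \<one>\<^bsub>C\<^esub>) = pt (qcomm A a t b) \<one>\<^bsub>C\<^esub>"
    using assms(1) Cons.prems by (simp add: qcomm_def pureD)
  then show ?case using Cons assms(1) by simp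
qed simp

lemma qcomms_pure_r:
  assumes "a \<in> carrier C" "b \<in> carrier C"
  shows "qcomms TA (pt \<one>\<^bsub>A\<^esub> a) ts (pt \<one>\<^bsub>A\<^esub> b) = pt \<one>\<^bsub>A\<^esub> (qcomms C a ts b)"
  using assms(2)
proof (induction ts arbitrary: b)
  case (Cons t ts)
  have "qcomm TA (pt \<one>\<^bsub>A\<^esub> a) t (pt \<one>\<^bsub>A\<^esub> b) = pt \<one>\<^bsub>A\<^esub> (qcomm C a t b)"
    using assms(1) Cons.prems by (simp add: qcomm_def pureD)
  then show ?case using Cons assms(1) by simp
qed simp

end

context qfamily
begin

text \<open>The image of \<open>e\<^sub>i\<close> has the form \<open>x + k y\<close> of \<open>serre_sum\<close> with \<open>x = e\<^sub>i \<otimes> 1\<close>, \<open>k = k\<^sub>i \<otimes> 1\<close> and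
  \<open>y = 1 \<otimes> e\<^sub>i\<close>. That of \<open>f\<^sub>i\<close> has it with the tensor factors exchanged: \<open>x = 1 \<otimes> f\<^sub>i\<close>,
  \<open>k = 1 \<otimes> k\<^sub>i\<^sup>-\<^sup>1\<close> and \<open>y = f\<^sub>i \<otimes> 1\<close>. In both cases the scalars in the commutation rules with \<open>k\<close> are
  the same.\<close>

lemma qfamily_coproduct:
  defines "T \<equiv> tensor_algebra A A" and "p \<equiv> pure_tensor A A"
  shows "qfamily D h T (\<lambda>i. p (e i) \<one> \<oplus>\<^bsub>T\<^esub> p (k i) (e i)) (\<lambda>i. p (f i) (l i) \<oplus>\<^bsub>T\<^esub> p \<one> (f i))
    (\<lambda>i. p (k i) (k i)) (\<lambda>i. p (l i) (l i))"
proof -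
  interpret TT: tens_alg A A by (rule tens_algI) (rule calg_axioms)+
  interpret T: calg T unfolding T_def by (rule TT.calg_TA)
  have T [simp]: "\<one>\<^bsub>T\<^esub> = p \<one> \<one>" by (simp add: T_def p_def)
  have pc [simp]: "p a b \<in> carrier T" if "a \<in> carrier A" "b \<in> carrier A" for a b
    using that by (simp add: T_def p_def)
  have pm [simp]: "p a b \<otimes>\<^bsub>T\<^esub> p a' b' = p (a \<otimes> a') (b \<otimes> b')"
    if "a \<in> carrier A" "b \<in> carrier A" "a' \<in> carrier A" "b' \<in> carrier A" for a b a' b'
    using that by (simp add: T_def p_def)
  have sc: "scomm T (p a c) (p b d) s"
    if "scomm A a b u" "scomm A c d v" "s = u * v" "a \<in> carrier A" "b \<in> carrier A" "c \<in> carrier A" "d \<in> carrier A"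
    for a b c d u v s
    unfolding that(3) T_def p_def using that by (intro TT.scomm_pure)
  have pD: "p (a \<oplus> a') b = p a b \<oplus>\<^bsub>T\<^esub> p a' b" "p b (a \<oplus> a') = p b a \<oplus>\<^bsub>T\<^esub> p b a'"
    if "a \<in> carrier A" "a' \<in> carrier A" "b \<in> carrier A" for a a' b
    using that by (simp_all add: T_def p_def TT.pureD)
  have pS: "p (c \<odot> a) b = c \<odot>\<^bsub>T\<^esub> p a b" "p b (c \<odot> a) = c \<odot>\<^bsub>T\<^esub> p b a"
    if "a \<in> carrier A" "b \<in> carrier A" for a b c
    using that by (simp_all add: T_def p_def TT.pureD)
  show ?thesis
  proof (intro qfamily.intro qfamily_axioms.intro qdatum_axioms T.calg_axioms)
    fix i j assume i: "i \<le> n" and j: "j \<le> n"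
    let ?x = "p (e i) \<one> \<oplus>\<^bsub>T\<^esub> p (k i) (e i)" and ?y = "p (f j) (l j) \<oplus>\<^bsub>T\<^esub> p \<one> (f j)"
    show "scomm T (p (k i) (k i)) (p (k j) (k j)) 1"
      by (rule sc[OF kk[OF i j] kk[OF i j]]) simp_all
    show "scomm T (p (k i) (k i)) (p (e j) \<one> \<oplus>\<^bsub>T\<^esub> p (k j) (e j)) (q i powi C i j)"
      by (intro T.scomm_add sc[OF ke[OF i j] scomm_one(2)] sc[OF kk[OF i j] ke[OF i j]]) simp_all
    show "scomm T (p (k i) (k i)) ?y (q i powi (- C i j))"
      by (intro T.scomm_add sc[OF kf[OF i j] kl_comm[OF i j]] sc[OF scomm_one(2) kf[OF i j]]) simp_all
    let ?Q = "1 / (q i - inverse (q i))"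
    \<comment> \<open>The two scalars that arise cancel because the matrix is symmetrised by the \<open>d\<^sub>i\<close>.\<close>
    have mix: "(p (k i) (e i)) \<otimes>\<^bsub>T\<^esub> (p (f j) (l j)) = (p (f j) (l j)) \<otimes>\<^bsub>T\<^esub> (p (k i) (e i))"
      using T.scommD[OF sc[OF kf[OF i j] el[OF i j], of 1]]
      by (simp add: q_symm[OF i j] power_int_minus power_int_not_zero)
    define S where "S = (if i = j then ?Q \<odot> (k i \<oplus> (-1) \<odot> l i) else \<zero>)"
    have S [simp]: "S \<in> carrier A" by (simp add: S_def)
    have ef1: "e i \<otimes> f j = S \<oplus> f j \<otimes> e i"
      unfolding S_def
      using ef[OF i j, symmetric] M.a_comm[of "(-1) \<odot> (f j \<otimes> e i)" "f j \<otimes> e i"] by (simp add: M.a_assoc)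
    have p0: "p \<zero> b = \<zero>\<^bsub>T\<^esub>" "p b \<zero> = \<zero>\<^bsub>T\<^esub>" if "b \<in> carrier A" for b
      using pS[of \<zero> b 0] that by simp_all
    \<comment> \<open>\<open>?X\<close> is the product in the other order; it cancels.\<close>
    let ?X = "p (f j \<otimes> e i) (l j) \<oplus>\<^bsub>T\<^esub> p (e i) (f j) \<oplus>\<^bsub>T\<^esub> (p (f j \<otimes> k i) (l j \<otimes> e i) \<oplus>\<^bsub>T\<^esub> p (k i) (f j \<otimes> e i))"
    have fe: "?y \<otimes>\<^bsub>T\<^esub> ?x = ?X"
      by (simp add: T.l_distr T.r_distr)
    have "?x \<otimes>\<^bsub>T\<^esub> ?y
        = (p S (l j) \<oplus>\<^bsub>T\<^esub> p (k i) S) \<oplus>\<^bsub>T\<^esub> ?X"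
      using mix by (simp add: T.l_distr T.r_distr ef1 pD T.M.a_ac)
    then have "?x \<otimes>\<^bsub>T\<^esub> ?y \<oplus>\<^bsub>T\<^esub> (-1) \<odot>\<^bsub>T\<^esub> (?y \<otimes>\<^bsub>T\<^esub> ?x)
        = p S (l j) \<oplus>\<^bsub>T\<^esub> p (k i) S"
      unfolding fe using T.M.a_assoc[of "p S (l j) \<oplus>\<^bsub>T\<^esub> p (k i) S" ?X "(-1) \<odot>\<^bsub>T\<^esub> ?X"] T.self_diff[of ?X]
      by (simp del: T.self_diff)
    also have "\<dots> = (if i = j then ?Q \<odot>\<^bsub>T\<^esub> (p (k i) (k i) \<oplus>\<^bsub>T\<^esub> (-1) \<odot>\<^bsub>T\<^esub> p (l i) (l i)) else \<zero>\<^bsub>T\<^esub>)"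
    proof (cases "i = j")
      case True
      have "(p (k i) (l i) \<oplus>\<^bsub>T\<^esub> (-1) \<odot>\<^bsub>T\<^esub> p (l i) (l i)) \<oplus>\<^bsub>T\<^esub> (p (k i) (k i) \<oplus>\<^bsub>T\<^esub> (-1) \<odot>\<^bsub>T\<^esub> p (k i) (l i))
          = (p (k i) (k i) \<oplus>\<^bsub>T\<^esub> (-1) \<odot>\<^bsub>T\<^esub> p (l i) (l i)) \<oplus>\<^bsub>T\<^esub> (p (k i) (l i) \<oplus>\<^bsub>T\<^esub> (-1) \<odot>\<^bsub>T\<^esub> p (k i) (l i))"
        by (simp add: T.M.a_ac del: T.self_diff)
      also have "\<dots> = p (k i) (k i) \<oplus>\<^bsub>T\<^esub> (-1) \<odot>\<^bsub>T\<^esub> p (l i) (l i)" by simp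
      finally show ?thesis
        using True by (simp add: S_def pD pS T.smult_add_r[symmetric])
    qed (simp add: S_def p0)
    finally show "?x \<otimes>\<^bsub>T\<^esub> ?y \<oplus>\<^bsub>T\<^esub> (-1) \<odot>\<^bsub>T\<^esub> (?y \<otimes>\<^bsub>T\<^esub> ?x)
        = (if i = j then ?Q \<odot>\<^bsub>T\<^esub> (p (k i) (k i) \<oplus>\<^bsub>T\<^esub> (-1) \<odot>\<^bsub>T\<^esub> p (l i) (l i)) else \<zero>\<^bsub>T\<^esub>)" .
    assume ij: "i \<noteq> j"
    have g: "(q i)\<^sup>2 \<noteq> 0" by simp
    have cii: "C i i = 2" if "i \<le> n" for i using datum that
      by (auto simp: untwisted_affine_datum_def Let_def generalized_cartan_matrix_def)
    then have kx: "scomm A (k i) (e i) ((q i)\<^sup>2)" "scomm A (l i) (f i) ((q i)\<^sup>2)"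
      using ke[OF i i] lf[OF i i] i by simp_all
    have kj: "scomm A (k j) (e i) (q i powi C i j)" "scomm A (l j) (f i) (q i powi C i j)"
      using ke[OF j i] lf[OF j i] q_symm[OF i j] by simp_all
    note one = scomm_one
    have "qcomms T (p (e i) \<one> \<oplus>\<^bsub>T\<^esub> p (k i) \<one> \<otimes>\<^bsub>T\<^esub> p \<one> (e i)) (serre_list D h i j)
        (p (e j) \<one> \<oplus>\<^bsub>T\<^esub> p (k j) \<one> \<otimes>\<^bsub>T\<^esub> p \<one> (e j)) = \<zero>\<^bsub>T\<^esub>"
      unfolding serre_list_def
    proof (rule T.serre_sum)
      show "qcomms T (p (e i) \<one>) (geo (q i powi C i j) ((q i)\<^sup>2) (nat (1 - C i j))) (p (e j) \<one>) = \<zero>\<^bsub>T\<^esub>"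
        using serre_e[OF i j ij] TT.qcomms_pure_l[of "e i" "e j"] by (simp add: serre_list_def T_def p_def)
      show "qcomms T (p \<one> (e i)) (geo (q i powi C i j) ((q i)\<^sup>2) (nat (1 - C i j))) (p \<one> (e j)) = \<zero>\<^bsub>T\<^esub>"
        using serre_e[OF i j ij] TT.qcomms_pure_r[of "e i" "e j"] by (simp add: serre_list_def T_def p_def)
      show "scomm T (p (k i) \<one>) (p (e i) \<one>) ((q i)\<^sup>2)" by (rule sc[OF kx(1) one(1)]) simp_all
      show "scomm T (p (k i) \<one>) (p (e j) \<one>) (q i powi C i j)" by (rule sc[OF ke[OF i j] one(1)]) simp_all
      show "scomm T (p (k j) \<one>) (p (e i) \<one>) (q i powi C i j)" by (rule sc[OF kj(1) one(1)]) simp_all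
      show "scomm T (p (k j) \<one>) (p (k i) \<one>) 1" by (rule sc[OF kk[OF j i] one(1)]) simp_all
      show "q i powi C i j * (q i powi C i j * ((q i)\<^sup>2) ^ (nat (1 - C i j) - 1)) = 1"
        by (rule serre_scalar[OF i j ij])
    qed (simp_all add: sc[OF one(1) one(2)])
    then show "qcomms T (p (e i) \<one> \<oplus>\<^bsub>T\<^esub> p (k i) (e i)) (serre_list D h i j)
        (p (e j) \<one> \<oplus>\<^bsub>T\<^esub> p (k j) (e j)) = \<zero>\<^bsub>T\<^esub>" by simp
    have "qcomms T (p \<one> (f i) \<oplus>\<^bsub>T\<^esub> p \<one> (l i) \<otimes>\<^bsub>T\<^esub> p (f i) \<one>) (serre_list D h i j)
        (p \<one> (f j) \<oplus>\<^bsub>T\<^esub> p \<one> (l j) \<otimes>\<^bsub>T\<^esub> p (f j) \<one>) = \<zero>\<^bsub>T\<^esub>"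
      unfolding serre_list_def
    proof (rule T.serre_sum)
      show "qcomms T (p (f i) \<one>) (geo (q i powi C i j) ((q i)\<^sup>2) (nat (1 - C i j))) (p (f j) \<one>) = \<zero>\<^bsub>T\<^esub>"
        using serre_f[OF i j ij] TT.qcomms_pure_l[of "f i" "f j"] by (simp add: serre_list_def T_def p_def)
      show "qcomms T (p \<one> (f i)) (geo (q i powi C i j) ((q i)\<^sup>2) (nat (1 - C i j))) (p \<one> (f j)) = \<zero>\<^bsub>T\<^esub>"
        using serre_f[OF i j ij] TT.qcomms_pure_r[of "f i" "f j"] by (simp add: serre_list_def T_def p_def)
      show "scomm T (p \<one> (l i)) (p \<one> (f i)) ((q i)\<^sup>2)" by (rule sc[OF one(1) kx(2)]) simp_all
      show "scomm T (p \<one> (l i)) (p \<one> (f j)) (q i powi C i j)" by (rule sc[OF one(1) lf[OF i j]]) simp_all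
      show "scomm T (p \<one> (l j)) (p \<one> (f i)) (q i powi C i j)" by (rule sc[OF one(1) kj(2)]) simp_all
      show "scomm T (p \<one> (l j)) (p \<one> (l i)) 1" by (rule sc[OF one(1) ll[OF j i]]) simp_all
      show "q i powi C i j * (q i powi C i j * ((q i)\<^sup>2) ^ (nat (1 - C i j) - 1)) = 1"
        by (rule serre_scalar[OF i j ij])
    qed (simp_all add: sc[OF one(2) one(1)])
    then show "qcomms T (p (f i) (l i) \<oplus>\<^bsub>T\<^esub> p \<one> (f i)) (serre_list D h i j)
        (p (f j) (l j) \<oplus>\<^bsub>T\<^esub> p \<one> (f j)) = \<zero>\<^bsub>T\<^esub>" by (simp add: T.M.a_comm)
  next
    show "kprod T D (\<lambda>i. p (k i) (k i)) [0..<Suc n] = \<one>\<^bsub>T\<^esub>"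
      using TT.kprod_pure[of k k D "[0..<Suc n]"] kprod by (simp add: T_def p_def del: upt_Suc)
  qed (simp_all add: kl)
qed

end

lemma qdatum_uminus: "qdatum D h \<Longrightarrow> qdatum D (- h)"
proof -
  assume "qdatum D h"
  then interpret qdatum D h .
  have "exp (- h) ^ m \<noteq> 1" if "m > 0" for m
    using generic[OF that] by (simp add: exp_minus power_inverse)
  then show ?thesis using datum by (simp add: qdatum_def)
qed

lemma qq_uminus: "qq D (- h) i = inverse (qq D h i)"
  by (simp add: qq_def exp_minus power_inverse)

context qfamily
begin

text \<open>The exponents of the parameters are symmetric about zero.\<close>

lemma serre_list_uminus:
  assumes i: "i \<le> n" and j: "j \<le> n" and ij: "i \<noteq> j"
  shows "serre_list D (- h) i j = rev (serre_list D h i j)"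
proof -
  have "q i powi C i j * (q i ^ 2) ^ (nat (1 - C i j) - 1) = inverse (q i powi C i j)"
    using serre_scalar[OF assms] inverse_unique by metis
  then show ?thesis
    unfolding serre_list_def by (subst rev_geo) (simp_all add: qq_uminus power_int_inverse power_inverse divide_inverse)
qed

text \<open>Passing from \<open>q\<close> to \<open>q\<^sup>-\<^sup>1\<close> reverses the list of parameters in the Serre relations, which does not
  affect the iterated q-commutator, and multiplication by \<open>k\<^sub>i\<^sup>-\<^sup>1\<close> is handled by \<open>serre_twist\<close>.\<close>

lemma qfamily_sigma:
  "qfamily D (- h) A (\<lambda>i. (-1) \<odot> (l i \<otimes> e i)) (\<lambda>i. (-1) \<odot> (f i \<otimes> k i)) l k"
proof (intro qfamily.intro qfamily_axioms.intro qdatum_uminus[OF qdatum_axioms] calg_axioms)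
  show "kprod A D l [0..<Suc n] = \<one>" by (rule kprod_inverse)
  fix i j assume i: "i \<le> n" and j: "j \<le> n"
  show "scomm A (l i) (l j) 1" by (rule ll[OF i j])
  show "scomm A (l i) ((-1) \<odot> (l j \<otimes> e j)) (qq D (- h) i powi C i j)"
    using scomm_mult_r[OF ll[OF i j] le[OF i j]]
    by (intro scomm_smult) (simp_all add: qq_uminus power_int_inverse divide_inverse)
  show "scomm A (l i) ((-1) \<odot> (f j \<otimes> k j)) (qq D (- h) i powi (- C i j))"
    using scomm_mult_r[OF lf[OF i j] lk[OF i j]]
    by (intro scomm_smult) (simp_all add: qq_uminus power_int_minus power_int_inverse)
  \<comment> \<open>The scalars from moving \<open>l\<^sub>i\<close> past \<open>f\<^sub>j\<close> and \<open>k\<^sub>j\<close> past \<open>e\<^sub>i\<close> are inverse to each other.\<close>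
  have fkl: "f j \<otimes> (k j \<otimes> (l i \<otimes> e i)) = l i \<otimes> (f j \<otimes> (e i \<otimes> k j))"
  proof -
    have "f j \<otimes> (k j \<otimes> (l i \<otimes> e i)) = f j \<otimes> (l i \<otimes> (k j \<otimes> e i))"
      using scomm_l[OF kl_comm[OF j i]] by simp
    also have "\<dots> = (q j powi C j i) \<odot> (f j \<otimes> (l i \<otimes> (e i \<otimes> k j)))"
      by (simp add: scommD[OF ke[OF j i]] smult_mult_r)
    also have "f j \<otimes> (l i \<otimes> (e i \<otimes> k j)) = (1 / (q i powi C i j)) \<odot> (l i \<otimes> (f j \<otimes> (e i \<otimes> k j)))"
      by (rule scomm_l[OF scomm_sym[OF lf[OF i j]]]) (simp_all add: power_int_not_zero)
    finally show ?thesis by (simp add: q_symm[OF i j] smult_smult power_int_not_zero)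
  qed
  let ?Q = "1 / (q i - inverse (q i))"
  have "l i \<otimes> (e i \<otimes> f j \<oplus> (-1) \<odot> (f j \<otimes> e i)) \<otimes> k j
      = l i \<otimes> (if i = j then ?Q \<odot> (k i \<oplus> (-1) \<odot> l i) else \<zero>) \<otimes> k j"
    by (simp only: ef[OF i j])
  also have "\<dots> = (if i = j then ?Q \<odot> (k i \<oplus> (-1) \<odot> l i) else \<zero>)"
    using kl[OF i] m_assoc[of "l i" "k i" "k i"]
    by (auto simp: smult_mult_l smult_mult_r r_distr l_distr m_assoc)
  also have "\<dots> = (if i = j then (1 / (qq D (- h) i - inverse (qq D (- h) i))) \<odot> (l i \<oplus> (-1) \<odot> k i) else \<zero>)"
  proof -
    have "1 / (inverse (q i) - q i) = - (1 / (q i - inverse (q i)))" for i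
      using minus_divide_right[of 1 "q i - inverse (q i)"] by simp
    then show ?thesis by (simp add: qq_uminus smult_add_r smult_smult M.a_comm)
  qed
  finally have *: "l i \<otimes> (e i \<otimes> f j \<oplus> (-1) \<odot> (f j \<otimes> e i)) \<otimes> k j
    = (if i = j then (1 / (qq D (- h) i - inverse (qq D (- h) i))) \<odot> (l i \<oplus> (-1) \<odot> k i) else \<zero>)" .
  show "((-1) \<odot> (l i \<otimes> e i)) \<otimes> ((-1) \<odot> (f j \<otimes> k j)) \<oplus> (-1) \<odot> (((-1) \<odot> (f j \<otimes> k j)) \<otimes> ((-1) \<odot> (l i \<otimes> e i)))
      = (if i = j then (1 / (qq D (- h) i - inverse (qq D (- h) i))) \<odot> (l i \<oplus> (-1) \<odot> k i) else \<zero>)"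
    unfolding *[symmetric]
    by (simp add: smult_mult_l smult_mult_r smult_smult r_distr l_distr m_assoc fkl)
  assume ij: "i \<noteq> j"
  show "qcomms A ((-1) \<odot> (l i \<otimes> e i)) (serre_list D (- h) i j) ((-1) \<odot> (l j \<otimes> e j)) = \<zero>"
  proof (rule serre_twist)
    show "scomm A (e i) (l i) (q i powi C i i)" by (rule el[OF i i])
    show "scomm A (e i) (l j) (q i powi C i j)" using el[OF i j] q_symm[OF i j] by simp
    show "scomm A (e j) (l i) (q i powi C i j)" by (rule el[OF j i])
    show "scomm A (l j) (l i) 1" by (rule ll[OF j i])
    show "qcomms A (e i) (serre_list D (- h) i j) (e j) = \<zero>"
      using serre_e[OF i j ij] by (simp add: serre_list_uminus[OF i j ij] qcomms_rev)
  qed simp_all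
  have fkkf: "(-1) \<odot> (f i \<otimes> k i) = (- (q i powi C i i)) \<odot> (k i \<otimes> f i)" if "i \<le> n" for i
    using scommD[OF fk[OF that that]] by (simp add: smult_smult)
  show "qcomms A ((-1) \<odot> (f i \<otimes> k i)) (serre_list D (- h) i j) ((-1) \<odot> (f j \<otimes> k j)) = \<zero>"
    unfolding fkkf[OF i] fkkf[OF j]
  proof (rule serre_twist)
    show "scomm A (f i) (k i) (q i powi C i i)" by (rule fk[OF i i])
    show "scomm A (f i) (k j) (q i powi C i j)" using fk[OF i j] q_symm[OF i j] by simp
    show "scomm A (f j) (k i) (q i powi C i j)" by (rule fk[OF j i])
    show "scomm A (k j) (k i) 1" by (rule kk[OF j i])
    show "qcomms A (f i) (serre_list D (- h) i j) (f j) = \<zero>"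
      using serre_f[OF i j ij] by (simp add: serre_list_uminus[OF i j ij] qcomms_rev)
  qed simp_all
qed (simp_all add: kl)

end

section \<open>The coproduct and the isomorphism with the inverse parameter\<close>

locale qalg = qdatum D h + presentation D h for D h
begin

lemma gens_mem [simp]:
  "i \<le> n \<Longrightarrow> E i \<in> gens D" "i \<le> n \<Longrightarrow> F i \<in> gens D" "i \<le> n \<Longrightarrow> K i \<in> gens D" "i \<le> n \<Longrightarrow> Kinv i \<in> gens D"
  by (auto simp: gens_def)

lemma rel_gen_eq: "g \<in> gens D \<Longrightarrow> rel_gen D h g = ugen D h g"
  by (simp add: rel_gen_def)

sublocale fam: qfamily D h U "\<lambda>i. rel_gen D h (E i)" "\<lambda>i. rel_gen D h (F i)"
  "\<lambda>i. rel_gen D h (K i)" "\<lambda>i. rel_gen D h (Kinv i)"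
proof (rule qfamilyI[OF U.calg_axioms])
  have "case_gen (\<lambda>i. rel_gen D h (E i)) (\<lambda>i. rel_gen D h (F i)) (\<lambda>i. rel_gen D h (K i))
      (\<lambda>i. rel_gen D h (Kinv i)) = rel_gen D h"
    by (rule ext) (simp split: gen.split)
  then show "ev U (case_gen (\<lambda>i. rel_gen D h (E i)) (\<lambda>i. rel_gen D h (F i)) (\<lambda>i. rel_gen D h (K i))
      (\<lambda>i. rel_gen D h (Kinv i))) r = \<zero>\<^bsub>U\<^esub>" if "r \<in> relations D h" for r
    using U_relation[OF that] by simp
qed simp_all

lemma ugen_KKinv:
  "i \<le> n \<Longrightarrow> ugen D h (K i) \<otimes>\<^bsub>U\<^esub> ugen D h (Kinv i) = \<one>\<^bsub>U\<^esub>"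
  "i \<le> n \<Longrightarrow> ugen D h (Kinv i) \<otimes>\<^bsub>U\<^esub> ugen D h (K i) = \<one>\<^bsub>U\<^esub>"
  using fam.kl[of i] by (simp_all add: rel_gen_eq)

text \<open>A homomorphism preserves inverses, so the image of \<open>k\<^sub>i\<close> determines that of \<open>k\<^sub>i\<^sup>-\<^sup>1\<close>.\<close>

lemma U_hom_unique:
  assumes \<phi>: "\<phi> \<in> alg_hom U A" and \<psi>: "\<psi> \<in> alg_hom U A" and "calg A"
    and eq: "\<And>i. i \<le> n \<Longrightarrow> \<phi> (ugen D h (E i)) = \<psi> (ugen D h (E i))"
      "\<And>i. i \<le> n \<Longrightarrow> \<phi> (ugen D h (F i)) = \<psi> (ugen D h (F i))"
      "\<And>i. i \<le> n \<Longrightarrow> \<phi> (ugen D h (K i)) = \<psi> (ugen D h (K i))"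
    and x: "x \<in> carrier U"
  shows "\<phi> x = \<psi> x"
proof (rule U_hom_eqI[OF \<phi> \<psi> _ x])
  interpret A: calg A by fact
  fix g assume "g \<in> gens D"
  then obtain i where i: "i \<le> n" "g \<in> {E i, F i, K i, Kinv i}" by (auto simp: gens_def)
  have inv: "\<phi> (ugen D h (K i)) \<otimes>\<^bsub>A\<^esub> \<phi> (ugen D h (Kinv i)) = \<one>\<^bsub>A\<^esub>"
    "\<psi> (ugen D h (Kinv i)) \<otimes>\<^bsub>A\<^esub> \<psi> (ugen D h (K i)) = \<one>\<^bsub>A\<^esub>"
    using alg_homD(3)[OF \<phi>, of "ugen D h (K i)" "ugen D h (Kinv i)", symmetric]
      alg_homD(3)[OF \<psi>, of "ugen D h (Kinv i)" "ugen D h (K i)", symmetric] i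
    by (simp_all add: ugen_KKinv alg_homD(2)[OF \<phi>] alg_homD(2)[OF \<psi>])
  have "\<psi> (ugen D h (Kinv i)) = \<phi> (ugen D h (Kinv i))"
    by (rule A.inv_unique[of _ "\<phi> (ugen D h (K i))"])
      (use inv eq(3) i alg_homD(4)[OF \<phi>] alg_homD(4)[OF \<psi>] in auto)
  then show "\<phi> (ugen D h g) = \<psi> (ugen D h g)" using i eq by auto
qed

text \<open>Resolves the definite descriptions by which the coproduct and \<open>\<sigma>\<close> are given: \<open>P i\<close> prescribes
  the images of \<open>e\<^sub>i\<close>, \<open>f\<^sub>i\<close> and \<open>k\<^sub>i\<close>.\<close>

lemma U_hom_THE:
  assumes ex: "\<phi> \<in> alg_hom U A" "\<And>i. i \<le> n \<Longrightarrow> P i (\<phi> (ugen D h (E i))) (\<phi> (ugen D h (F i))) (\<phi> (ugen D h (K i)))"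
    and "calg A"
    and uniq: "\<And>i x y z x' y' z'. i \<le> n \<Longrightarrow> P i x y z \<Longrightarrow> P i x' y' z' \<Longrightarrow> x = x' \<and> y = y' \<and> z = z'"
  shows "(THE \<phi>. \<phi> \<in> extensional (carrier U) \<and> \<phi> \<in> alg_hom U A \<and>
      (\<forall>i\<le>n. P i (\<phi> (ugen D h (E i))) (\<phi> (ugen D h (F i))) (\<phi> (ugen D h (K i))))) = restrict \<phi> (carrier U)"
proof (rule the_equality)
  have r: "restrict \<phi> (carrier U) \<in> alg_hom U A"
    by (rule alg_hom_cong[OF ex(1) U.calg_axioms]) simp
  then show "restrict \<phi> (carrier U) \<in> extensional (carrier U) \<and> restrict \<phi> (carrier U) \<in> alg_hom U A \<and>
      (\<forall>i\<le>n. P i (restrict \<phi> (carrier U) (ugen D h (E i))) (restrict \<phi> (carrier U) (ugen D h (F i)))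
        (restrict \<phi> (carrier U) (ugen D h (K i))))"
    using ex(2) by simp
  fix \<psi> assume \<psi>: "\<psi> \<in> extensional (carrier U) \<and> \<psi> \<in> alg_hom U A \<and>
      (\<forall>i\<le>n. P i (\<psi> (ugen D h (E i))) (\<psi> (ugen D h (F i))) (\<psi> (ugen D h (K i))))"
  show "\<psi> = restrict \<phi> (carrier U)"
  proof (rule extensionalityI[of _ "carrier U"])
    fix x assume x: "x \<in> carrier U"
    have "\<psi> (ugen D h (E i)) = \<phi> (ugen D h (E i)) \<and> \<psi> (ugen D h (F i)) = \<phi> (ugen D h (F i))
        \<and> \<psi> (ugen D h (K i)) = \<phi> (ugen D h (K i))" if "i \<le> n" for i
      using uniq[OF that _ ex(2)[OF that]] \<psi> that by blast
    then have "\<psi> x = \<phi> x"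
      by (intro U_hom_unique[OF _ ex(1) \<open>calg A\<close> _ _ _ x]) (use \<psi> in auto)
    then show "\<psi> x = restrict \<phi> (carrier U) x" using x by simp
  qed (use \<psi> in auto)
qed

abbreviation "UU \<equiv> tensor_algebra U U"
abbreviation "pU \<equiv> pure_tensor U U"

sublocale UU: tens_alg U U by (rule tens_algI) (rule U.calg_axioms)+

lemma coproduct:
  shows "coproduct D h \<in> alg_hom U UU"
    "i \<le> n \<Longrightarrow> coproduct D h (ugen D h (E i)) =
       pU (ugen D h (E i)) \<one>\<^bsub>U\<^esub> \<oplus>\<^bsub>UU\<^esub> pU (ugen D h (K i)) (ugen D h (E i))"
    "i \<le> n \<Longrightarrow> coproduct D h (ugen D h (K i)) = pU (ugen D h (K i)) (ugen D h (K i))"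
    "i \<le> n \<Longrightarrow> coproduct D h (ugen D h (Kinv i)) = pU (ugen D h (Kinv i)) (ugen D h (Kinv i))"
proof -
  let ?g = "rel_gen D h"
  let ?e = "\<lambda>i. pU (?g (E i)) \<one>\<^bsub>U\<^esub> \<oplus>\<^bsub>UU\<^esub> pU (?g (K i)) (?g (E i))"
    and ?f = "\<lambda>i. pU (?g (F i)) (?g (Kinv i)) \<oplus>\<^bsub>UU\<^esub> pU \<one>\<^bsub>U\<^esub> (?g (F i))"
    and ?k = "\<lambda>i. pU (?g (K i)) (?g (K i))" and ?l = "\<lambda>i. pU (?g (Kinv i)) (?g (Kinv i))"
  interpret T: qfamily D h UU ?e ?f ?k ?l by (rule fam.qfamily_coproduct)
  let ?c = "case_gen ?e ?f ?k ?l"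
  have fc: "?c g \<in> carrier UU" for g by (cases g) (simp_all only: gen.case T.fam_closed)
  obtain \<phi> where \<phi>: "\<phi> \<in> alg_hom U UU" "\<And>g. g \<in> gens D \<Longrightarrow> \<phi> (ugen D h g) = ?c g"
    using U_hom_exists[OF T.calg_axioms fc T.relations_hold] by blast
  have eq: "coproduct D h = restrict \<phi> (carrier U)"
    unfolding coproduct_def Let_def
    by (rule U_hom_THE[OF \<phi>(1) _ T.calg_axioms, where P = "\<lambda>i x y z.
       x = pU (ugen D h (E i)) \<one>\<^bsub>U\<^esub> \<oplus>\<^bsub>UU\<^esub> pU (ugen D h (K i)) (ugen D h (E i)) \<and>
       y = pU (ugen D h (F i)) (ugen D h (Kinv i)) \<oplus>\<^bsub>UU\<^esub> pU \<one>\<^bsub>U\<^esub> (ugen D h (F i)) \<and>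
       z = pU (ugen D h (K i)) (ugen D h (K i))"])
      (simp_all add: \<phi>(2) rel_gen_eq)
  show "coproduct D h \<in> alg_hom U UU"
    unfolding eq by (rule alg_hom_cong[OF \<phi>(1) U.calg_axioms]) simp
  show "i \<le> n \<Longrightarrow> coproduct D h (ugen D h (E i)) =
       pU (ugen D h (E i)) \<one>\<^bsub>U\<^esub> \<oplus>\<^bsub>UU\<^esub> pU (ugen D h (K i)) (ugen D h (E i))"
    "i \<le> n \<Longrightarrow> coproduct D h (ugen D h (K i)) = pU (ugen D h (K i)) (ugen D h (K i))"
    "i \<le> n \<Longrightarrow> coproduct D h (ugen D h (Kinv i)) = pU (ugen D h (Kinv i)) (ugen D h (Kinv i))"
    by (simp_all add: eq \<phi>(2) rel_gen_eq)
qed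

subsection \<open>The Borel subalgebra\<close>

definition "bgens = ugen D h ` (\<Union>i\<in>{0..n}. {E i, K i, Kinv i})"

abbreviation "B \<equiv> borel D h"

lemma bgens_carrier: "bgens \<subseteq> carrier U"
  by (auto simp: bgens_def)

lemma B_eq: "B = U\<lparr>carrier := alg_span U bgens\<rparr>"
  by (simp add: borel_def bgens_def)

lemma B_simps [simp]:
  "mult B = mult U" "one B = one U" "zero B = zero U" "add B = add U" "smult B = smult U"
  by (simp_all add: B_eq)

lemma subalg_B: "subalg (carrier B) U"
  using U.alg_span_subalg(1)[OF bgens_carrier] by (simp add: B_eq)

sublocale B: calg B
  using U.calg_sub[OF U.alg_span_subalg(1)[OF bgens_carrier]] by (simp add: B_eq)

lemma B_carrier: "x \<in> carrier B \<Longrightarrow> x \<in> carrier U"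
  using U.subalgD(1)[OF subalg_B] by auto

lemma bgen_closed [simp]:
  "i \<le> n \<Longrightarrow> ugen D h (E i) \<in> carrier B" "i \<le> n \<Longrightarrow> ugen D h (K i) \<in> carrier B"
  "i \<le> n \<Longrightarrow> ugen D h (Kinv i) \<in> carrier B"
  using U.alg_span_subalg(2)[OF bgens_carrier] by (auto simp: B_eq bgens_def)

lemma B_minimal:
  assumes "subalg S U" "\<And>i. i \<le> n \<Longrightarrow> ugen D h (E i) \<in> S" "\<And>i. i \<le> n \<Longrightarrow> ugen D h (K i) \<in> S"
    "\<And>i. i \<le> n \<Longrightarrow> ugen D h (Kinv i) \<in> S"
  shows "carrier B \<subseteq> S"
proof -
  have "bgens \<subseteq> S" using assms(2-4) by (auto simp: bgens_def)
  from U.alg_span_minimal[OF assms(1) this] show ?thesis by (simp add: B_eq)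
qed

lemma B_induct [consumes 1, case_names one mult add smult E K Kinv]:
  assumes "x \<in> carrier B" and "P \<one>\<^bsub>U\<^esub>"
    and "\<And>x y. x \<in> carrier B \<Longrightarrow> y \<in> carrier B \<Longrightarrow> P x \<Longrightarrow> P y \<Longrightarrow> P (x \<otimes>\<^bsub>U\<^esub> y)"
    and "\<And>x y. x \<in> carrier B \<Longrightarrow> y \<in> carrier B \<Longrightarrow> P x \<Longrightarrow> P y \<Longrightarrow> P (x \<oplus>\<^bsub>U\<^esub> y)"
    and "\<And>c x. x \<in> carrier B \<Longrightarrow> P x \<Longrightarrow> P (c \<odot>\<^bsub>U\<^esub> x)"
    and "\<And>i. i \<le> n \<Longrightarrow> P (ugen D h (E i))" "\<And>i. i \<le> n \<Longrightarrow> P (ugen D h (K i))"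
      "\<And>i. i \<le> n \<Longrightarrow> P (ugen D h (Kinv i))"
  shows "P x"
proof -
  have "subalg {x \<in> carrier B. P x} U"
    using assms U.subalgD[OF subalg_B] by (intro U.subalgI) auto
  then have "carrier B \<subseteq> {x \<in> carrier B. P x}" using assms(6-8) by (intro B_minimal) auto
  then show ?thesis using assms(1) by auto
qed

abbreviation "BB \<equiv> tensor_algebra B B"
abbreviation "pB \<equiv> pure_tensor B B"

sublocale BB: tens_alg B B by (rule tens_algI) (rule B.calg_axioms)+

abbreviation "BU \<equiv> tensor_map B B U U (\<lambda>x. x) (\<lambda>x. x)"

lemma incl_alg_hom: "(\<lambda>x. x) \<in> alg_hom B U"
  by (rule alg_homI) (simp_all add: lin_hom_def B_carrier)

lemma BU_alg_hom: "BU \<in> alg_hom BB UU"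
  using incl_alg_hom B.calg_axioms U.calg_axioms by (intro tensor_map_alg_hom)

lemma BU_pure: "x \<in> carrier B \<Longrightarrow> y \<in> carrier B \<Longrightarrow> BU (pB x y) = pU x y"
  using incl_alg_hom by (intro tensor_map(2) B.cvec_axioms U.cvec_axioms) (simp_all add: alg_hom_def)

lemma BU_inj: "inj_on BU (carrier BB)"
  using tensor_map_inclusion_inj[OF U.cvec_axioms U.cvec_axioms, of "carrier B" "carrier B"]
    U.subalgD(6)[OF subalg_B] by (simp add: B_eq tensor_algebra_def)

text \<open>The elements of \<open>U\<close> whose coproduct lies in the image of \<open>B \<otimes> B\<close> form a subalgebra that
  contains the generators of \<open>B\<close>.\<close>

lemma borel_coproduct_BU:
  assumes "x \<in> carrier B"
  shows "borel_coproduct D h x \<in> carrier BB" "BU (borel_coproduct D h x) = coproduct D h x"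
proof -
  have "calg BB" "calg UU" using BB.calg_TA UU.calg_TA by simp_all
  then have "subalg (BU ` carrier BB) UU" by (rule subalg_image[OF BU_alg_hom])
  then have "subalg {x \<in> carrier U. coproduct D h x \<in> BU ` carrier BB} U"
    by (rule subalg_vimage[OF coproduct(1) U.calg_axioms \<open>calg UU\<close>])
  then have "carrier B \<subseteq> {x \<in> carrier U. coproduct D h x \<in> BU ` carrier BB}"
  proof (rule B_minimal)
    fix i assume i: "i \<le> n"
    let ?e = "ugen D h (E i)" and ?k = "ugen D h (K i)" and ?l = "ugen D h (Kinv i)"
    have "pB ?e \<one>\<^bsub>U\<^esub> \<oplus>\<^bsub>BB\<^esub> pB ?k ?e \<in> carrier BB" using i U.subalgD(2)[OF subalg_B] by simp
    moreover have "BU (pB ?e \<one>\<^bsub>U\<^esub> \<oplus>\<^bsub>BB\<^esub> pB ?k ?e) = coproduct D h ?e"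
      using i U.subalgD(2)[OF subalg_B] by (subst alg_homD(5)[OF BU_alg_hom]) (simp_all add: BU_pure coproduct)
    ultimately show "?e \<in> {x \<in> carrier U. coproduct D h x \<in> BU ` carrier BB}" using i by (auto intro: rev_image_eqI)
    have "BU (pB ?k ?k) = coproduct D h ?k" using i by (simp add: BU_pure coproduct)
    then show "?k \<in> {x \<in> carrier U. coproduct D h x \<in> BU ` carrier BB}" using i by (auto intro: rev_image_eqI)
    have "BU (pB ?l ?l) = coproduct D h ?l" using i by (simp add: BU_pure coproduct)
    then show "?l \<in> {x \<in> carrier U. coproduct D h x \<in> BU ` carrier BB}" using i by (auto intro: rev_image_eqI)
  qed
  then obtain t where t: "t \<in> carrier BB" "BU t = coproduct D h x" using assms by auto
  have "borel_coproduct D h x \<in> carrier BB \<and> BU (borel_coproduct D h x) = coproduct D h x"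
    unfolding borel_coproduct_def Let_def
    by (rule theI[of _ t]) (use t BU_inj in \<open>auto dest: inj_onD\<close>)
  then show "borel_coproduct D h x \<in> carrier BB" "BU (borel_coproduct D h x) = coproduct D h x" by auto
qed

lemma borel_coproduct_eqI:
  "x \<in> carrier B \<Longrightarrow> t \<in> carrier BB \<Longrightarrow> BU t = coproduct D h x \<Longrightarrow> borel_coproduct D h x = t"
  using borel_coproduct_BU[of x] inj_onD[OF BU_inj] by auto

text \<open>The inclusion of \<open>B \<otimes> B\<close> in \<open>U \<otimes> U\<close> is an injective homomorphism, so all properties can be
  checked after applying it.\<close>

lemma borel_coproduct:
  shows "borel_coproduct D h \<in> alg_hom B BB"
    "i \<le> n \<Longrightarrow> borel_coproduct D h (ugen D h (E i)) =
       pB (ugen D h (E i)) \<one>\<^bsub>U\<^esub> \<oplus>\<^bsub>BB\<^esub> pB (ugen D h (K i)) (ugen D h (E i))"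
    "i \<le> n \<Longrightarrow> borel_coproduct D h (ugen D h (K i)) = pB (ugen D h (K i)) (ugen D h (K i))"
    "i \<le> n \<Longrightarrow> borel_coproduct D h (ugen D h (Kinv i)) = pB (ugen D h (Kinv i)) (ugen D h (Kinv i))"
proof -
  interpret TB: calg BB using BB.calg_TA .
  note c = borel_coproduct_BU
  have one: "\<one>\<^bsub>U\<^esub> \<in> carrier B" using U.subalgD(2)[OF subalg_B] .
  show "borel_coproduct D h \<in> alg_hom B BB"
  proof (rule alg_homI[OF lin_homI])
    fix x y a assume x: "x \<in> carrier B" and y: "y \<in> carrier B"
    note xy = x y B_carrier[OF x] B_carrier[OF y]
    show "borel_coproduct D h x \<in> carrier BB" by (rule c(1)[OF x])
    show "borel_coproduct D h (x \<oplus>\<^bsub>B\<^esub> y) = borel_coproduct D h x \<oplus>\<^bsub>BB\<^esub> borel_coproduct D h y"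
      using B.M.a_closed[OF x y] TB.M.a_closed[OF c(1)[OF x] c(1)[OF y]] xy
      by (intro borel_coproduct_eqI)
        (simp_all only: alg_homD(5)[OF BU_alg_hom] alg_homD(5)[OF coproduct(1)] c B_simps)
    show "borel_coproduct D h (x \<otimes>\<^bsub>B\<^esub> y) = borel_coproduct D h x \<otimes>\<^bsub>BB\<^esub> borel_coproduct D h y"
      using B.m_closed[OF x y] TB.m_closed[OF c(1)[OF x] c(1)[OF y]] xy
      by (intro borel_coproduct_eqI)
        (simp_all only: alg_homD(3)[OF BU_alg_hom] alg_homD(3)[OF coproduct(1)] c B_simps)
    show "borel_coproduct D h (a \<odot>\<^bsub>B\<^esub> x) = a \<odot>\<^bsub>BB\<^esub> borel_coproduct D h x"
      using B.smult_cl[OF x] TB.smult_cl[OF c(1)[OF x]] xy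
      by (intro borel_coproduct_eqI)
        (simp_all only: alg_homD(6)[OF BU_alg_hom] alg_homD(6)[OF coproduct(1)] c B_simps)
  next
    show "borel_coproduct D h \<one>\<^bsub>B\<^esub> = \<one>\<^bsub>BB\<^esub>"
      using one TB.one_closed
      by (intro borel_coproduct_eqI)
        (simp_all only: alg_homD(2)[OF BU_alg_hom] alg_homD(2)[OF coproduct(1)] B_simps)
  qed
  assume i: "i \<le> n"
  let ?e = "ugen D h (E i)" and ?k = "ugen D h (K i)" and ?l = "ugen D h (Kinv i)"
  show "borel_coproduct D h ?e = pB ?e \<one>\<^bsub>U\<^esub> \<oplus>\<^bsub>BB\<^esub> pB ?k ?e"
  proof (rule borel_coproduct_eqI)
    show "BU (pB ?e \<one>\<^bsub>U\<^esub> \<oplus>\<^bsub>BB\<^esub> pB ?k ?e) = coproduct D h ?e"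
      using i one by (subst alg_homD(5)[OF BU_alg_hom]) (simp_all add: BU_pure coproduct)
  qed (use i one in simp_all)
  show "borel_coproduct D h ?k = pB ?k ?k" "borel_coproduct D h ?l = pB ?l ?l"
    using i by (simp_all add: borel_coproduct_eqI BU_pure coproduct)
qed

end

subsection \<open>The isomorphism with the algebra for the inverse parameter\<close>

locale qpair = P: qalg D h + M: qalg D "- h" for D h
begin

lemma sigma:
  shows "sigma D h \<in> alg_hom P.U M.U"
    "i \<le> rank D \<Longrightarrow> sigma D h (ugen D h (E i)) = (-1) \<odot>\<^bsub>M.U\<^esub> (ugen D (-h) (Kinv i) \<otimes>\<^bsub>M.U\<^esub> ugen D (-h) (E i))"
    "i \<le> rank D \<Longrightarrow> sigma D h (ugen D h (K i)) = ugen D (-h) (Kinv i)"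
    "i \<le> rank D \<Longrightarrow> sigma D h (ugen D h (Kinv i)) = ugen D (-h) (K i)"
proof -
  let ?g = "rel_gen D (- h)"
  interpret T: qfamily D h M.U "\<lambda>i. (-1) \<odot>\<^bsub>M.U\<^esub> (?g (Kinv i) \<otimes>\<^bsub>M.U\<^esub> ?g (E i))"
    "\<lambda>i. (-1) \<odot>\<^bsub>M.U\<^esub> (?g (F i) \<otimes>\<^bsub>M.U\<^esub> ?g (K i))" "\<lambda>i. ?g (Kinv i)" "\<lambda>i. ?g (K i)"
    using M.fam.qfamily_sigma by simp
  let ?f = "case_gen (\<lambda>i. (-1) \<odot>\<^bsub>M.U\<^esub> (?g (Kinv i) \<otimes>\<^bsub>M.U\<^esub> ?g (E i)))
    (\<lambda>i. (-1) \<odot>\<^bsub>M.U\<^esub> (?g (F i) \<otimes>\<^bsub>M.U\<^esub> ?g (K i))) (\<lambda>i. ?g (Kinv i)) (\<lambda>i. ?g (K i))"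
  have fc: "?f g \<in> carrier M.U" for g by (cases g) (simp_all only: gen.case T.fam_closed)
  obtain \<phi> where \<phi>: "\<phi> \<in> alg_hom P.U M.U" "\<And>g. g \<in> gens D \<Longrightarrow> \<phi> (ugen D h g) = ?f g"
    using P.U_hom_exists[OF M.U.calg_axioms fc T.relations_hold] by blast
  have eq: "sigma D h = restrict \<phi> (carrier P.U)"
    unfolding sigma_def Let_def
    by (rule P.U_hom_THE[OF \<phi>(1) _ M.U.calg_axioms, where P = "\<lambda>i x y z.
       x = \<ominus>\<^bsub>M.U\<^esub> (ugen D (-h) (Kinv i) \<otimes>\<^bsub>M.U\<^esub> ugen D (-h) (E i)) \<and>
       y = \<ominus>\<^bsub>M.U\<^esub> (ugen D (-h) (F i) \<otimes>\<^bsub>M.U\<^esub> ugen D (-h) (K i)) \<and>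
       z = ugen D (-h) (Kinv i)"])
      (simp_all add: \<phi>(2) M.rel_gen_eq M.U.neg_smult)
  show "sigma D h \<in> alg_hom P.U M.U"
    unfolding eq by (rule alg_hom_cong[OF \<phi>(1) P.U.calg_axioms]) simp
  show "i \<le> rank D \<Longrightarrow> sigma D h (ugen D h (E i)) = (-1) \<odot>\<^bsub>M.U\<^esub> (ugen D (-h) (Kinv i) \<otimes>\<^bsub>M.U\<^esub> ugen D (-h) (E i))"
    "i \<le> rank D \<Longrightarrow> sigma D h (ugen D h (K i)) = ugen D (-h) (Kinv i)"
    "i \<le> rank D \<Longrightarrow> sigma D h (ugen D h (Kinv i)) = ugen D (-h) (K i)"
    by (simp_all add: eq \<phi>(2) M.rel_gen_eq)
qed

text \<open>The preimage of the Borel subalgebra under \<open>\<sigma>\<close> is a subalgebra that contains the generators.\<close>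

lemma sigma_B: "sigma D h \<in> alg_hom P.B M.B"
proof -
  note D = alg_homD[OF sigma(1)]
  have "subalg {x \<in> carrier P.U. sigma D h x \<in> carrier M.B} P.U"
    by (rule subalg_vimage[OF sigma(1) P.U.calg_axioms M.U.calg_axioms M.subalg_B])
  then have "carrier P.B \<subseteq> {x \<in> carrier P.U. sigma D h x \<in> carrier M.B}"
    by (rule P.B_minimal) (simp_all add: sigma M.U.subalgD[OF M.subalg_B])
  then show ?thesis
    by (intro alg_homI lin_homI) (auto simp: D P.B_carrier)
qed

end

section \<open>Representations\<close>

locale repn = A: calg A for A :: "(complex, 'u, 'm) module_scheme" +
  fixes V :: "('u, 'v) rep"
  assumes is_rep: "is_rep A V"
begin

sublocale V: cvec V
  using is_rep by (simp add: is_rep_def cvec_def)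

lemma act_lin: "x \<in> carrier A \<Longrightarrow> act V x \<in> lin_hom V V"
  using is_rep by (simp add: is_rep_def)

lemma act_lin_l: "v \<in> carrier V \<Longrightarrow> (\<lambda>x. act V x v) \<in> lin_hom A V"
  using is_rep by (simp add: is_rep_def)

lemma act_one: "v \<in> carrier V \<Longrightarrow> act V \<one>\<^bsub>A\<^esub> v = v"
  using is_rep by (simp add: is_rep_def)

lemma act_mult: "v \<in> carrier V \<Longrightarrow> x \<in> carrier A \<Longrightarrow> y \<in> carrier A \<Longrightarrow>
    act V (x \<otimes>\<^bsub>A\<^esub> y) v = act V x (act V y v)"
  using is_rep by (simp add: is_rep_def)

lemmas act_simps = lin_homD[OF act_lin] lin_homD(2,3)[OF act_lin_l]

end

lemma repnI: "calg A \<Longrightarrow> is_rep A V \<Longrightarrow> repn A V"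
  by (simp add: repn_def repn_axioms_def)

lemma is_repI:
  assumes "cvec V"
    "\<And>x v. x \<in> carrier A \<Longrightarrow> v \<in> carrier V \<Longrightarrow> act V x v \<in> carrier V"
    "\<And>x v w. x \<in> carrier A \<Longrightarrow> v \<in> carrier V \<Longrightarrow> w \<in> carrier V \<Longrightarrow> act V x (v \<oplus>\<^bsub>V\<^esub> w) = act V x v \<oplus>\<^bsub>V\<^esub> act V x w"
    "\<And>c x v. x \<in> carrier A \<Longrightarrow> v \<in> carrier V \<Longrightarrow> act V x (c \<odot>\<^bsub>V\<^esub> v) = c \<odot>\<^bsub>V\<^esub> act V x v"
    "\<And>x y v. x \<in> carrier A \<Longrightarrow> y \<in> carrier A \<Longrightarrow> v \<in> carrier V \<Longrightarrow> act V (x \<oplus>\<^bsub>A\<^esub> y) v = act V x v \<oplus>\<^bsub>V\<^esub> act V y v"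
    "\<And>c x v. x \<in> carrier A \<Longrightarrow> v \<in> carrier V \<Longrightarrow> act V (c \<odot>\<^bsub>A\<^esub> x) v = c \<odot>\<^bsub>V\<^esub> act V x v"
    "\<And>v. v \<in> carrier V \<Longrightarrow> act V \<one>\<^bsub>A\<^esub> v = v"
    "\<And>x y v. x \<in> carrier A \<Longrightarrow> y \<in> carrier A \<Longrightarrow> v \<in> carrier V \<Longrightarrow> act V (x \<otimes>\<^bsub>A\<^esub> y) v = act V x (act V y v)"
  shows "is_rep A V"
  using assms unfolding is_rep_def cvec_def by (auto intro!: lin_homI)

lemma pullback_simps [simp]:
  "carrier (pullback \<sigma> V) = carrier V" "zero (pullback \<sigma> V) = zero V" "add (pullback \<sigma> V) = add V"
  "smult (pullback \<sigma> V) = smult V" "act (pullback \<sigma> V) x = act V (\<sigma> x)"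
  by (simp_all add: pullback_def module.defs rep.defs)

lemma is_rep_pullback:
  assumes "\<sigma> \<in> alg_hom B A" "calg A" "calg B" "is_rep A V"
  shows "is_rep B (pullback \<sigma> V)"
proof -
  interpret repn A V using assms by (intro repnI)
  interpret B: calg B by fact
  note D = alg_homD[OF assms(1)]
  show ?thesis
    by (rule is_repI[OF cvec_cong[OF V.cvec_axioms]]) (simp_all add: D act_simps act_one act_mult)
qed

text \<open>The external tensor product of two representations, as a representation of the tensor
  product algebra. The module \<open>V \<otimes> W\<close> over the Borel subalgebra is its restriction along the
  coproduct.\<close>

definition tensor_act ::
    "(complex, 'a, 'm) module_scheme \<Rightarrow> (complex, 'b, 'n) module_scheme \<Rightarrow> ('a, 'v) rep \<Rightarrow> ('b, 'w) rep \<Rightarrow>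
     ('a \<times> 'b \<Rightarrow>\<^sub>0 complex) set \<Rightarrow> ('v \<times> 'w \<Rightarrow>\<^sub>0 complex) set \<Rightarrow> ('v \<times> 'w \<Rightarrow>\<^sub>0 complex) set" where
  "tensor_act A B V W s m =
    tensor_lift A B (tensor_space V W) (\<lambda>y z. tensor_map V W V W (act V y) (act W z) m) s"

locale rep_pair = V: repn A V + W: repn C W
  for A :: "(complex, 'a, 'm) module_scheme" and C :: "(complex, 'b, 'n) module_scheme"
    and V :: "('a, 'v) rep" and W :: "('b, 'w) rep"
begin

sublocale AC: tens_alg A C by (rule tens_algI) (rule V.A.calg_axioms W.A.calg_axioms)+
sublocale VW: tens V W by (rule tensI) (rule V.V.cvec_axioms W.V.cvec_axioms)+

abbreviation "tm y z \<equiv> tensor_map V W V W (act V y) (act W z)"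
abbreviation "ta \<equiv> tensor_act A C V W"

lemma tmap:
  assumes "y \<in> carrier A" "z \<in> carrier C"
  shows "tm y z \<in> lin_hom VW.T VW.T"
    "v \<in> carrier V \<Longrightarrow> w \<in> carrier W \<Longrightarrow>
       tm y z (VW.pt v w) = VW.pt (act V y v) (act W z w)"
  using tensor_map[OF V.act_lin[OF assms(1)] W.act_lin[OF assms(2)] V.V.cvec_axioms W.V.cvec_axioms
      V.V.cvec_axioms W.V.cvec_axioms] by auto

lemmas tmapD = lin_homD[OF tmap(1)]

lemma tmap_bilin:
  assumes "m \<in> carrier VW.T"
  shows "(\<lambda>y z. tm y z m) \<in> bilin_hom A C VW.T"
proof (rule bilin_homI)
  fix y z z' assume *: "y \<in> carrier A" "z \<in> carrier C" "z' \<in> carrier C"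
  show "tm y (z \<oplus>\<^bsub>C\<^esub> z') m =
      tm y z m \<oplus>\<^bsub>VW.T\<^esub> tm y z' m"
    using assms
    by (induction m rule: VW.tensor_induct)
      (use * in \<open>simp_all add: tmap tmapD V.act_simps W.act_simps VW.pureD VW.T.M.a_ac\<close>)
next
  fix y y' z assume *: "y \<in> carrier A" "y' \<in> carrier A" "z \<in> carrier C"
  show "tm (y \<oplus>\<^bsub>A\<^esub> y') z m =
      tm y z m \<oplus>\<^bsub>VW.T\<^esub> tm y' z m"
    using assms
    by (induction m rule: VW.tensor_induct)
      (use * in \<open>simp_all add: tmap tmapD V.act_simps W.act_simps VW.pureD VW.T.M.a_ac\<close>)
next
  fix c y z assume *: "y \<in> carrier A" "z \<in> carrier C"
  show "tm y (c \<odot>\<^bsub>C\<^esub> z) m = c \<odot>\<^bsub>VW.T\<^esub> tm y z m"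
    using assms
    by (induction m rule: VW.tensor_induct)
      (use * in \<open>simp_all add: tmap tmapD V.act_simps W.act_simps VW.pureD VW.T.smult_add_r\<close>)
  show "tm (c \<odot>\<^bsub>A\<^esub> y) z m = c \<odot>\<^bsub>VW.T\<^esub> tm y z m"
    using assms
    by (induction m rule: VW.tensor_induct)
      (use * in \<open>simp_all add: tmap tmapD V.act_simps W.act_simps VW.pureD VW.T.smult_add_r\<close>)
qed (use assms tmapD(1) in blast)

lemma ta_lin_l: "m \<in> carrier VW.T \<Longrightarrow> (\<lambda>s. ta s m) \<in> lin_hom AC.T VW.T"
  unfolding tensor_act_def by (rule AC.tensor_lift(1)[OF tmap_bilin VW.T.cvec_axioms])

lemma ta_pure_l: "m \<in> carrier VW.T \<Longrightarrow> y \<in> carrier A \<Longrightarrow> z \<in> carrier C \<Longrightarrow>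
    ta (AC.pt y z) m = tm y z m"
  unfolding tensor_act_def by (rule AC.tensor_lift(2)[OF tmap_bilin VW.T.cvec_axioms])

lemmas taD_l = lin_homD[OF ta_lin_l]

lemma ta_lin: 
  assumes "s \<in> carrier AC.T" shows "ta s \<in> lin_hom VW.T VW.T"
proof (rule lin_homI)
  fix m m' assume m: "m \<in> carrier VW.T" "m' \<in> carrier VW.T"
  show "ta s (m \<oplus>\<^bsub>VW.T\<^esub> m') = ta s m \<oplus>\<^bsub>VW.T\<^esub> ta s m'"
    using assms by (induction s rule: AC.tensor_induct)
      (use m in \<open>simp_all add: taD_l ta_pure_l tmapD VW.T.M.a_ac\<close>)
next
  fix c m assume m: "m \<in> carrier VW.T"
  show "ta s (c \<odot>\<^bsub>VW.T\<^esub> m) = c \<odot>\<^bsub>VW.T\<^esub> ta s m"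
    using assms by (induction s rule: AC.tensor_induct)
      (use m in \<open>simp_all add: taD_l ta_pure_l tmapD VW.T.smult_add_r\<close>)
qed (use assms taD_l(1) in blast)

lemmas taD = lin_homD[OF ta_lin]

lemma ta_pure: "v \<in> carrier V \<Longrightarrow> w \<in> carrier W \<Longrightarrow> y \<in> carrier A \<Longrightarrow> z \<in> carrier C \<Longrightarrow>
    ta (AC.pt y z) (VW.pt v w) = VW.pt (act V y v) (act W z w)"
  by (simp add: ta_pure_l tmap)

lemma ta_one: "m \<in> carrier VW.T \<Longrightarrow> ta (AC.pt \<one>\<^bsub>A\<^esub> \<one>\<^bsub>C\<^esub>) m = m"
  by (induction m rule: VW.tensor_induct) (simp_all add: ta_pure V.act_one W.act_one taD)

lemma ta_mult:
  assumes "s \<in> carrier AC.T" "t \<in> carrier AC.T" "m \<in> carrier VW.T"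
  shows "ta (s \<otimes>\<^bsub>AC.TA\<^esub> t) m = ta s (ta t m)"
  using assms(1)
proof (induction s rule: AC.tensor_induct)
  case (pure a c)
  note p = pure
  show ?case using assms(2)
  proof (induction t rule: AC.tensor_induct)
    case (pure a' c')
    show ?case using assms(3)
      by (induction m rule: VW.tensor_induct)
        (use p pure in \<open>simp_all add: ta_pure V.act_mult W.act_mult V.act_simps W.act_simps taD\<close>)
  next
    case (add t t')
    then show ?case using p assms(3) by (simp add: AC.mult_add_r taD_l taD AC.mult_closed)
  qed
next
  case (add s s')
  then show ?case using assms by (simp add: AC.mult_add_l taD_l taD AC.mult_closed)
qed

end

lemma tensor_rep_simps [simp]:
  "carrier (tensor_rep D h V W) = carrier (tensor_space V W)"
  "zero (tensor_rep D h V W) = zero (tensor_space V W)"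
  "add (tensor_rep D h V W) = add (tensor_space V W)"
  "smult (tensor_rep D h V W) = smult (tensor_space V W)"
  "act (tensor_rep D h V W) x m = tensor_act (borel D h) (borel D h) V W (borel_coproduct D h x) m"
  by (simp_all add: tensor_rep_def tensor_act_def module.defs rep.defs)

context qalg
begin

lemma is_rep_tensor_rep:
  assumes "is_rep B V" "is_rep B W"
  shows "is_rep B (tensor_rep D h V W)"
proof -
  interpret VW: rep_pair B B V W
    unfolding rep_pair_def using assms by (simp add: repnI B.calg_axioms)
  note D = alg_homD[OF borel_coproduct(1), simplified]
  show ?thesis
    by (rule is_repI[OF cvec_cong[OF VW.VW.T.cvec_axioms]])
      (simp_all add: D VW.taD VW.taD_l VW.ta_one[simplified] VW.ta_mult)
qed

end

section \<open>The flip\<close>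

context tens
begin

interpretation WV: tens W V by (rule tensI) unfold_locales

definition flip :: "('v \<times> 'w \<Rightarrow>\<^sub>0 complex) set \<Rightarrow> ('w \<times> 'v \<Rightarrow>\<^sub>0 complex) set" where
  "flip = tensor_lift V W (tensor_space W V) (\<lambda>v w. pure_tensor W V w v)"

lemma flip:
  shows "flip \<in> lin_hom T (tensor_space W V)"
    "v \<in> carrier V \<Longrightarrow> w \<in> carrier W \<Longrightarrow> flip (pt v w) = pure_tensor W V w v"
proof -
  have "(\<lambda>v w. pure_tensor W V w v) \<in> bilin_hom V W (tensor_space W V)"
    by (rule bilin_homI) (simp_all add: WV.pureD)
  note * = tensor_lift[OF this WV.T.cvec_axioms]
  show "flip \<in> lin_hom T (tensor_space W V)"
    "v \<in> carrier V \<Longrightarrow> w \<in> carrier W \<Longrightarrow> flip (pt v w) = pure_tensor W V w v"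
    unfolding flip_def using * by auto
qed

end

lemma flip_flip:
  assumes "cvec V" "cvec W" "t \<in> carrier (tensor_space V W)"
  shows "tens.flip W V (tens.flip V W t) = t"
proof -
  interpret VW: tens V W using assms by (intro tensI)
  interpret WV: tens W V using assms by (intro tensI)
  have "(\<lambda>t. WV.flip (VW.flip t)) t = (\<lambda>t. t) t"
    by (rule VW.tensor_eqI[OF lin_hom_comp[OF VW.flip(1) WV.flip(1)] _ _ assms(3)])
      (simp_all add: VW.flip WV.flip lin_hom_def)
  then show ?thesis by simp
qed

lemma bij_betw_flip:
  assumes "cvec V" "cvec W"
  shows "bij_betw (tens.flip V W) (carrier (tensor_space V W)) (carrier (tensor_space W V))"
proof -
  interpret VW: tens V W using assms by (intro tensI)
  interpret WV: tens W V using assms by (intro tensI)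
  show ?thesis
    by (rule bij_betwI[of _ _ _ "tens.flip W V"])
      (auto simp: flip_flip[OF assms] flip_flip[OF assms(2,1)] lin_homD(1)[OF VW.flip(1)] lin_homD(1)[OF WV.flip(1)])
qed

lemma tensor_pullback:
  "tensor_space (pullback \<sigma> V) (pullback \<tau> W) = tensor_space V W"
  "pure_tensor (pullback \<sigma> V) (pullback \<tau> W) = pure_tensor V W"
  by (simp_all add: fun_eq_iff tensor_space_def pure_tensor_def tensor_null_def tensor_rels_def)

context qpair
begin

text \<open>Since both sides are representations, the elements \<open>x\<close> for which the flip is equivariant form a
  subalgebra, and for the generators pure tensors suffice. For \<open>x = e\<^sub>i\<close> both sides send \<open>v \<otimes> w\<close> to
  \<open>- (k\<^sup>-\<^sup>1 w \<otimes> k\<^sup>-\<^sup>1 e v + k\<^sup>-\<^sup>1 e w \<otimes> v)\<close>, where \<open>e\<close> and \<open>k\<close> are the generators of the algebra for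
  \<open>q\<^sup>-\<^sup>1\<close>.\<close>

lemma flip_intertwines:
  assumes V: "is_rep M.B V" and W: "is_rep M.B W" and x: "x \<in> carrier P.B"
    and m: "m \<in> carrier (tensor_space V W)"
  shows "tens.flip V W (act (functor_F D h (tensor_rep D (- h) V W)) x m)
    = act (tensor_rep D h (functor_F D h W) (functor_F D h V)) x (tens.flip V W m)"
proof -
  let ?FV = "functor_F D h V" and ?FW = "functor_F D h W"
  interpret VW: rep_pair M.B M.B V W
    unfolding rep_pair_def using V W by (simp add: repnI M.B.calg_axioms)
  have FV: "is_rep P.B ?FV" "is_rep P.B ?FW"
    unfolding functor_F_def
    by (rule is_rep_pullback[OF sigma_B M.B.calg_axioms P.B.calg_axioms], rule V W)+
  interpret FWV: rep_pair P.B P.B ?FW ?FV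
    unfolding rep_pair_def using FV by (simp add: repnI P.B.calg_axioms)
  interpret L: repn P.B "functor_F D h (tensor_rep D (- h) V W)"
    unfolding functor_F_def
    by (intro repnI P.B.calg_axioms is_rep_pullback[OF sigma_B M.B.calg_axioms P.B.calg_axioms] M.is_rep_tensor_rep V W)
  interpret R: repn P.B "tensor_rep D h ?FW ?FV"
    by (intro repnI P.B.calg_axioms P.is_rep_tensor_rep FV)
  define \<theta> where "\<theta> = VW.VW.flip"
  let ?L = "act (functor_F D h (tensor_rep D (- h) V W))" and ?R = "act (tensor_rep D h ?FW ?FV)"
  interpret WV: tens W V by (rule tensI) unfold_locales
  have F [simp]: "carrier (functor_F D h X) = carrier X" "add (functor_F D h X) = add X"
    "smult (functor_F D h X) = smult X" "act (functor_F D h X) y = act X (sigma D h y)" for X y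
    by (simp_all add: functor_F_def)
  have TF [simp]: "tensor_space ?FW ?FV = tensor_space W V" "pure_tensor ?FW ?FV = pure_tensor W V"
    by (simp_all add: functor_F_def tensor_pullback)
  note \<theta> = VW.VW.flip[folded \<theta>_def]
  note \<theta>D = lin_homD[OF \<theta>(1)]
  note L = lin_homD[OF L.act_lin, simplified] lin_homD(2,3)[OF L.act_lin_l, simplified]
  note R = lin_homD[OF R.act_lin, simplified] lin_homD(2,3)[OF R.act_lin_l, simplified]
  interpret Z: repn M.B "tensor_rep D (- h) V W"
    by (intro repnI M.B.calg_axioms M.is_rep_tensor_rep V W)
  have M1: "\<one>\<^bsub>M.U\<^esub> \<in> carrier M.B" and P1: "\<one>\<^bsub>P.U\<^esub> \<in> carrier P.B"
    using M.U.subalgD(2)[OF M.subalg_B] P.U.subalgD(2)[OF P.subalg_B] by auto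
  have lk: "act V (ugen D (- h) (Kinv i)) (act V (ugen D (- h) (K i)) v) = v"
    if "i \<le> rank D" "v \<in> carrier V" for i v
    using VW.V.act_mult[of v "ugen D (- h) (Kinv i)" "ugen D (- h) (K i)"] that VW.V.act_one
    by (simp add: M.ugen_KKinv)
  have gen: "\<forall>m\<in>carrier VW.VW.T. \<theta> (?L x m) = ?R x (\<theta> m)"
    if "x \<in> carrier P.B" "\<And>v w. v \<in> carrier V \<Longrightarrow> w \<in> carrier W \<Longrightarrow>
      \<theta> (?L x (VW.VW.pt v w)) = ?R x (WV.pt w v)" for x
  proof
    fix m assume "m \<in> carrier VW.VW.T"
    then show "\<theta> (?L x m) = ?R x (\<theta> m)"
    proof (induction m rule: VW.VW.tensor_induct)
      case (pure v w)
      then show ?case using that by (simp only: \<theta>)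
    next
      case (add m m')
      then show ?case using that(1) L(1,2)[of x] R(1,2)[of x] by (simp add: \<theta>D)
    qed
  qed
  have "\<forall>m\<in>carrier VW.VW.T. \<theta> (?L x m) = ?R x (\<theta> m)" using x
  proof (induction x rule: P.B_induct)
    case one
    then show ?case using L.act_one R.act_one \<theta>D(1) by simp
  next
    case (mult x y)
    then show ?case using L.act_mult R.act_mult L(1) R(1) \<theta>D(1) by simp
  next
    case (add x y)
    then show ?case using L(1,4) R(1,4) \<theta>D(1,2) by simp
  next
    case (smult c x)
    then show ?case using L(1,5) R(1,5) \<theta>D(1,3) by simp
  next
    case (E i)
    note i = E
    show ?case
    proof (rule gen)
      fix v w assume v: "v \<in> carrier V" and w: "w \<in> carrier W"
      let ?e = "ugen D (- h) (E i)" and ?k = "ugen D (- h) (K i)" and ?l = "ugen D (- h) (Kinv i)"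
      note [simp] = VW.V.act_simps(1) VW.W.act_simps(1) M.bgen_closed
      have "?L (ugen D h (E i)) (VW.VW.pt v w) = (-1) \<odot>\<^bsub>VW.VW.T\<^esub>
          act (tensor_rep D (- h) V W) ?l (act (tensor_rep D (- h) V W) ?e (VW.VW.pt v w))"
        using Z.act_mult[of "VW.VW.pt v w" ?l ?e] Z.act_simps(5)[of "VW.VW.pt v w" "?l \<otimes>\<^bsub>M.U\<^esub> ?e" "-1"]
          v w i M.B.m_closed[of ?l ?e]
        by (simp add: sigma del: tensor_rep_simps(5))
      also have "act (tensor_rep D (- h) V W) ?e (VW.VW.pt v w)
          = VW.VW.pt (act V ?e v) w \<oplus>\<^bsub>VW.VW.T\<^esub> VW.VW.pt (act V ?k v) (act W ?e w)"
        using v w i M1 by (simp add: M.borel_coproduct VW.taD_l VW.ta_pure VW.W.act_one[simplified])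
      also have "act (tensor_rep D (- h) V W) ?l \<dots>
          = VW.VW.pt (act V ?l (act V ?e v)) (act W ?l w) \<oplus>\<^bsub>VW.VW.T\<^esub> VW.VW.pt v (act W ?l (act W ?e w))"
        using v w i lk[OF i v] by (simp add: M.borel_coproduct VW.taD VW.ta_pure)
      finally have "\<theta> (?L (ugen D h (E i)) (VW.VW.pt v w)) = (-1) \<odot>\<^bsub>WV.T\<^esub>
          (WV.pt (act W ?l w) (act V ?l (act V ?e v)) \<oplus>\<^bsub>WV.T\<^esub> WV.pt (act W ?l (act W ?e w)) v)"
        using v w i by (simp add: \<theta>D \<theta>(2))
      moreover have "?R (ugen D h (E i)) (WV.pt w v)
          = WV.pt (act W (sigma D h (ugen D h (E i))) w) v
            \<oplus>\<^bsub>WV.T\<^esub> WV.pt (act W ?l w) (act V (sigma D h (ugen D h (E i))) v)"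
        using v w i P1 by (simp add: P.borel_coproduct FWV.taD_l[simplified] FWV.ta_pure[simplified]
            FWV.W.act_one[simplified] sigma(3) alg_homD(2)[OF sigma_B, simplified] VW.V.act_one[simplified])
      moreover have "act V (sigma D h (ugen D h (E i))) v = (-1) \<odot>\<^bsub>V\<^esub> act V ?l (act V ?e v)"
        "act W (sigma D h (ugen D h (E i))) w = (-1) \<odot>\<^bsub>W\<^esub> act W ?l (act W ?e w)"
        using v w i M.B.m_closed[of ?l ?e] VW.V.act_mult[of v ?l ?e] VW.W.act_mult[of w ?l ?e]
          VW.V.act_simps(5)[of v "?l \<otimes>\<^bsub>M.U\<^esub> ?e" "-1"] VW.W.act_simps(5)[of w "?l \<otimes>\<^bsub>M.U\<^esub> ?e" "-1"]
        by (simp_all add: sigma)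
      ultimately show "\<theta> (?L (ugen D h (E i)) (VW.VW.pt v w)) = ?R (ugen D h (E i)) (WV.pt w v)"
        using v w i by (simp add: WV.pureD WV.T.smult_add_r WV.T.M.a_comm)
    qed (use i in simp)
  next
    case (K i)
    show ?case
      by (rule gen) (use K in \<open>simp_all add: sigma M.borel_coproduct P.borel_coproduct VW.ta_pure
        FWV.ta_pure[simplified] \<theta>(2) VW.V.act_simps(1) VW.W.act_simps(1)\<close>)
  next
    case (Kinv i)
    show ?case
      by (rule gen) (use Kinv in \<open>simp_all add: sigma M.borel_coproduct P.borel_coproduct VW.ta_pure
        FWV.ta_pure[simplified] \<theta>(2) VW.V.act_simps(1) VW.W.act_simps(1)\<close>)
  qed
  then show ?thesis using m \<theta>_def by simp
qed

end

theorem theorem1p1: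
  fixes D :: affine_datum and h :: complex
    and V :: "(ual, 'v) rep" and W :: "(ual, 'w) rep"
  assumes "untwisted_affine_datum D"
    and "\<forall>m::nat. m > 0 \<longrightarrow> exp h ^ m \<noteq> 1"
    and "category_O D (- h) V"
    and "category_O D (- h) W"
  shows "rep_isomorphic (borel D h)
           (functor_F D h (tensor_rep D (- h) V W))
           (tensor_rep D h (functor_F D h W) (functor_F D h V))"
proof -
  have P: "qdatum D h" using assms by (simp add: qdatum_def)
  interpret qpair D h
    using P qdatum_uminus[OF P] by (simp add: qpair_def qalg_def)
  have V: "is_rep M.B V" and W: "is_rep M.B W" using assms by (simp_all add: category_O_def)
  interpret V: repn M.B V by (rule repnI[OF M.B.calg_axioms V])
  interpret W: repn M.B W by (rule repnI[OF M.B.calg_axioms W])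
  interpret VW: tens V W by (rule tensI) unfold_locales
  note pb = is_rep_pullback[OF sigma_B M.B.calg_axioms P.B.calg_axioms]
  have FV: "is_rep P.B (functor_F D h V)" "is_rep P.B (functor_F D h W)"
    using V W pb by (auto simp: functor_F_def)
  have carr: "carrier (functor_F D h (tensor_rep D (- h) V W)) = carrier (tensor_space V W)"
      "carrier (tensor_rep D h (functor_F D h W) (functor_F D h V)) = carrier (tensor_space W V)"
    by (simp_all add: functor_F_def tensor_pullback)
  show ?thesis unfolding rep_isomorphic_def
  proof (intro conjI bexI[of _ VW.flip] ballI)
    show "is_rep P.B (functor_F D h (tensor_rep D (- h) V W))"
      unfolding functor_F_def by (intro pb M.is_rep_tensor_rep V W)
    show "is_rep P.B (tensor_rep D h (functor_F D h W) (functor_F D h V))"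
      by (intro P.is_rep_tensor_rep FV)
    show "bij_betw VW.flip (carrier (functor_F D h (tensor_rep D (- h) V W)))
        (carrier (tensor_rep D h (functor_F D h W) (functor_F D h V)))"
      unfolding carr by (rule bij_betw_flip[OF V.V.cvec_axioms W.V.cvec_axioms])
    show "VW.flip \<in> lin_hom (functor_F D h (tensor_rep D (- h) V W))
        (tensor_rep D h (functor_F D h W) (functor_F D h V))"
      using VW.flip(1) by (simp add: lin_hom_def functor_F_def tensor_pullback)
  qed (simp_all only: carr flip_intertwines[OF V W])
qed

end
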